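(* Let $K$ be a field of characteristic $p>0$, $A_n$ the $n$'th Weyl algebra over $K$, $P_m$ a polynomial algebra in $m\ge0$ variables over $K$ ($P_0:=K$), $A=A_n\otimes_KP_m$ and $s=2n+m$. For any $\sigma\in\operatorname{Aut}_K(A)$ and $a\in A$, $$\sigma^{-1}(a)=\sum_{\alpha,\beta\in\mathcal{N},\,\gamma\in\mathbb{N}^s}\phi_{Z,\sigma}\Big({\partial'}^{[\gamma]}\big(\Phi_\sigma({\delta'}^{[\alpha,\beta]}(a))\big)\Big)\,q^\alpha p^\beta x^\gamma=\sum_{\alpha,\beta\in\mathcal{N},\,\gamma\in\mathbb{N}^s}\phi_{Z,\sigma}\Big({\partial'}^{[\gamma]}\big(\Psi_\sigma({\delta'}^{[\alpha,\beta]}(a))\big)\Big)\,p^\beta q^\alpha x^\gamma ,$$ where ${\partial'}^{[\gamma]}:=\prod_{i=1}^{s}{\partial_i'}^{[\gamma_i]}$, ${\delta'}^{[\alpha,\beta]}:=(\alpha!\beta!)^{-1}\prod_{i=1}^n(\operatorname{ad}p_i')^{\alpha_i}\prod_{j=1}^n(-\operatorname{ad}q_j')^{\beta_j}$, and the remaining notation is as in the context.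
   Context: $\mathbb{N}=\{0,1,\ldots\}$, $(\operatorname{ad}r)(s)=rs-sr$. $A_n$ is the $K$-algebra generated by $q_1,\ldots,q_n,p_1,\ldots,p_n$ with defining relations $[p_i,q_j]=\delta_{ij}$ (Kronecker delta), $[p_i,p_j]=[q_i,q_j]=0$. (The characteristic $p$ should not be confused with the generators $p_i$; $p^\beta:=p_1^{\beta_1}\cdots p_n^{\beta_n}$, $q^\alpha:=q_1^{\alpha_1}\cdots q_n^{\alpha_n}$.) $P_m=K[x_{2n+1},\ldots,x_{2n+m}]$. Put $x_i:=q_i^p$, $x_{n+i}:=p_i^p$ ($p$-th powers) for $1\le i\le n$; the centre of $A$ is the polynomial algebra $Z=K[x_1,\ldots,x_s]$. $\mathcal{N}:=\{\alpha\in\mathbb{N}^n: 0\le\alpha_i<p \text{ for all } i\}$, $\alpha!=\prod\alpha_i!$, $x^\gamma=\prod_{i=1}^sx_i^{\gamma_i}$. Given $\sigma$, put $q_i':=\sigma(q_i)$, $p_i':=\sigma(p_i)$ ($1\le i\le n$), $x_j':=\sigma(x_j)$ ($1\le j\le s$), so $Z=K[x_1',\ldots,x_s']$. For $1\le i\le n$ define maps $A\to A$: $$\Phi_i':=\sum_{j=0}^{p-1}(-1)^j\frac{{q_i'}^j}{j!}(\operatorname{ad}p_i')^j,\quad \Psi_i':=\sum_{j=0}^{p-1}(-1)^j(\operatorname{ad}p_i')^j(\cdot)\frac{{q_i'}^j}{j!},$$ $$\Phi_{n+i}':=\sum_{j=0}^{p-1}\frac{{p_i'}^j}{j!}(\operatorname{ad}q_i')^j,\quad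 \Psi_{n+i}':=\sum_{j=0}^{p-1}(\operatorname{ad}q_i')^j(\cdot)\frac{{p_i'}^j}{j!},$$ and $\Phi_\sigma:=\Phi_{2n}'\Phi_{2n-1}'\cdots\Phi_1'$, $\Psi_\sigma:=\Psi_{2n}'\Psi_{2n-1}'\cdots\Psi_1'$; both have image $Z$. The higher derivations of $Z$ with respect to $x_1',\ldots,x_s'$: ${\partial_i'}^{[j]}:Z\to Z$ is the $K$-linear map ${x'}^\epsilon\mapsto\binom{\epsilon_i}{j}{x_1'}^{\epsilon_1}\cdots{x_i'}^{\epsilon_i-j}\cdots{x_s'}^{\epsilon_s}$ ($0$ if $\epsilon_i<j$). For $1\le i\le s$, $k\ge0$ put $\phi_{i,k}':=\sum_{j=0}^{p-1}(-1)^j\frac{{x_i'}^{p^kj}}{j!}({\partial_i'}^{[p^k]})^j$ and $\phi_i':=\cdots\phi_{i,1}'\phi_{i,0}':Z\to Z$ (if $u\in Z$ has degree $<p^{k+1}$ in $x_i'$ then $\phi_i'(u)=\phi_{i,k}'\cdots\phi_{i,0}'(u)$, further factors acting as the identity). The $\phi_i'$ commute and $\phi_{Z,\sigma}:=\prod_{i=1}^s\phi_i'$. *)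

theory Defs
  imports "HOL-Algebra.QuotRing" "HOL-Algebra.Module" "HOL-Library.Poly_Mapping"
begin

text \<open>
  The ground field is a type of class \<^class>\<open>field\<close>.  A (not necessarily commutative) unital
  algebra over it is represented by the record type of \<^theory>\<open>HOL-Algebra.Module\<close>, i.e. a ring
  record together with a scalar multiplication; the locale \<^locale>\<open>algebra\<close> of that theory
  is not used because it is restricted to commutative algebras.
\<close>

section \<open>Monoid algebras, quotients, tensor products\<close>

definition monoid_algebra :: "('w, 'b) monoid_scheme \<Rightarrow> ('k::field, 'w \<Rightarrow>\<^sub>0 'k) module" where
  "monoid_algebra M =
     \<lparr>carrier = {f. Poly_Mapping.keys f \<subseteq> carrier M},
      monoid.mult = (\<lambda>f g. \<Sum>u\<in>Poly_Mapping.keys f. \<Sum>v\<in>Poly_Mapping.keys g.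
        Poly_Mapping.single (u \<otimes>\<^bsub>M\<^esub> v) (Poly_Mapping.lookup f u * Poly_Mapping.lookup g v)),
      one = Poly_Mapping.single \<one>\<^bsub>M\<^esub> 1,
      ring.zero = 0,
      ring.add = (+),
      smult = (\<lambda>c. Poly_Mapping.map ((*) c))\<rparr>"

definition algebra_quot :: "('k, 'a) module \<Rightarrow> 'a set \<Rightarrow> ('k, 'a set) module" where
  "algebra_quot A I =
     ring.extend (A Quot I) (module.fields (\<lambda>c X. \<Union>x\<in>X. I +>\<^bsub>A\<^esub> (c \<odot>\<^bsub>A\<^esub> x)))"

text \<open>
  The tensor product \<open>B \<otimes> C\<close> is the free vector space on \<open>B \<times> C\<close> modulo the bilinear relations.
  The product \<open>(b \<otimes> c) (b' \<otimes> c') = b b' \<otimes> c c'\<close> on the free vector space is that of the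
  monoid algebra of the multiplicative monoid \<open>B \<times> C\<close>.  Multiplying a bilinear
  relation by a basis vector gives a bilinear relation again, so the ideal generated
  by the relations is just their linear span.
\<close>

definition tensor_relations ::
    "('k::field, 'b) module \<Rightarrow> ('k, 'c) module \<Rightarrow> ('b \<times> 'c \<Rightarrow>\<^sub>0 'k) set" where
  "tensor_relations B C =
     {Poly_Mapping.single (b \<oplus>\<^bsub>B\<^esub> b', c) 1 - Poly_Mapping.single (b, c) 1
        - Poly_Mapping.single (b', c) 1 | b b' c.
        b \<in> carrier B \<and> b' \<in> carrier B \<and> c \<in> carrier C}
   \<union> {Poly_Mapping.single (b, c \<oplus>\<^bsub>C\<^esub> c') 1 - Poly_Mapping.single (b, c) 1
        - Poly_Mapping.single (b, c') 1 | b c c'.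
        b \<in> carrier B \<and> c \<in> carrier C \<and> c' \<in> carrier C}
   \<union> {Poly_Mapping.single (k \<odot>\<^bsub>B\<^esub> b, c) 1 - Poly_Mapping.single (b, c) k | k b c.
        b \<in> carrier B \<and> c \<in> carrier C}
   \<union> {Poly_Mapping.single (b, k \<odot>\<^bsub>C\<^esub> c) 1 - Poly_Mapping.single (b, c) k | k b c.
        b \<in> carrier B \<and> c \<in> carrier C}"

definition tensor_ideal ::
    "('k::field, 'b) module \<Rightarrow> ('k, 'c) module \<Rightarrow> ('b \<times> 'c \<Rightarrow>\<^sub>0 'k) set" where
  "tensor_ideal B C = Idl\<^bsub>monoid_algebra (B \<times>\<times> C)\<^esub> (tensor_relations B C)"

definition tensor_algebra ::
    "('k::field, 'b) module \<Rightarrow> ('k, 'c) module \<Rightarrow> ('k, ('b \<times> 'c \<Rightarrow>\<^sub>0 'k) set) module" where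
  "tensor_algebra B C = algebra_quot (monoid_algebra (B \<times>\<times> C)) (tensor_ideal B C)"

definition tensor_elem ::
    "('k::field, 'b) module \<Rightarrow> ('k, 'c) module \<Rightarrow> 'b \<Rightarrow> 'c \<Rightarrow> ('b \<times> 'c \<Rightarrow>\<^sub>0 'k) set" where
  "tensor_elem B C b c =
     tensor_ideal B C +>\<^bsub>monoid_algebra (B \<times>\<times> C)\<^esub> Poly_Mapping.single (b, c) 1"

text \<open>
  Vector-space automorphisms that are ring automorphisms.  Only the values on the carrier matter.
\<close>

definition algebra_aut :: "('k, 'a) module \<Rightarrow> ('a \<Rightarrow> 'a) set" where
  "algebra_aut A =
     {\<sigma> \<in> ring_iso A A. \<forall>c. \<forall>a\<in>carrier A. \<sigma> (c \<odot>\<^bsub>A\<^esub> a) = c \<odot>\<^bsub>A\<^esub> \<sigma> a}"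

section \<open>Free algebras and polynomial algebras\<close>

definition free_monoid :: "'g set \<Rightarrow> 'g list monoid" where
  "free_monoid G = \<lparr>carrier = lists G, monoid.mult = (@), one = []\<rparr>"

definition free_algebra :: "'g set \<Rightarrow> ('k::field, 'g list \<Rightarrow>\<^sub>0 'k) module" where
  "free_algebra G = monoid_algebra (free_monoid G)"

text \<open>
  Exponents of monomials in variables with index set \<open>I\<close>.  They are total functions that vanish
  outside \<open>I\<close>; all index sets used below are finite.
\<close>

definition exponents :: "nat set \<Rightarrow> (nat \<Rightarrow> nat) set" where
  "exponents I = {\<epsilon>. \<forall>i. i \<notin> I \<longrightarrow> \<epsilon> i = 0}"

definition exponent_monoid :: "nat set \<Rightarrow> (nat \<Rightarrow> nat) monoid" where
  "exponent_monoid I =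
     \<lparr>carrier = exponents I, monoid.mult = (\<lambda>\<epsilon> \<eta> i. \<epsilon> i + \<eta> i), one = (\<lambda>i. 0)\<rparr>"

type_synonym 'k poly_rep = "(nat \<Rightarrow> nat) \<Rightarrow>\<^sub>0 'k"

definition poly_algebra :: "nat set \<Rightarrow> ('k::field, 'k poly_rep) module" where
  "poly_algebra I = monoid_algebra (exponent_monoid I)"

definition poly_var :: "nat \<Rightarrow> 'k::field poly_rep" where
  "poly_var i = Poly_Mapping.single (\<lambda>j. if j = i then 1 else 0) 1"

section \<open>The Weyl algebra and its tensor product with a polynomial algebra\<close>

datatype weyl_gen = Qgen nat | Pgen nat

type_synonym 'k weyl = "(weyl_gen list \<Rightarrow>\<^sub>0 'k) set"

definition weyl_gens :: "nat \<Rightarrow> weyl_gen set" where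
  "weyl_gens n = Qgen ` {1..n} \<union> Pgen ` {1..n}"

definition weyl_relations :: "nat \<Rightarrow> (weyl_gen list \<Rightarrow>\<^sub>0 'k::field) set" where
  "weyl_relations n =
     {Poly_Mapping.single [Pgen i, Qgen j] 1 - Poly_Mapping.single [Qgen j, Pgen i] 1
        - Poly_Mapping.single [] (if i = j then 1 else 0) | i j. i \<in> {1..n} \<and> j \<in> {1..n}}
   \<union> {Poly_Mapping.single [Pgen i, Pgen j] 1 - Poly_Mapping.single [Pgen j, Pgen i] 1 | i j.
        i \<in> {1..n} \<and> j \<in> {1..n}}
   \<union> {Poly_Mapping.single [Qgen i, Qgen j] 1 - Poly_Mapping.single [Qgen j, Qgen i] 1 | i j.
        i \<in> {1..n} \<and> j \<in> {1..n}}"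

definition weyl_ideal :: "nat \<Rightarrow> (weyl_gen list \<Rightarrow>\<^sub>0 'k::field) set" where
  "weyl_ideal n = Idl\<^bsub>free_algebra (weyl_gens n)\<^esub> (weyl_relations n)"

definition weyl_algebra :: "nat \<Rightarrow> ('k::field, 'k weyl) module" where
  "weyl_algebra n = algebra_quot (free_algebra (weyl_gens n)) (weyl_ideal n)"

definition weyl_elem :: "nat \<Rightarrow> weyl_gen \<Rightarrow> 'k::field weyl" where
  "weyl_elem n g = weyl_ideal n +>\<^bsub>free_algebra (weyl_gens n)\<^esub> Poly_Mapping.single [g] 1"

type_synonym 'k weyl_poly = "('k weyl \<times> 'k poly_rep \<Rightarrow>\<^sub>0 'k) set"

definition weyl_poly_algebra :: "nat \<Rightarrow> nat \<Rightarrow> ('k::field, 'k weyl_poly) module" where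
  "weyl_poly_algebra n m = tensor_algebra (weyl_algebra n) (poly_algebra {2*n+1..2*n+m})"

definition q_gen :: "nat \<Rightarrow> nat \<Rightarrow> nat \<Rightarrow> 'k::field weyl_poly" where
  "q_gen n m i = tensor_elem (weyl_algebra n) (poly_algebra {2*n+1..2*n+m})
     (weyl_elem n (Qgen i)) \<one>\<^bsub>poly_algebra {2*n+1..2*n+m}\<^esub>"

definition p_gen :: "nat \<Rightarrow> nat \<Rightarrow> nat \<Rightarrow> 'k::field weyl_poly" where
  "p_gen n m i = tensor_elem (weyl_algebra n) (poly_algebra {2*n+1..2*n+m})
     (weyl_elem n (Pgen i)) \<one>\<^bsub>poly_algebra {2*n+1..2*n+m}\<^esub>"

text \<open>
  The elements \<open>x\<^sub>1, \<dots>, x\<^sub>s\<close> with \<open>s = 2n + m\<close>; in the first \<open>2n\<close> of them \<open>p\<close> is the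
  characteristic of the ground field.
\<close>

definition x_gen :: "nat \<Rightarrow> nat \<Rightarrow> nat \<Rightarrow> nat \<Rightarrow> 'k::field weyl_poly" where
  "x_gen p n m j =
     (if j \<le> n then q_gen n m j [^]\<^bsub>(weyl_poly_algebra n m :: ('k, _) module)\<^esub> p
      else if j \<le> 2*n then p_gen n m (j - n) [^]\<^bsub>(weyl_poly_algebra n m :: ('k, _) module)\<^esub> p
      else tensor_elem (weyl_algebra n) (poly_algebra {2*n+1..2*n+m})
             \<one>\<^bsub>(weyl_algebra n :: ('k, _) module)\<^esub> (poly_var j))"

section \<open>Operators\<close>

text \<open>
  The composite \<open>F 1 \<circ> F 2 \<circ> \<dots> \<circ> F r\<close> and the composite \<open>F r \<circ> \<dots> \<circ> F 2 \<circ> F 1\<close>.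
\<close>

definition comp_prod :: "nat \<Rightarrow> (nat \<Rightarrow> 'a \<Rightarrow> 'a) \<Rightarrow> 'a \<Rightarrow> 'a" where
  "comp_prod r F = foldr F [1..<Suc r]"

definition comp_prod_rev :: "nat \<Rightarrow> (nat \<Rightarrow> 'a \<Rightarrow> 'a) \<Rightarrow> 'a \<Rightarrow> 'a" where
  "comp_prod_rev r F = fold F [1..<Suc r]"

definition ad :: "('a, 'b) ring_scheme \<Rightarrow> 'a \<Rightarrow> 'a \<Rightarrow> 'a" where
  "ad A r t = r \<otimes>\<^bsub>A\<^esub> t \<ominus>\<^bsub>A\<^esub> t \<otimes>\<^bsub>A\<^esub> r"

text \<open>The ordered monomial \<open>y\<^sub>1\<^bsup>\<epsilon> 1\<^esup> \<cdots> y\<^sub>r\<^bsup>\<epsilon> r\<^esup>\<close>.\<close>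

definition monomial_in :: "('a, 'b) ring_scheme \<Rightarrow> nat \<Rightarrow> (nat \<Rightarrow> 'a) \<Rightarrow> (nat \<Rightarrow> nat) \<Rightarrow> 'a" where
  "monomial_in A r y \<epsilon> = foldr (\<lambda>i a. y i [^]\<^bsub>A\<^esub> \<epsilon> i \<otimes>\<^bsub>A\<^esub> a) [1..<Suc r] \<one>\<^bsub>A\<^esub>"

text \<open>
  In the next two definitions \<open>c\<close> is \<open>1\<close> or \<open>- 1\<close>.  The inverse factorials are
  formed in the ground field; for \<open>j < p\<close> they exist there.
\<close>

definition left_ad_series ::
    "('k::field, 'a) module \<Rightarrow> nat \<Rightarrow> 'k \<Rightarrow> 'a \<Rightarrow> 'a \<Rightarrow> 'a \<Rightarrow> 'a" where
  "left_ad_series A p c u v a =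
     (\<Oplus>\<^bsub>A\<^esub>j\<in>{..<p}. (c ^ j / of_nat (fact j)) \<odot>\<^bsub>A\<^esub> (u [^]\<^bsub>A\<^esub> j \<otimes>\<^bsub>A\<^esub> (ad A v ^^ j) a))"

definition right_ad_series ::
    "('k::field, 'a) module \<Rightarrow> nat \<Rightarrow> 'k \<Rightarrow> 'a \<Rightarrow> 'a \<Rightarrow> 'a \<Rightarrow> 'a" where
  "right_ad_series A p c u v a =
     (\<Oplus>\<^bsub>A\<^esub>j\<in>{..<p}. (c ^ j / of_nat (fact j)) \<odot>\<^bsub>A\<^esub> ((ad A v ^^ j) a \<otimes>\<^bsub>A\<^esub> u [^]\<^bsub>A\<^esub> j))"

text \<open>
  The arguments \<open>q\<close>, \<open>p'\<close>, \<open>x\<close> of the following operators are the images under \<open>\<sigma>\<close> of the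
  canonical generators; \<open>p\<close> is the characteristic.
\<close>

definition Phi_factor ::
    "('k::field, 'a) module \<Rightarrow> nat \<Rightarrow> nat \<Rightarrow> (nat \<Rightarrow> 'a) \<Rightarrow> (nat \<Rightarrow> 'a) \<Rightarrow> nat \<Rightarrow> 'a \<Rightarrow> 'a" where
  "Phi_factor A p n q p' i =
     (if i \<le> n then left_ad_series A p (- 1) (q i) (p' i)
      else left_ad_series A p 1 (p' (i - n)) (q (i - n)))"

definition Psi_factor ::
    "('k::field, 'a) module \<Rightarrow> nat \<Rightarrow> nat \<Rightarrow> (nat \<Rightarrow> 'a) \<Rightarrow> (nat \<Rightarrow> 'a) \<Rightarrow> nat \<Rightarrow> 'a \<Rightarrow> 'a" where
  "Psi_factor A p n q p' i =
     (if i \<le> n then right_ad_series A p (- 1) (q i) (p' i)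
      else right_ad_series A p 1 (p' (i - n)) (q (i - n)))"

definition Phi_op ::
    "('k::field, 'a) module \<Rightarrow> nat \<Rightarrow> nat \<Rightarrow> (nat \<Rightarrow> 'a) \<Rightarrow> (nat \<Rightarrow> 'a) \<Rightarrow> 'a \<Rightarrow> 'a" where
  "Phi_op A p n q p' = comp_prod_rev (2*n) (Phi_factor A p n q p')"

definition Psi_op ::
    "('k::field, 'a) module \<Rightarrow> nat \<Rightarrow> nat \<Rightarrow> (nat \<Rightarrow> 'a) \<Rightarrow> (nat \<Rightarrow> 'a) \<Rightarrow> 'a \<Rightarrow> 'a" where
  "Psi_op A p n q p' = comp_prod_rev (2*n) (Psi_factor A p n q p')"

definition multi_fact :: "nat \<Rightarrow> (nat \<Rightarrow> nat) \<Rightarrow> nat" where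
  "multi_fact n \<alpha> = (\<Prod>i\<in>{1..n}. fact (\<alpha> i))"

definition delta_op ::
    "('k::field, 'a) module \<Rightarrow> nat \<Rightarrow> (nat \<Rightarrow> 'a) \<Rightarrow> (nat \<Rightarrow> 'a) \<Rightarrow> (nat \<Rightarrow> nat) \<Rightarrow> (nat \<Rightarrow> nat)
      \<Rightarrow> 'a \<Rightarrow> 'a" where
  "delta_op A n q p' \<alpha> \<beta> a =
     inverse (of_nat (multi_fact n \<alpha> * multi_fact n \<beta>)) \<odot>\<^bsub>A\<^esub>
       comp_prod n (\<lambda>i. ad A (p' i) ^^ \<alpha> i)
         (comp_prod n (\<lambda>j. (\<lambda>b. \<ominus>\<^bsub>A\<^esub> ad A (q j) b) ^^ \<beta> j) a)"

text \<open>
  Higher derivations of the polynomial algebra \<open>K[y\<^sub>1, \<dots>, y\<^sub>s]\<close> and their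
  transport to \<open>Z = K[x\<^sub>1, \<dots>, x\<^sub>s]\<close> along the evaluation \<open>y\<^sub>i \<mapsto> x\<^sub>i\<close>.  For \<open>z \<in> Z\<close>,
  \<open>z_coords A s x z\<close> is the polynomial in \<open>x\<^sub>1, \<dots>, x\<^sub>s\<close> that represents \<open>z\<close>; so \<open>hderiv\<close> is the
  linear map on \<open>Z\<close> that sends \<open>x\<^sup>\<epsilon>\<close> to \<open>(\<epsilon>\<^sub>i choose j)\<close> times the monomial with \<open>\<epsilon>\<^sub>i\<close> lowered
  by \<open>j\<close>.  The truncated subtraction is harmless because the coefficient is \<open>0\<close> if \<open>\<epsilon>\<^sub>i < j\<close>.
\<close>

definition poly_hderiv :: "nat \<Rightarrow> nat \<Rightarrow> 'k::field poly_rep \<Rightarrow> 'k poly_rep" where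
  "poly_hderiv i j f =
     (\<Sum>\<epsilon>\<in>Poly_Mapping.keys f.
        Poly_Mapping.single (\<epsilon>(i := \<epsilon> i - j)) (of_nat (\<epsilon> i choose j) * Poly_Mapping.lookup f \<epsilon>))"

definition poly_value ::
    "('k::field, 'a) module \<Rightarrow> nat \<Rightarrow> (nat \<Rightarrow> 'a) \<Rightarrow> 'k poly_rep \<Rightarrow> 'a" where
  "poly_value A s x f =
     (\<Oplus>\<^bsub>A\<^esub>\<epsilon>\<in>Poly_Mapping.keys f. Poly_Mapping.lookup f \<epsilon> \<odot>\<^bsub>A\<^esub> monomial_in A s x \<epsilon>)"

definition z_coords ::
    "('k::field, 'a) module \<Rightarrow> nat \<Rightarrow> (nat \<Rightarrow> 'a) \<Rightarrow> 'a \<Rightarrow> 'k poly_rep" where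
  "z_coords A s x = inv_into (carrier (poly_algebra {1..s})) (poly_value A s x)"

definition hderiv ::
    "('k::field, 'a) module \<Rightarrow> nat \<Rightarrow> (nat \<Rightarrow> 'a) \<Rightarrow> nat \<Rightarrow> nat \<Rightarrow> 'a \<Rightarrow> 'a" where
  "hderiv A s x i j z = poly_value A s x (poly_hderiv i j (z_coords A s x z))"

definition hderiv_multi ::
    "('k::field, 'a) module \<Rightarrow> nat \<Rightarrow> (nat \<Rightarrow> 'a) \<Rightarrow> (nat \<Rightarrow> nat) \<Rightarrow> 'a \<Rightarrow> 'a" where
  "hderiv_multi A s x \<gamma> = comp_prod s (\<lambda>i. hderiv A s x i (\<gamma> i))"

definition phi_level ::
    "('k::field, 'a) module \<Rightarrow> nat \<Rightarrow> nat \<Rightarrow> (nat \<Rightarrow> 'a) \<Rightarrow> nat \<Rightarrow> nat \<Rightarrow> 'a \<Rightarrow> 'a" where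
  "phi_level A p s x i k u =
     (\<Oplus>\<^bsub>A\<^esub>j\<in>{..<p}. ((- 1) ^ j / of_nat (fact j)) \<odot>\<^bsub>A\<^esub>
        (x i [^]\<^bsub>A\<^esub> (p ^ k * j) \<otimes>\<^bsub>A\<^esub> (hderiv A s x i (p ^ k) ^^ j) u))"

text \<open>
  The infinite composite \<open>\<cdots> \<circ> \<phi>\<^sub>i\<^sub>,\<^sub>1 \<circ> \<phi>\<^sub>i\<^sub>,\<^sub>0\<close>: on each element of \<open>Z\<close> the finite composites
  are eventually constant, and the value is the eventual one.
\<close>

definition phi_var ::
    "('k::field, 'a) module \<Rightarrow> nat \<Rightarrow> nat \<Rightarrow> (nat \<Rightarrow> 'a) \<Rightarrow> nat \<Rightarrow> 'a \<Rightarrow> 'a" where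
  "phi_var A p s x i u =
     (THE v. \<forall>\<^sub>F N in sequentially. fold (phi_level A p s x i) [0..<N] u = v)"

definition phi_Z ::
    "('k::field, 'a) module \<Rightarrow> nat \<Rightarrow> nat \<Rightarrow> (nat \<Rightarrow> 'a) \<Rightarrow> 'a \<Rightarrow> 'a" where
  "phi_Z A p s x = comp_prod s (phi_var A p s x)"

section \<open>Index sets and sums\<close>

definition restricted_exponents :: "nat \<Rightarrow> nat \<Rightarrow> (nat \<Rightarrow> nat) set" where
  "restricted_exponents p n = {\<alpha> \<in> exponents {1..n}. \<forall>i\<in>{1..n}. \<alpha> i < p}"

text \<open>
  The sum over a possibly infinite index set of a family with only finitely many nonzero terms.
\<close>

definition is_finitary_sum ::
    "('a, 'b) ring_scheme \<Rightarrow> 'i set \<Rightarrow> ('i \<Rightarrow> 'a) \<Rightarrow> 'a \<Rightarrow> bool" where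
  "is_finitary_sum A I f v \<longleftrightarrow>
     f ` I \<subseteq> carrier A \<and> finite {i \<in> I. f i \<noteq> \<zero>\<^bsub>A\<^esub>} \<and>
     v = (\<Oplus>\<^bsub>A\<^esub>i\<in>{i \<in> I. f i \<noteq> \<zero>\<^bsub>A\<^esub>}. f i)"

end

theory Submission
  imports Defs Complex_Main "HOL-Library.Function_Algebras" "HOL-Number_Theory.Cong"
begin

text \<open>
  The inverse automorphism is determined by the normal form of \<open>b = \<sigma>\<^sup>-\<^sup>1(a)\<close>.  Moving generators past each
  other and moving \<open>p\<close>-th powers, which are central, to the end, every element of \<open>A\<close> becomes a
  linear combination \<open>b = \<Sum> c\<^sub>\<alpha>\<^sub>\<beta>\<^sub>\<gamma> q\<^sup>\<alpha> p\<^sup>\<beta> x\<^sup>\<gamma>\<close> with \<open>\<alpha>\<^sub>i, \<beta>\<^sub>i < p\<close> (\<open>normal_form\<close>).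
  Applying \<open>\<sigma>\<close> gives \<open>a = \<Sum> c\<^sub>\<alpha>\<^sub>\<beta>\<^sub>\<gamma> q'\<^sup>\<alpha> p'\<^sup>\<beta> x'\<^sup>\<gamma>\<close> with the same coefficients.  The formula
  asserts that the operators in it, which are built from the primed generators alone, read off
  \<open>c\<^sub>\<alpha>\<^sub>\<beta>\<^sub>\<gamma>\<close> from \<open>a\<close>.  All of them are linear, so only their effect on the products
  \<open>q'\<^sup>a p'\<^sup>b x'\<^sup>\<gamma>\<close> matters, and they act there by operations on exponents:
  
  \<^item> \<open>\<delta>'\<^sup>[\<^sup>\<alpha>\<^sup>,\<^sup>\<beta>\<^sup>]\<close> is a divided partial derivative, since \<open>ad p'\<^sub>i\<close> and \<open>- ad q'\<^sub>i\<close> differentiate by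
    \<open>q'\<^sub>i\<close> and \<open>p'\<^sub>i\<close>.  It kills the products with \<open>a\<^sub>i < \<alpha>\<^sub>i\<close> or \<open>b\<^sub>i < \<beta>\<^sub>i\<close> for some \<open>i\<close>.
  \<^item> \<open>\<Phi>\<^sub>\<sigma>\<close> kills the products in which some \<open>q'\<^sub>i\<close> or \<open>p'\<^sub>i\<close> remains, and fixes those of the \<open>x'\<^sub>j\<close>.
    The factors for the \<open>q'\<^sub>i\<close> act first.  Each factor multiplies a product with exponent \<open>a\<close> by
    \<open>\<Sum>j<p. (-1)\<^sup>j (a choose j)\<close>, which in characteristic \<open>p\<close> is \<open>1\<close> if \<open>p\<close> divides \<open>a\<close> and \<open>0\<close>
    otherwise (\<open>truncated_alternating_sum\<close>).  Together, \<open>\<Phi>\<^sub>\<sigma> \<circ> \<delta>'\<^sup>[\<^sup>\<alpha>\<^sup>,\<^sup>\<beta>\<^sup>]\<close> sends \<open>a\<close> to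
    \<open>\<Sum>\<gamma>. c\<^sub>\<alpha>\<^sub>\<beta>\<^sub>\<gamma> x'\<^sup>\<gamma>\<close> (\<open>center_coefficient\<close>).
  \<^item> On the centre, \<open>\<partial>'\<^sup>[\<^sup>\<gamma>\<^sup>]\<close> and \<open>\<phi>\<^sub>Z\<^sub>,\<^sub>\<sigma>\<close> do the same for the \<open>x'\<^sub>j\<close>.  Their exponents are
    unbounded; because \<open>(\<epsilon> choose p\<^sup>k)\<close> is the quotient \<open>\<epsilon> div p\<^sup>k\<close> modulo \<open>p\<close>
    (\<open>of_nat_choose_prime_power\<close>), the factor number \<open>k\<close> tests whether digit number \<open>k\<close> of the exponent in
    base \<open>p\<close> vanishes.  All digits together detect the exponent \<open>0\<close> (\<open>constant_coefficient_mon\<close>).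
  
  The higher derivations are defined through coordinates with respect to the \<open>x'\<^sub>j\<close>, so the argument
  rests on the algebraic independence of the \<open>x\<^sub>j\<close> (\<open>x_independent\<close>).  It is seen in a representation
  on polynomials in which \<open>q\<^sub>i\<close>, \<open>t\<^sub>j\<close> multiply by variables and \<open>p\<^sub>i\<close> acts as \<open>X\<^sub>n\<^sub>+\<^sub>i + \<partial>\<^sub>i\<close>.
  
  The formula for \<open>\<Psi>\<^sub>\<sigma>\<close> is the same computation in the opposite algebra, where right factors become
  left factors and commutators change sign.  The calculus is therefore developed for families
  with \<open>[p\<^sub>i, q\<^sub>i] = e\<close>, where \<open>e\<^sup>2 = 1\<close>.
\<close>

abbreviation "keys \<equiv> Poly_Mapping.keys"
abbreviation "lookup \<equiv> Poly_Mapping.lookup"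
abbreviation "single \<equiv> Poly_Mapping.single"

section \<open>Linear algebra over a field inside ring records\<close>

locale unital_algebra = ring A for A :: "('k::field, 'a) module" (structure) +
  assumes smult_closed [simp, intro]: "a \<in> carrier A \<Longrightarrow> c \<odot> a \<in> carrier A"
    and smult_l_distr: "a \<in> carrier A \<Longrightarrow> (c + d) \<odot> a = c \<odot> a \<oplus> d \<odot> a"
    and smult_r_distr: "a \<in> carrier A \<Longrightarrow> b \<in> carrier A \<Longrightarrow> c \<odot> (a \<oplus> b) = c \<odot> a \<oplus> c \<odot> b"
    and smult_smult: "a \<in> carrier A \<Longrightarrow> c \<odot> (d \<odot> a) = (c * d) \<odot> a"
    and smult_one [simp]: "a \<in> carrier A \<Longrightarrow> 1 \<odot> a = a"
    and smult_mult_left: "a \<in> carrier A \<Longrightarrow> b \<in> carrier A \<Longrightarrow> (c \<odot> a) \<otimes> b = c \<odot> (a \<otimes> b)"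
    and smult_mult_right: "a \<in> carrier A \<Longrightarrow> b \<in> carrier A \<Longrightarrow> a \<otimes> (c \<odot> b) = c \<odot> (a \<otimes> b)"
begin

lemma smult_zero_left [simp]: "a \<in> carrier A \<Longrightarrow> 0 \<odot> a = \<zero>"
  using smult_l_distr[of a 0 0] by (metis add.r_cancel_one smult_closed add_0)

lemma smult_zero_right [simp]: "c \<odot> \<zero> = \<zero>"
  by (metis mult_zero_right smult_smult smult_zero_left zero_closed)

lemma smult_minus_left: "a \<in> carrier A \<Longrightarrow> (- c) \<odot> a = \<ominus> (c \<odot> a)"
  by (metis add.right_inverse minus_equality smult_closed smult_l_distr smult_zero_left add.commute
      r_neg add_eq_0_iff)

lemma a_minus_smult: "a \<in> carrier A \<Longrightarrow> b \<in> carrier A \<Longrightarrow> a \<ominus> b = a \<oplus> (- 1) \<odot> b"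
  by (simp add: a_minus_def smult_minus_left)

lemma a_inv_smult: "a \<in> carrier A \<Longrightarrow> \<ominus> a = (- 1) \<odot> a"
  by (simp add: smult_minus_left)

end

definition vector_subspace :: "('k::field, 'a) module \<Rightarrow> 'a set \<Rightarrow> bool" where
  "vector_subspace A S \<longleftrightarrow> S \<subseteq> carrier A \<and> \<zero>\<^bsub>A\<^esub> \<in> S \<and>
     (\<forall>a\<in>S. \<forall>b\<in>S. a \<oplus>\<^bsub>A\<^esub> b \<in> S) \<and> (\<forall>c. \<forall>a\<in>S. c \<odot>\<^bsub>A\<^esub> a \<in> S)"

text \<open>
  Operators on the subalgebra generated by the \<open>x\<^sub>j\<close> have no meaning elsewhere; hence a domain \<open>S\<close>
  that may be smaller than the carrier.
\<close>

definition linear_map_on ::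
    "('k::field, 'a) module \<Rightarrow> 'a set \<Rightarrow> ('k, 'b) module \<Rightarrow> ('a \<Rightarrow> 'b) \<Rightarrow> bool" where
  "linear_map_on A S B F \<longleftrightarrow> (\<forall>a\<in>S. F a \<in> carrier B) \<and>
     (\<forall>a\<in>S. \<forall>b\<in>S. F (a \<oplus>\<^bsub>A\<^esub> b) = F a \<oplus>\<^bsub>B\<^esub> F b) \<and> (\<forall>c. \<forall>a\<in>S. F (c \<odot>\<^bsub>A\<^esub> a) = c \<odot>\<^bsub>B\<^esub> F a)"

text \<open>
  With finitely supported coefficient functions, linear combinations of a family depend linearly
  on the coefficients, and equality of coefficients is equality of functions.
\<close>

definition lincomb :: "('k::field, 'a) module \<Rightarrow> ('i \<Rightarrow> 'a) \<Rightarrow> ('i \<Rightarrow>\<^sub>0 'k) \<Rightarrow> 'a" where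
  "lincomb A g f = (\<Oplus>\<^bsub>A\<^esub>i\<in>keys f. lookup f i \<odot>\<^bsub>A\<^esub> g i)"

context unital_algebra
begin

lemma subspace_carrier: "vector_subspace A (carrier A)"
  by (simp add: vector_subspace_def)

lemma subspace_finsum:
  assumes "vector_subspace A S" "finite I" "\<And>i. i \<in> I \<Longrightarrow> g i \<in> S"
  shows "(\<Oplus>i\<in>I. g i) \<in> S"
  using assms(2,3)
proof (induction I rule: finite_induct)
  case empty
  then show ?case using assms(1) by (simp add: vector_subspace_def)
next
  case (insert i I)
  have "g \<in> I \<rightarrow> carrier A" "g i \<in> carrier A"
    using insert assms(1) by (auto simp: vector_subspace_def)
  then show ?case using insert assms(1) by (simp add: finsum_insert vector_subspace_def)
qed

lemma subspace_lincomb: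
  assumes "vector_subspace A S" "\<And>i. i \<in> keys f \<Longrightarrow> g i \<in> S"
  shows "lincomb A g f \<in> S"
  unfolding lincomb_def using assms
  by (intro subspace_finsum) (auto simp: vector_subspace_def)

lemma lincomb_closed:
  "(\<And>i. i \<in> keys f \<Longrightarrow> g i \<in> carrier A) \<Longrightarrow> lincomb A g f \<in> carrier A"
  by (rule subspace_lincomb[OF subspace_carrier])

lemma lincomb_cong:
  assumes "\<And>i. i \<in> keys f \<Longrightarrow> g i = h i"
    "\<And>i. i \<in> keys f \<Longrightarrow> h i \<in> carrier A"
  shows "lincomb A g f = lincomb A h f"
  unfolding lincomb_def by (rule finsum_cong') (auto simp: assms)

lemma lincomb_superset:
  assumes "finite F" "keys f \<subseteq> F" "\<And>i. i \<in> F \<Longrightarrow> g i \<in> carrier A"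
  shows "lincomb A g f = (\<Oplus>i\<in>F. lookup f i \<odot> g i)"
  unfolding lincomb_def
  by (rule add.finprod_mono_neutral_cong_left) (use assms in \<open>auto simp: in_keys_iff\<close>)

lemma lincomb_zero [simp]: "lincomb A g 0 = \<zero>"
  by (simp add: lincomb_def)

lemma lincomb_single:
  assumes "g i \<in> carrier A"
  shows "lincomb A g (single i c) = c \<odot> g i"
proof -
  have "lincomb A g (single i c)
      = (\<Oplus>j\<in>{i}. lookup (single i c) j \<odot> g j)"
    by (rule lincomb_superset) (use assms in auto)
  then show ?thesis using assms by simp
qed

lemma lincomb_add:
  assumes "\<And>i. i \<in> keys f \<union> keys h \<Longrightarrow> g i \<in> carrier A"
  shows "lincomb A g (f + h) = lincomb A g f \<oplus> lincomb A g h"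
proof -
  let ?F = "keys f \<union> keys h"
  have "lincomb A g (f + h) = (\<Oplus>i\<in>?F. lookup (f + h) i \<odot> g i)"
    by (rule lincomb_superset) (use assms Poly_Mapping.keys_add[of f h] in auto)
  also have "\<dots> = (\<Oplus>i\<in>?F. lookup f i \<odot> g i \<oplus> lookup h i \<odot> g i)"
    by (rule finsum_cong') (use assms in \<open>auto simp: lookup_add smult_l_distr\<close>)
  also have "\<dots> = (\<Oplus>i\<in>?F. lookup f i \<odot> g i) \<oplus> (\<Oplus>i\<in>?F. lookup h i \<odot> g i)"
    by (rule finsum_addf) (use assms in auto)
  also have "(\<Oplus>i\<in>?F. lookup f i \<odot> g i) = lincomb A g f"
    by (rule lincomb_superset[symmetric]) (use assms in auto)
  also have "(\<Oplus>i\<in>?F. lookup h i \<odot> g i) = lincomb A g h"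
    by (rule lincomb_superset[symmetric]) (use assms in auto)
  finally show ?thesis .
qed

lemma lincomb_sum:
  assumes "finite I" "\<And>i j. i \<in> I \<Longrightarrow> j \<in> keys (h i) \<Longrightarrow> g j \<in> carrier A"
  shows "lincomb A g (\<Sum>i\<in>I. h i) = (\<Oplus>i\<in>I. lincomb A g (h i))"
  using assms
proof (induction I rule: finite_induct)
  case (insert i I)
  have *: "g j \<in> carrier A" if "j \<in> keys (\<Sum>i\<in>I. h i)" for j
    using that insert.prems subsetD[OF keys_sum that] by auto
  have "lincomb A g (\<Sum>i\<in>insert i I. h i) = lincomb A g (h i) \<oplus> lincomb A g (\<Sum>i\<in>I. h i)"
    unfolding sum.insert[OF insert.hyps] by (rule lincomb_add) (use insert.prems * in auto)
  also have "lincomb A g (\<Sum>i\<in>I. h i) = (\<Oplus>i\<in>I. lincomb A g (h i))"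
    using insert.IH insert.prems by blast
  also have "lincomb A g (h i) \<oplus> \<dots> = (\<Oplus>i\<in>insert i I. lincomb A g (h i))"
    using insert by (subst finsum_insert) (auto intro!: lincomb_closed)
  finally show ?case .
qed simp

lemma linear_map_on_lincomb:
  assumes B: "unital_algebra B" and S: "vector_subspace A S" and F: "linear_map_on A S B F"
    and g: "\<And>i. i \<in> keys f \<Longrightarrow> g i \<in> S"
  shows "F (lincomb A g f) = lincomb B (\<lambda>i. F (g i)) f"
proof -
  interpret B: unital_algebra B by fact
  have F0: "F \<zero> = \<zero>\<^bsub>B\<^esub>"
  proof -
    have "F (0 \<odot> \<zero>) = 0 \<odot>\<^bsub>B\<^esub> F \<zero>" "F \<zero> \<in> carrier B"
      using F S unfolding linear_map_on_def vector_subspace_def by blast+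
    then show ?thesis by simp
  qed
  have "F (\<Oplus>i\<in>I. lookup f i \<odot> g i)
      = (\<Oplus>\<^bsub>B\<^esub>i\<in>I. lookup f i \<odot>\<^bsub>B\<^esub> F (g i))"
    if "finite I" "I \<subseteq> keys f" for I
    using that
  proof (induction I rule: finite_induct)
    case empty
    then show ?case by (simp add: F0)
  next
    case (insert i I)
    have gS: "g j \<in> S" if "j \<in> insert i I" for j using g that insert.prems by blast
    have S': "S \<subseteq> carrier A" "\<And>c a. a \<in> S \<Longrightarrow> c \<odot> a \<in> S" using S by (auto simp: vector_subspace_def)
    have s: "(\<Oplus>i\<in>I. lookup f i \<odot> g i) \<in> S"
      by (rule subspace_finsum[OF S]) (use insert gS S' in auto)
    have "F (\<Oplus>i\<in>insert i I. lookup f i \<odot> g i)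
      = F (lookup f i \<odot> g i \<oplus> (\<Oplus>i\<in>I. lookup f i \<odot> g i))"
      by (subst finsum_insert) (use insert gS S' in auto)
    also have "\<dots> = lookup f i \<odot>\<^bsub>B\<^esub> F (g i) \<oplus>\<^bsub>B\<^esub> F (\<Oplus>i\<in>I. lookup f i \<odot> g i)"
      using F gS[of i] s S'(2)[of "g i"] unfolding linear_map_on_def by simp
    also have "\<dots> = (\<Oplus>\<^bsub>B\<^esub>i\<in>insert i I. lookup f i \<odot>\<^bsub>B\<^esub> F (g i))"
    proof (subst B.finsum_insert)
      show "(\<lambda>i. lookup f i \<odot>\<^bsub>B\<^esub> F (g i)) \<in> I \<rightarrow> carrier B"
        using F gS unfolding linear_map_on_def by auto
      show "lookup f i \<odot>\<^bsub>B\<^esub> F (g i) \<in> carrier B"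
        using F gS unfolding linear_map_on_def by auto
    qed (use insert in auto)
    finally show ?case .
  qed
  then show ?thesis unfolding lincomb_def by auto
qed

lemma ad_closed [simp, intro]: "v \<in> carrier A \<Longrightarrow> a \<in> carrier A \<Longrightarrow> ad A v a \<in> carrier A"
  by (simp add: ad_def)

lemma smult_a_minus: 
  "a \<in> carrier A \<Longrightarrow> b \<in> carrier A \<Longrightarrow> c \<odot> (a \<ominus> b) = c \<odot> a \<ominus> c \<odot> b"
  by (simp add: a_minus_smult smult_r_distr smult_smult mult.commute)

lemma ad_add: "v \<in> carrier A \<Longrightarrow> a \<in> carrier A \<Longrightarrow> b \<in> carrier A \<Longrightarrow>
    ad A v (a \<oplus> b) = ad A v a \<oplus> ad A v b"
  unfolding ad_def by algebra

lemma ad_smult: "v \<in> carrier A \<Longrightarrow> a \<in> carrier A \<Longrightarrow> ad A v (c \<odot> a) = c \<odot> ad A v a"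
  by (simp add: ad_def smult_mult_left smult_mult_right smult_a_minus)

lemma ad_mult: "v \<in> carrier A \<Longrightarrow> a \<in> carrier A \<Longrightarrow> b \<in> carrier A \<Longrightarrow>
    ad A v (a \<otimes> b) = ad A v a \<otimes> b \<oplus> a \<otimes> ad A v b"
  unfolding ad_def by algebra

lemma ad_eq_zero_iff: "v \<in> carrier A \<Longrightarrow> a \<in> carrier A \<Longrightarrow> ad A v a = \<zero> \<longleftrightarrow> v \<otimes> a = a \<otimes> v"
  unfolding ad_def a_minus_def by (metis m_closed minus_equality minus_minus r_neg a_inv_closed)

abbreviation linear_op :: "('a \<Rightarrow> 'a) \<Rightarrow> bool" where
  "linear_op F \<equiv> linear_map_on A (carrier A) A F"

lemma linear_op_ad: "v \<in> carrier A \<Longrightarrow> linear_op (ad A v)"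
  by (auto simp: linear_map_on_def ad_add ad_smult)

lemma linear_map_on_smult: "linear_map_on A S A F \<Longrightarrow> linear_map_on A S A (\<lambda>a. c \<odot> F a)"
  by (auto simp: linear_map_on_def smult_r_distr smult_smult mult.commute)

lemma linear_map_on_lmult:
  "u \<in> carrier A \<Longrightarrow> linear_map_on A S A F \<Longrightarrow> linear_map_on A S A (\<lambda>a. u \<otimes> F a)"
  by (auto simp: linear_map_on_def r_distr smult_mult_right)

lemma linear_op_comp: "linear_op F \<Longrightarrow> linear_op G \<Longrightarrow> linear_op (\<lambda>a. F (G a))"
  by (auto simp: linear_map_on_def)

lemma linear_op_id: "linear_op (\<lambda>a. a)"
  by (auto simp: linear_map_on_def)

lemma linear_op_funpow: "linear_op F \<Longrightarrow> linear_op (F ^^ j)"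
  by (induction j) (auto simp: linear_map_on_def)

lemma smult_finsum:
  assumes "finite I" "g \<in> I \<rightarrow> carrier A"
  shows "c \<odot> (\<Oplus>i\<in>I. g i) = (\<Oplus>i\<in>I. c \<odot> g i)"
  using assms
proof (induction I rule: finite_induct)
  case (insert i I)
  then have "(\<lambda>i. c \<odot> g i) \<in> I \<rightarrow> carrier A" by auto
  with insert show ?case by (simp add: finsum_insert smult_r_distr finsum_closed)
qed simp

lemma linear_map_on_finsum:
  assumes "finite I" "\<And>i. i \<in> I \<Longrightarrow> linear_map_on A S A (F i)"
  shows "linear_map_on A S A (\<lambda>a. \<Oplus>i\<in>I. F i a)"
  unfolding linear_map_on_def
proof (intro conjI ballI allI)
  fix a b assume ab: "a \<in> S" "b \<in> S"
  have cl: "(\<lambda>i. F i a) \<in> I \<rightarrow> carrier A" if "a \<in> S" for a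
    using assms(2) that by (auto simp: linear_map_on_def)
  show "(\<Oplus>i\<in>I. F i a) \<in> carrier A" using cl[OF ab(1)] by (rule finsum_closed)
  have "(\<Oplus>i\<in>I. F i (a \<oplus> b)) = (\<Oplus>i\<in>I. F i a \<oplus> F i b)"
    by (rule finsum_cong') (use assms(2) ab in \<open>auto simp: linear_map_on_def\<close>)
  also have "\<dots> = (\<Oplus>i\<in>I. F i a) \<oplus> (\<Oplus>i\<in>I. F i b)"
    using cl ab by (intro finsum_addf) auto
  finally show "(\<Oplus>i\<in>I. F i (a \<oplus> b)) = (\<Oplus>i\<in>I. F i a) \<oplus> (\<Oplus>i\<in>I. F i b)" .
  fix c
  have "(\<Oplus>i\<in>I. F i (c \<odot> a)) = (\<Oplus>i\<in>I. c \<odot> F i a)"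
    by (rule finsum_cong') (use assms(2) ab in \<open>auto simp: linear_map_on_def\<close>)
  also have "\<dots> = c \<odot> (\<Oplus>i\<in>I. F i a)"
    by (rule smult_finsum[symmetric]) (use assms(1) cl[OF ab(1)] in auto)
  finally show "(\<Oplus>i\<in>I. F i (c \<odot> a)) = c \<odot> (\<Oplus>i\<in>I. F i a)" .
qed

lemma linear_op_foldr:
  assumes "\<And>i. i \<in> set xs \<Longrightarrow> linear_op (F i)"
  shows "linear_op (foldr F xs)"
  using assms
proof (induction xs)
  case Nil
  then show ?case using linear_op_id by (simp add: id_def)
next
  case (Cons i xs)
  have "linear_op (F i)" "linear_op (foldr F xs)" using Cons by auto
  from linear_op_comp[OF this] show ?case by (simp add: o_def)
qed

lemma linear_op_smultD: "linear_op F \<Longrightarrow> a \<in> carrier A \<Longrightarrow> F (c \<odot> a) = c \<odot> F a"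
  by (simp add: linear_map_on_def)

lemma finsum_smult_const:
  assumes "a \<in> carrier A" "finite I"
  shows "(\<Oplus>i\<in>I. c i \<odot> a) = (\<Sum>i\<in>I. c i) \<odot> a"
  using assms(2)
proof (induction I rule: finite_induct)
  case (insert i I)
  then show ?case using assms(1) by (simp add: finsum_insert smult_l_distr)
qed (use assms in simp)

end

section \<open>Monoid algebras and their modules\<close>

definition pscale :: "'k::field \<Rightarrow> ('i \<Rightarrow>\<^sub>0 'k) \<Rightarrow> 'i \<Rightarrow>\<^sub>0 'k" where
  "pscale c = Poly_Mapping.map ((*) c)"

lemma lookup_pscale [simp]: "lookup (pscale c f) i = c * lookup f i"
  unfolding pscale_def by transfer (simp add: when_def)

interpretation pm: vector_space pscale
  by standard (auto intro!: poly_mapping_eqI simp: lookup_add algebra_simps)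

abbreviation plinear :: "(('i \<Rightarrow>\<^sub>0 'k::field) \<Rightarrow> 'j \<Rightarrow>\<^sub>0 'k) \<Rightarrow> bool" where
  "plinear \<equiv> module_hom pscale pscale"

lemma plinearI:
  "(\<And>f g. T (f + g) = T f + T g) \<Longrightarrow> (\<And>c f. T (pscale c f) = pscale c (T f)) \<Longrightarrow> plinear T"
  by (auto simp: module_hom_def module_hom_axioms_def pm.module_axioms)

lemma pscale_single [simp]:
  "pscale c (single i d) = single i (c * d)"
  by (rule poly_mapping_eqI) (simp add: lookup_single when_def)

lemma keys_pscale: "keys (pscale c f) \<subseteq> keys f"
  by (auto simp: in_keys_iff)

lemma poly_mapping_sum_singles:
  "(\<Sum>i\<in>keys f. single i (lookup f i)) = f"
proof (rule poly_mapping_eqI)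
  fix k
  have "(\<Sum>i\<in>keys f. (lookup f i when i = k))
      = (\<Sum>i\<in>keys f. if i = k then lookup f k else 0)"
    by (rule sum.cong) (auto simp: when_def)
  then show "lookup (\<Sum>i\<in>keys f.
      single i (lookup f i)) k = lookup f k"
    by (simp add: lookup_sum lookup_single in_keys_iff)
qed

definition pm_extend :: "('i \<Rightarrow> 'j \<Rightarrow>\<^sub>0 'k) \<Rightarrow> ('i \<Rightarrow>\<^sub>0 'k::field) \<Rightarrow> 'j \<Rightarrow>\<^sub>0 'k" where
  "pm_extend g f = (\<Sum>i\<in>keys f. pscale (lookup f i) (g i))"

lemma pm_extend_superset:
  assumes "finite F" "keys f \<subseteq> F"
  shows "pm_extend g f = (\<Sum>i\<in>F. pscale (lookup f i) (g i))"
  unfolding pm_extend_def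
  by (rule sum.mono_neutral_left) (use assms in \<open>auto simp: in_keys_iff\<close>)

lemma pm_extend_single [simp]: "pm_extend g (single i c) = pscale c (g i)"
  by (subst pm_extend_superset[of "{i}"]) auto

lemma plinear_pm_extend: "plinear (pm_extend (g :: 'i \<Rightarrow> 'j \<Rightarrow>\<^sub>0 'k::field))"
proof (rule plinearI)
  fix f h :: "'i \<Rightarrow>\<^sub>0 'k"
  let ?F = "keys f \<union> keys h"
  show "pm_extend g (f + h) = pm_extend g f + pm_extend g h"
    using Poly_Mapping.keys_add[of f h]
    by (simp add: pm_extend_superset[of ?F] lookup_add pm.scale_left_distrib sum.distrib)
next
  fix c and f :: "'i \<Rightarrow>\<^sub>0 'k"
  show "pm_extend g (pscale c f) = pscale c (pm_extend g f)"
    using keys_pscale[of c f]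
    by (simp add: pm_extend_superset[of "keys f"] pm.scale_sum_right)
qed

lemmas pm_extend_add = module_hom.add[OF plinear_pm_extend]
  and pm_extend_scale = module_hom.scale[OF plinear_pm_extend]
  and pm_extend_zero [simp] = module_hom.zero[OF plinear_pm_extend]
  and pm_extend_diff = module_hom.diff[OF plinear_pm_extend]

lemma plinear_apply_pm_extend:
  assumes "plinear T"
  shows "T (pm_extend g f) = pm_extend (\<lambda>i. T (g i)) f"
  by (simp add: pm_extend_def module_hom.sum[OF assms] module_hom.scale[OF assms])

lemma pm_extend_cong:
  "(\<And>i. i \<in> keys f \<Longrightarrow> g i = h i) \<Longrightarrow> pm_extend g f = pm_extend h f"
  by (simp add: pm_extend_def)

lemma pm_extend_add_fun: "pm_extend (\<lambda>i. g i + h i) f = pm_extend g f + pm_extend h f"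
  by (simp add: pm_extend_def pm.scale_right_distrib sum.distrib)

lemma pm_extend_scale_fun: "pm_extend (\<lambda>i. pscale c (g i)) f = pscale c (pm_extend g f)"
  by (simp add: pm_extend_def pm.scale_sum_right mult.commute)

lemma pm_extend_zero_fun [simp]: "pm_extend (\<lambda>i. 0) f = 0"
  by (simp add: pm_extend_def)

lemma pm_extend_singles: "pm_extend (\<lambda>i. single i 1) f = f"
  using poly_mapping_sum_singles[of f] by (simp add: pm_extend_def)

lemma keys_pm_extend:
  assumes "\<And>i. i \<in> keys f \<Longrightarrow> keys (g i) \<subseteq> S"
  shows "keys (pm_extend g f) \<subseteq> S"
  unfolding pm_extend_def
  by (intro order.trans[OF keys_sum] UN_least order.trans[OF keys_pscale] assms)

lemma monoid_algebra_mult: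
  "f \<otimes>\<^bsub>monoid_algebra M\<^esub> g = pm_extend (\<lambda>u. pm_extend (\<lambda>v. single (u \<otimes>\<^bsub>M\<^esub> v) 1) g) f"
  by (simp add: monoid_algebra_def pm_extend_def pm.scale_sum_right)

lemma carrier_monoid_algebra:
  "f \<in> carrier (monoid_algebra M) \<longleftrightarrow> keys f \<subseteq> carrier M"
  by (simp add: monoid_algebra_def)

lemma monoid_algebra_simps [simp]:
  "\<zero>\<^bsub>monoid_algebra M\<^esub> = 0"
  "\<one>\<^bsub>monoid_algebra M\<^esub> = single \<one>\<^bsub>M\<^esub> 1"
  "f \<oplus>\<^bsub>monoid_algebra M\<^esub> g = f + g"
  "c \<odot>\<^bsub>monoid_algebra M\<^esub> f = pscale c f"
  by (simp_all add: monoid_algebra_def pscale_def)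

lemma monoid_algebra_mult_single [simp]:
  "single u c \<otimes>\<^bsub>monoid_algebra M\<^esub> single v d
    = single (u \<otimes>\<^bsub>M\<^esub> v) (c * d)"
  by (simp add: monoid_algebra_mult)

text \<open>
  A monoid acting by linear maps \<open>\<rho>\<close> acts through its monoid algebra: both sides are bilinear in \<open>f\<close>
  and \<open>g\<close>, and on basis elements the claim is the action law.
\<close>

lemma pm_extend_action_mult:
  assumes \<rho>: "\<And>u. u \<in> carrier M \<Longrightarrow> plinear (\<rho> u)"
    and mult: "\<And>u v x. u \<in> carrier M \<Longrightarrow> v \<in> carrier M \<Longrightarrow> \<rho> (u \<otimes>\<^bsub>M\<^esub> v) x = \<rho> u (\<rho> v x)"
    and f: "f \<in> carrier (monoid_algebra M)" and g: "g \<in> carrier (monoid_algebra M)"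
  shows "pm_extend (\<lambda>w. \<rho> w x) (f \<otimes>\<^bsub>monoid_algebra M\<^esub> g)
    = pm_extend (\<lambda>u. \<rho> u (pm_extend (\<lambda>v. \<rho> v x) g)) f"
proof -
  have "pm_extend (\<lambda>w. \<rho> w x) (f \<otimes>\<^bsub>monoid_algebra M\<^esub> g)
      = pm_extend (\<lambda>u. pm_extend (\<lambda>v. \<rho> (u \<otimes>\<^bsub>M\<^esub> v) x) g) f"
    by (simp add: monoid_algebra_mult plinear_apply_pm_extend[OF plinear_pm_extend])
  also have "\<dots> = pm_extend (\<lambda>u. \<rho> u (pm_extend (\<lambda>v. \<rho> v x) g)) f"
  proof (rule pm_extend_cong)
    fix u assume "u \<in> keys f"
    then have u: "u \<in> carrier M" using f by (auto simp: carrier_monoid_algebra)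
    have "\<rho> u (pm_extend (\<lambda>v. \<rho> v x) g) = pm_extend (\<lambda>v. \<rho> u (\<rho> v x)) g"
      by (rule plinear_apply_pm_extend[OF \<rho>[OF u]])
    also have "\<dots> = pm_extend (\<lambda>v. \<rho> (u \<otimes>\<^bsub>M\<^esub> v) x) g"
      by (rule pm_extend_cong) (use g u mult in \<open>auto simp: carrier_monoid_algebra\<close>)
    finally show "pm_extend (\<lambda>v. \<rho> (u \<otimes>\<^bsub>M\<^esub> v) x) g = \<rho> u (pm_extend (\<lambda>v. \<rho> v x) g)" by simp
  qed
  finally show ?thesis .
qed

lemma pm_extend_bilinear:
  "pm_extend (\<lambda>u. pm_extend (T u) (g + h)) f = pm_extend (\<lambda>u. pm_extend (T u) g) f + pm_extend (\<lambda>u. pm_extend (T u) h) f"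
  "pm_extend (\<lambda>u. pm_extend (T u) (pscale c g)) f = pscale c (pm_extend (\<lambda>u. pm_extend (T u) g) f)"
  by (simp_all add: pm_extend_add pm_extend_scale pm_extend_add_fun pm_extend_scale_fun)

lemma unital_algebra_monoid_algebra:
  assumes "monoid M"
  shows "unital_algebra (monoid_algebra M :: ('k::field, 'w \<Rightarrow>\<^sub>0 'k) module)"
proof -
  interpret M: monoid M by fact
  let ?A = "monoid_algebra M :: ('k, 'w \<Rightarrow>\<^sub>0 'k) module"
  have closed: "f \<otimes>\<^bsub>?A\<^esub> g \<in> carrier ?A" if "f \<in> carrier ?A" "g \<in> carrier ?A" for f g
    using that unfolding monoid_algebra_mult carrier_monoid_algebra
    by (intro keys_pm_extend) auto
  have assoc: "(f \<otimes>\<^bsub>?A\<^esub> g) \<otimes>\<^bsub>?A\<^esub> h = f \<otimes>\<^bsub>?A\<^esub> (g \<otimes>\<^bsub>?A\<^esub> h)"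
    if f: "f \<in> carrier ?A" and g: "g \<in> carrier ?A" and h: "h \<in> carrier ?A" for f g h
  proof -
    have hk: "v \<in> carrier M" if "v \<in> keys h" for v 
      using h that by (auto simp: carrier_monoid_algebra)
    \<comment> \<open>Both sides are linear in \<open>h\<close>; on a basis element the claim is associativity in \<open>M\<close>.\<close>
    have "(f \<otimes>\<^bsub>?A\<^esub> g) \<otimes>\<^bsub>?A\<^esub> single w 1 = f \<otimes>\<^bsub>?A\<^esub> (g \<otimes>\<^bsub>?A\<^esub> single w 1)"
      if w: "w \<in> carrier M" for w
    proof -
      have "(f \<otimes>\<^bsub>?A\<^esub> g) \<otimes>\<^bsub>?A\<^esub> single w 1
          = pm_extend (\<lambda>u. pm_extend (\<lambda>v. single ((u \<otimes>\<^bsub>M\<^esub> v) \<otimes>\<^bsub>M\<^esub> w) 1) g) f"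
        by (simp add: monoid_algebra_mult plinear_apply_pm_extend[OF plinear_pm_extend])
      also have "\<dots> = pm_extend (\<lambda>u. pm_extend (\<lambda>v. single (u \<otimes>\<^bsub>M\<^esub> (v \<otimes>\<^bsub>M\<^esub> w)) 1) g) f"
        by (intro pm_extend_cong)
          (use f g w in \<open>auto simp: carrier_monoid_algebra subset_iff M.m_assoc\<close>)
      also have "\<dots> = f \<otimes>\<^bsub>?A\<^esub> (g \<otimes>\<^bsub>?A\<^esub> single w 1)"
        by (simp add: monoid_algebra_mult plinear_apply_pm_extend[OF plinear_pm_extend])
      finally show ?thesis .
    qed
    note single = this
    have lin_right: "plinear (\<lambda>h. f \<otimes>\<^bsub>?A\<^esub> h)" for f
      by (rule plinearI) (simp_all add: monoid_algebra_mult pm_extend_bilinear)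
    have expand: "f \<otimes>\<^bsub>?A\<^esub> h = pm_extend (\<lambda>w. f \<otimes>\<^bsub>?A\<^esub> single w 1) h" for f
      using plinear_apply_pm_extend[OF lin_right, of f "\<lambda>w. single w 1" h]
      by (simp only: pm_extend_singles)
    have "(f \<otimes>\<^bsub>?A\<^esub> g) \<otimes>\<^bsub>?A\<^esub> h = pm_extend (\<lambda>w. (f \<otimes>\<^bsub>?A\<^esub> g) \<otimes>\<^bsub>?A\<^esub> single w 1) h"
      by (rule expand)
    also have "\<dots> = pm_extend (\<lambda>w. f \<otimes>\<^bsub>?A\<^esub> (g \<otimes>\<^bsub>?A\<^esub> single w 1)) h"
      by (rule pm_extend_cong) (rule single[OF hk])
    also have "\<dots> = f \<otimes>\<^bsub>?A\<^esub> (pm_extend (\<lambda>w. g \<otimes>\<^bsub>?A\<^esub> single w 1) h)"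
      by (rule plinear_apply_pm_extend[OF lin_right, symmetric])
    also have "\<dots> = f \<otimes>\<^bsub>?A\<^esub> (g \<otimes>\<^bsub>?A\<^esub> h)"
      by (simp only: expand[of g])
    finally show ?thesis .
  qed
  have one_l: "\<one>\<^bsub>?A\<^esub> \<otimes>\<^bsub>?A\<^esub> f = f" if "f \<in> carrier ?A" for f
  proof -
    have "\<one>\<^bsub>?A\<^esub> \<otimes>\<^bsub>?A\<^esub> f = pm_extend (\<lambda>v. single (\<one>\<^bsub>M\<^esub> \<otimes>\<^bsub>M\<^esub> v) 1) f"
      by (simp add: monoid_algebra_mult)
    also have "\<dots> = pm_extend (\<lambda>v. single v 1) f"
      by (rule pm_extend_cong) (use that in \<open>auto simp: carrier_monoid_algebra subset_iff\<close>)
    finally show ?thesis by (simp add: pm_extend_singles)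
  qed
  have one_r: "f \<otimes>\<^bsub>?A\<^esub> \<one>\<^bsub>?A\<^esub> = f" if "f \<in> carrier ?A" for f
  proof -
    have "f \<otimes>\<^bsub>?A\<^esub> \<one>\<^bsub>?A\<^esub> = pm_extend (\<lambda>v. single (v \<otimes>\<^bsub>M\<^esub> \<one>\<^bsub>M\<^esub>) 1) f"
      by (simp add: monoid_algebra_mult)
    also have "\<dots> = pm_extend (\<lambda>v. single v 1) f"
      by (rule pm_extend_cong) (use that in \<open>auto simp: carrier_monoid_algebra subset_iff\<close>)
    finally show ?thesis by (simp add: pm_extend_singles)
  qed
  show ?thesis
  proof (intro unital_algebra.intro unital_algebra_axioms.intro ringI abelian_groupI monoidI)
    fix f assume f: "f \<in> carrier ?A"
    show "\<exists>g\<in>carrier ?A. g \<oplus>\<^bsub>?A\<^esub> f = \<zero>\<^bsub>?A\<^esub>"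
      using f by (intro bexI[of _ "- f"]) (auto simp: carrier_monoid_algebra in_keys_iff subset_iff)
  next
    fix f g assume "f \<in> carrier ?A" "g \<in> carrier ?A"
    then show "f \<oplus>\<^bsub>?A\<^esub> g \<in> carrier ?A"
      using Poly_Mapping.keys_add[of f g] by (auto simp: carrier_monoid_algebra)
  next
    fix f c assume "f \<in> carrier ?A"
    then show "c \<odot>\<^bsub>?A\<^esub> f \<in> carrier ?A"
      using keys_pscale[of c f] by (auto simp: carrier_monoid_algebra)
  qed ((rule closed assoc one_l one_r; assumption) |
      (simp add: carrier_monoid_algebra; fail) |
      (simp add: monoid_algebra_mult pm_extend_add pm_extend_add_fun
          pm_extend_scale pm_extend_scale_fun pm.scale_left_distrib pm.scale_right_distrib add_ac))+
qed

lemma lincomb_monoid_algebra: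
  fixes M :: "('w, 'b) monoid_scheme" and f :: "'w \<Rightarrow>\<^sub>0 'k::field"
  assumes "monoid M" "f \<in> carrier (monoid_algebra M)"
  shows "lincomb (monoid_algebra M) (\<lambda>w. single w 1) f = f"
proof -
  interpret A: unital_algebra "monoid_algebra M :: ('k, 'w \<Rightarrow>\<^sub>0 'k) module"
    by (rule unital_algebra_monoid_algebra) fact
  have *: "(\<Oplus>\<^bsub>monoid_algebra M\<^esub>i\<in>I. single i (lookup f i))
      = (\<Sum>i\<in>I. single i (lookup f i))"
    if "finite I" "I \<subseteq> keys f" for I
    using that
  proof (induction I rule: finite_induct)
    case (insert i I)
    then show ?case using assms(2)
      by (subst A.finsum_insert) (auto simp: carrier_monoid_algebra)
  qed simp
  show ?thesis unfolding lincomb_def using *[of "keys f"]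
    by (simp add: poly_mapping_sum_singles)
qed

section \<open>Quotient algebras\<close>

definition algebra_hom :: "('k::field, 'a) module \<Rightarrow> ('k, 'b) module \<Rightarrow> ('a \<Rightarrow> 'b) set" where
  "algebra_hom A B = {h \<in> ring_hom A B. \<forall>c. \<forall>a\<in>carrier A. h (c \<odot>\<^bsub>A\<^esub> a) = c \<odot>\<^bsub>B\<^esub> h a}"

lemma algebra_homD:
  assumes "h \<in> algebra_hom A B"
  shows "a \<in> carrier A \<Longrightarrow> h a \<in> carrier B"
    and "a \<in> carrier A \<Longrightarrow> b \<in> carrier A \<Longrightarrow> h (a \<oplus>\<^bsub>A\<^esub> b) = h a \<oplus>\<^bsub>B\<^esub> h b"
    and "a \<in> carrier A \<Longrightarrow> b \<in> carrier A \<Longrightarrow> h (a \<otimes>\<^bsub>A\<^esub> b) = h a \<otimes>\<^bsub>B\<^esub> h b"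
    and "h \<one>\<^bsub>A\<^esub> = \<one>\<^bsub>B\<^esub>"
    and "a \<in> carrier A \<Longrightarrow> h (c \<odot>\<^bsub>A\<^esub> a) = c \<odot>\<^bsub>B\<^esub> h a"
  using assms by (auto simp: algebra_hom_def ring_hom_def)

lemma linear_map_on_algebra_hom: "h \<in> algebra_hom A B \<Longrightarrow> linear_map_on A (carrier A) B h"
  by (simp add: linear_map_on_def algebra_homD)

lemma ring_extend:
  assumes "ring R"
  shows "ring (ring.extend R r)"
proof -
  interpret R: ring R by fact
  have fields: "carrier (ring.extend R r) = carrier R" "monoid.mult (ring.extend R r) = monoid.mult R"
    "add (ring.extend R r) = add R" "one (ring.extend R r) = one R"
    "zero (ring.extend R r) = zero R"
    by (simp_all add: ring.extend_def)
  show ?thesis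
  proof (intro ringI abelian_groupI monoidI, unfold fields)
    show "\<exists>y\<in>carrier R. y \<oplus>\<^bsub>R\<^esub> x = \<zero>\<^bsub>R\<^esub>" if "x \<in> carrier R" for x
      using that R.l_neg by blast
  qed (rule R.m_closed R.a_closed R.m_assoc R.l_distr R.r_distr R.a_assoc R.zero_closed
      R.one_closed R.l_one R.r_one R.l_zero R.a_comm; assumption)+
qed

lemma algebra_quot_simps [simp]:
  "carrier (algebra_quot A I) = carrier (A Quot I)"
  "X \<oplus>\<^bsub>algebra_quot A I\<^esub> Y = X \<oplus>\<^bsub>A Quot I\<^esub> Y"
  "X \<otimes>\<^bsub>algebra_quot A I\<^esub> Y = X \<otimes>\<^bsub>A Quot I\<^esub> Y"
  "\<one>\<^bsub>algebra_quot A I\<^esub> = \<one>\<^bsub>A Quot I\<^esub>"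
  "\<zero>\<^bsub>algebra_quot A I\<^esub> = \<zero>\<^bsub>A Quot I\<^esub>"
  "c \<odot>\<^bsub>algebra_quot A I\<^esub> X = (\<Union>x\<in>X. I +>\<^bsub>A\<^esub> (c \<odot>\<^bsub>A\<^esub> x))"
  by (simp_all add: algebra_quot_def ring.defs module.defs)

locale algebra_ideal = unital_algebra A + ideal I A for A :: "('k::field, 'a) module" (structure) and I
begin

lemma ideal_smult: "i \<in> I \<Longrightarrow> c \<odot> i \<in> I"
proof -
  assume i: "i \<in> I"
  then have "i \<in> carrier A" by (rule Icarr)
  then have "c \<odot> i = (c \<odot> \<one>) \<otimes> i" by (simp add: smult_mult_left)
  also have "\<dots> \<in> I" by (rule I_l_closed) (use i in auto)
  finally show ?thesis .
qed

lemma coset_eq_iff: "a \<in> carrier A \<Longrightarrow> b \<in> carrier A \<Longrightarrow> I +> a = I +> b \<longleftrightarrow> a \<ominus> b \<in> I"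
  by (metis quotient_eq_iff_same_a_r_cos is_ideal)

lemma carrier_quot: "carrier (algebra_quot A I) = (\<lambda>a. I +> a) ` carrier A"
  by (auto simp: FactRing_simps)

lemma coset_smult:
  assumes a: "a \<in> carrier A"
  shows "c \<odot>\<^bsub>algebra_quot A I\<^esub> (I +> a) = I +> (c \<odot> a)"
proof -
  have "I +> (c \<odot> b) = I +> (c \<odot> a)" if b: "b \<in> I +> a" for b
  proof -
    obtain i where i: "i \<in> I" "b = i \<oplus> a" using b unfolding a_r_coset_def' by blast
    have iA: "i \<in> carrier A" by (rule Icarr) (rule i)
    have "c \<odot> b = c \<odot> i \<oplus> c \<odot> a" using a iA i(2) by (simp only: smult_r_distr)
    moreover have "x \<oplus> y \<ominus> y = x" if "x \<in> carrier A" "y \<in> carrier A" for x y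
      using that by algebra
    ultimately have "c \<odot> b \<ominus> c \<odot> a = c \<odot> i" using a iA by simp
    with ideal_smult[OF i(1)] have "c \<odot> b \<ominus> c \<odot> a \<in> I" by simp
    moreover have "c \<odot> b \<in> carrier A" "c \<odot> a \<in> carrier A" using i(2) iA a by simp_all
    ultimately show ?thesis by (subst coset_eq_iff)
  qed
  then have "(\<Union>b\<in>I +> a. I +> (c \<odot> b)) = (\<Union>b\<in>I +> a. I +> (c \<odot> a))" by (rule SUP_cong[OF refl])
  also have "\<dots> = I +> (c \<odot> a)" using a_rcos_self[OF a] by (intro UN_constant[THEN trans]) auto
  finally show ?thesis by (simp only: algebra_quot_simps)
qed

lemma quot_hom: "(\<lambda>a. I +> a) \<in> algebra_hom A (algebra_quot A I)"
  using rcos_ring_hom coset_smult by (auto simp: algebra_hom_def ring_hom_def)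

lemma unital_algebra_quot: "unital_algebra (algebra_quot A I)"
proof -
  let ?Q = "algebra_quot A I"
  note h = algebra_homD[OF quot_hom]
  have "ring ?Q"
    unfolding algebra_quot_def by (rule ring_extend[OF quotient_is_ring])
  then show ?thesis
    by (rule unital_algebra.intro, intro unital_algebra_axioms.intro; unfold carrier_quot)
      (elim imageE, simp only: h(2-5)[symmetric] smult_closed m_closed add.m_closed imageI
        smult_l_distr smult_r_distr smult_smult smult_one smult_mult_left smult_mult_right)+
qed

end

section \<open>Linear actions\<close>

text \<open>
  That an ideal given by generators is small is seen from a homomorphism that kills the
  generators.  Here the target consists of the linear maps of a vector space with basis.
\<close>

definition algebra_action :: "('k::field, 'a) module \<Rightarrow> ('a \<Rightarrow> ('v \<Rightarrow>\<^sub>0 'k) \<Rightarrow> 'v \<Rightarrow>\<^sub>0 'k) \<Rightarrow> bool" where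
  "algebra_action A \<rho> \<longleftrightarrow> (\<forall>a\<in>carrier A. plinear (\<rho> a)) \<and> (\<forall>x. \<rho> \<one>\<^bsub>A\<^esub> x = x) \<and>
     (\<forall>a\<in>carrier A. \<forall>b\<in>carrier A. \<forall>x. \<rho> (a \<oplus>\<^bsub>A\<^esub> b) x = \<rho> a x + \<rho> b x) \<and>
     (\<forall>a\<in>carrier A. \<forall>b\<in>carrier A. \<forall>x. \<rho> (a \<otimes>\<^bsub>A\<^esub> b) x = \<rho> a (\<rho> b x)) \<and>
     (\<forall>c. \<forall>a\<in>carrier A. \<forall>x. \<rho> (c \<odot>\<^bsub>A\<^esub> a) x = pscale c (\<rho> a x))"

lemma algebra_actionD:
  assumes "algebra_action A \<rho>"
  shows "a \<in> carrier A \<Longrightarrow> plinear (\<rho> a)" and "\<rho> \<one>\<^bsub>A\<^esub> x = x"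
    and "a \<in> carrier A \<Longrightarrow> b \<in> carrier A \<Longrightarrow> \<rho> (a \<oplus>\<^bsub>A\<^esub> b) x = \<rho> a x + \<rho> b x"
    and "a \<in> carrier A \<Longrightarrow> b \<in> carrier A \<Longrightarrow> \<rho> (a \<otimes>\<^bsub>A\<^esub> b) x = \<rho> a (\<rho> b x)"
    and "a \<in> carrier A \<Longrightarrow> \<rho> (c \<odot>\<^bsub>A\<^esub> a) x = pscale c (\<rho> a x)"
  using assms by (auto simp: algebra_action_def)

lemma algebra_action_monoid_algebra:
  fixes \<rho> :: "'w \<Rightarrow> ('v \<Rightarrow>\<^sub>0 'k::field) \<Rightarrow> 'v \<Rightarrow>\<^sub>0 'k"
  assumes "monoid M" and \<rho>: "\<And>u. u \<in> carrier M \<Longrightarrow> plinear (\<rho> u)"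
    and mult: "\<And>u v x. u \<in> carrier M \<Longrightarrow> v \<in> carrier M \<Longrightarrow> \<rho> (u \<otimes>\<^bsub>M\<^esub> v) x = \<rho> u (\<rho> v x)"
    and one: "\<And>x. \<rho> \<one>\<^bsub>M\<^esub> x = x"
  shows "algebra_action (monoid_algebra M) (\<lambda>f x. pm_extend (\<lambda>w. \<rho> w x) f)"
  unfolding algebra_action_def
proof (intro conjI ballI allI)
  fix f :: "'w \<Rightarrow>\<^sub>0 'k" assume f: "f \<in> carrier (monoid_algebra M)"
  have lin: "plinear (\<rho> w)" if "w \<in> keys f" for w
    using \<rho> f that by (auto simp: carrier_monoid_algebra)
  show "plinear (\<lambda>x. pm_extend (\<lambda>w. \<rho> w x) f)"
  proof (rule plinearI)
    fix x y
    have "pm_extend (\<lambda>w. \<rho> w (x + y)) f = pm_extend (\<lambda>w. \<rho> w x + \<rho> w y) f"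
      by (rule pm_extend_cong) (rule module_hom.add[OF lin])
    then show "pm_extend (\<lambda>w. \<rho> w (x + y)) f = pm_extend (\<lambda>w. \<rho> w x) f + pm_extend (\<lambda>w. \<rho> w y) f"
      by (simp add: pm_extend_add_fun)
  next
    fix c x
    have "pm_extend (\<lambda>w. \<rho> w (pscale c x)) f = pm_extend (\<lambda>w. pscale c (\<rho> w x)) f"
      by (rule pm_extend_cong) (rule module_hom.scale[OF lin])
    then show "pm_extend (\<lambda>w. \<rho> w (pscale c x)) f = pscale c (pm_extend (\<lambda>w. \<rho> w x) f)"
      by (simp add: pm_extend_scale_fun)
  qed
qed (simp_all add: one pm_extend_add pm_extend_scale pm_extend_action_mult[of M \<rho>, OF \<rho> mult])

text \<open>
  The elements that act as zero form a two-sided ideal, which contains \<open>Idl R\<close> as soon as it contains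
  \<open>R\<close>.  So all representatives of a coset act alike.
\<close>

lemma (in unital_algebra) algebra_action_quot:
  assumes \<rho>: "algebra_action A \<rho>" and R: "R \<subseteq> carrier A" and zero: "\<And>r x. r \<in> R \<Longrightarrow> \<rho> r x = 0"
  shows "\<exists>\<rho>'. algebra_action (algebra_quot A (Idl R)) \<rho>' \<and> (\<forall>a\<in>carrier A. \<rho>' (Idl R +> a) = \<rho> a)"
proof -
  note \<rho> = algebra_actionD[OF \<rho>]
  have minus: "\<rho> (a \<ominus> b) x = \<rho> a x - \<rho> b x" if "a \<in> carrier A" "b \<in> carrier A" for a b x
    using that by (simp add: a_minus_smult \<rho>)
  define J where "J = {a \<in> carrier A. \<forall>x. \<rho> a x = 0}"
  have "ideal J A"
  proof (rule idealI)
    show "ring A" by (rule ring_axioms)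
    show "subgroup J (add_monoid A)"
    proof (rule group.subgroupI[OF a_group])
      have "\<rho> \<zero> x = 0" for x using \<rho>(5)[OF zero_closed, of 0 x] by simp
      then show "J \<noteq> {}" by (auto simp: J_def)
      fix a assume "a \<in> J"
      then show "inv\<^bsub>add_monoid A\<^esub> a \<in> J"
        unfolding J_def a_inv_def[symmetric] by (auto simp: a_inv_smult \<rho>)
    qed (auto simp: J_def \<rho>)
  qed (auto simp: J_def \<rho> module_hom.zero[OF \<rho>(1)])
  moreover have "R \<subseteq> J" using R zero by (auto simp: J_def)
  ultimately have J: "Idl R \<subseteq> J" by (rule genideal_minimal)
  interpret I: algebra_ideal A "Idl R"
    by (intro algebra_ideal.intro unital_algebra_axioms genideal_ideal R)
  define \<rho>' where "\<rho>' X = \<rho> (SOME a. a \<in> X)" for X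
  have eq: "\<rho>' (Idl R +> a) = \<rho> a" if a: "a \<in> carrier A" for a
  proof -
    have "(SOME b. b \<in> Idl R +> a) \<in> Idl R +> a"
      by (rule someI) (rule I.a_rcos_self[OF a])
    then obtain i where i: "i \<in> Idl R" "(SOME b. b \<in> Idl R +> a) = i \<oplus> a"
      by (auto simp: a_r_coset_def')
    have "i \<in> J" using i J by blast
    then show ?thesis using a by (auto simp: \<rho>'_def i J_def \<rho>)
  qed
  note h = algebra_homD[OF I.quot_hom]
  have "algebra_action (algebra_quot A (Idl R)) \<rho>'"
    unfolding algebra_action_def I.carrier_quot
    by (auto simp: eq \<rho> h(4)[symmetric] h(2,3,5)[symmetric] simp del: algebra_quot_simps)
  with eq show ?thesis by blast
qed

section \<open>Presentations and tensor products\<close>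

lemma (in algebra_ideal) coset_ideal_elem: "i \<in> I \<Longrightarrow> I +> i = \<zero>\<^bsub>algebra_quot A I\<^esub>"
  by (simp add: FactRing_def a_rcos_const)

lemma quot_monoid_algebra_lincomb:
  fixes M :: "('w, 'b) monoid_scheme" and J :: "('w \<Rightarrow>\<^sub>0 'k::field) set"
  assumes M: "monoid M" and J: "algebra_ideal (monoid_algebra M) J"
    and X: "X \<in> carrier (algebra_quot (monoid_algebra M) J)"
  shows "\<exists>f. keys f \<subseteq> carrier M \<and>
    X = lincomb (algebra_quot (monoid_algebra M) J)
      (\<lambda>w. J +>\<^bsub>monoid_algebra M\<^esub> single w 1) f"
proof -
  interpret J: algebra_ideal "monoid_algebra M :: ('k, 'w \<Rightarrow>\<^sub>0 'k) module" J by fact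
  obtain f where f: "f \<in> carrier (monoid_algebra M)" "X = J +>\<^bsub>monoid_algebra M\<^esub> f"
    using X unfolding J.carrier_quot by blast
  then have keys: "keys f \<subseteq> carrier M" by (simp add: carrier_monoid_algebra)
  have "J +>\<^bsub>monoid_algebra M\<^esub> lincomb (monoid_algebra M) (\<lambda>w. single w 1) f
      = lincomb (algebra_quot (monoid_algebra M) J) (\<lambda>w. J +>\<^bsub>monoid_algebra M\<^esub> single w 1) f"
    by (rule J.linear_map_on_lincomb[OF J.unital_algebra_quot J.subspace_carrier
          linear_map_on_algebra_hom[OF J.quot_hom]])
      (use keys in \<open>auto simp: carrier_monoid_algebra\<close>)
  then show ?thesis using f keys lincomb_monoid_algebra[OF M f(1)] by metis
qed

locale tensor_product = B: unital_algebra B + C: unital_algebra C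
  for B :: "('k::field, 'b) module" and C :: "('k, 'c) module"
begin

abbreviation "BC \<equiv> (monoid_algebra (B \<times>\<times> C) :: ('k, 'b \<times> 'c \<Rightarrow>\<^sub>0 'k) module)"
abbreviation "T \<equiv> tensor_algebra B C"
abbreviation "te \<equiv> tensor_elem B C"

lemma monoid_BC: "monoid (B \<times>\<times> C)"
  by (rule DirProd_monoid[OF B.monoid_axioms C.monoid_axioms])

lemma tensor_relations_carrier: "tensor_relations B C \<subseteq> carrier BC"
proof -
  have s: "single w c \<in> carrier BC" if "w \<in> carrier (B \<times>\<times> C)" for w c
    using that by (simp add: carrier_monoid_algebra)
  have d: "f - g \<in> carrier BC" if "f \<in> carrier BC" "g \<in> carrier BC" for f g
    using that Poly_Mapping.keys_diff[of f g] unfolding carrier_monoid_algebra by blast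
  show ?thesis
    unfolding tensor_relations_def
    by (auto intro!: d s)
qed

lemma algebra_BC: "unital_algebra BC"
  by (rule unital_algebra_monoid_algebra[OF monoid_BC])

lemma tensor_ideal: "algebra_ideal BC (tensor_ideal B C)"
  unfolding tensor_ideal_def
  by (intro algebra_ideal.intro algebra_BC ring.genideal_ideal tensor_relations_carrier
      unital_algebra.axioms(1)[OF algebra_BC])

sublocale T: unital_algebra T
  unfolding tensor_algebra_def by (rule algebra_ideal.unital_algebra_quot[OF tensor_ideal])

lemma tensor_hom: "(\<lambda>f. tensor_ideal B C +>\<^bsub>BC\<^esub> f) \<in> algebra_hom BC T"
  unfolding tensor_algebra_def by (rule algebra_ideal.quot_hom[OF tensor_ideal])

lemma single_carrier:
  "b \<in> carrier B \<Longrightarrow> c \<in> carrier C \<Longrightarrow> single (b, c) (k::'k) \<in> carrier BC"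
  by (simp add: carrier_monoid_algebra)

lemma tensor_elem_closed [simp, intro]:
  "b \<in> carrier B \<Longrightarrow> c \<in> carrier C \<Longrightarrow> te b c \<in> carrier T"
  unfolding tensor_elem_def by (rule algebra_homD(1)[OF tensor_hom]) (rule single_carrier)

lemma tensor_coset_cong:
  assumes "f - g \<in> tensor_relations B C" and g: "g \<in> carrier BC"
  shows "tensor_ideal B C +>\<^bsub>BC\<^esub> f = tensor_ideal B C +>\<^bsub>BC\<^esub> g"
proof -
  have "tensor_relations B C \<subseteq> tensor_ideal B C"
    unfolding tensor_ideal_def
    by (rule ring.genideal_self[OF unital_algebra.axioms(1)[OF algebra_BC] tensor_relations_carrier])
  then have "tensor_ideal B C +>\<^bsub>BC\<^esub> (f - g) = \<zero>\<^bsub>T\<^esub>"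
    unfolding tensor_algebra_def using assms
    by (intro algebra_ideal.coset_ideal_elem[OF tensor_ideal]) blast
  moreover have "tensor_ideal B C +>\<^bsub>BC\<^esub> ((f - g) \<oplus>\<^bsub>BC\<^esub> g)
      = (tensor_ideal B C +>\<^bsub>BC\<^esub> (f - g)) \<oplus>\<^bsub>T\<^esub> (tensor_ideal B C +>\<^bsub>BC\<^esub> g)"
    using assms tensor_relations_carrier by (intro algebra_homD(2)[OF tensor_hom]) blast+
  moreover have "tensor_ideal B C +>\<^bsub>BC\<^esub> g \<in> carrier T"
    by (rule algebra_homD(1)[OF tensor_hom g])
  ultimately show ?thesis by simp
qed

lemma coset_single:
  assumes "b \<in> carrier B" "c \<in> carrier C"
  shows "tensor_ideal B C +>\<^bsub>BC\<^esub> single (b, c) k = k \<odot>\<^bsub>T\<^esub> te b c"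
  using algebra_homD(5)[OF tensor_hom single_carrier[OF assms], of k 1] by (simp add: tensor_elem_def)

lemma coset_add_singles:
  assumes "b \<in> carrier B" "c \<in> carrier C" "b' \<in> carrier B" "c' \<in> carrier C"
  shows "tensor_ideal B C +>\<^bsub>BC\<^esub> (single (b, c) 1 + single (b', c') 1)
    = te b c \<oplus>\<^bsub>T\<^esub> te b' c'"
  using algebra_homD(2)[OF tensor_hom single_carrier[OF assms(1,2)] single_carrier[OF assms(3,4)], of 1 1]
  by (simp add: tensor_elem_def)

lemma add_singles_carrier:
  assumes "b \<in> carrier B" "c \<in> carrier C" "b' \<in> carrier B" "c' \<in> carrier C"
  shows "single (b, c) 1 + single (b', c') 1 \<in> carrier BC"
  using ring.ring_simprules(1)[OF unital_algebra.axioms(1)[OF algebra_BC]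
      single_carrier[OF assms(1,2)] single_carrier[OF assms(3,4)], of 1 1]
  by simp

lemma tensor_elem_smult_left:
  assumes "b \<in> carrier B" "c \<in> carrier C"
  shows "te (k \<odot>\<^bsub>B\<^esub> b) c = k \<odot>\<^bsub>T\<^esub> te b c"
proof -
  have "te (k \<odot>\<^bsub>B\<^esub> b) c = tensor_ideal B C +>\<^bsub>BC\<^esub> (single (b, c) k)"
    unfolding tensor_elem_def
  proof (rule tensor_coset_cong)
    show "single (k \<odot>\<^bsub>B\<^esub> b, c) 1 - (single (b, c) k) \<in> tensor_relations B C"
      unfolding tensor_relations_def diff_diff_eq[symmetric] using assms by blast
  qed (use assms in \<open>auto intro: single_carrier add_singles_carrier\<close>)
  then show ?thesis using assms by (simp add: coset_single)
qed

lemma tensor_elem_smult_right: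
  assumes "b \<in> carrier B" "c \<in> carrier C"
  shows "te b (k \<odot>\<^bsub>C\<^esub> c) = k \<odot>\<^bsub>T\<^esub> te b c"
proof -
  have "te b (k \<odot>\<^bsub>C\<^esub> c) = tensor_ideal B C +>\<^bsub>BC\<^esub> (single (b, c) k)"
    unfolding tensor_elem_def
  proof (rule tensor_coset_cong)
    show "single (b, k \<odot>\<^bsub>C\<^esub> c) 1 - (single (b, c) k) \<in> tensor_relations B C"
      unfolding tensor_relations_def diff_diff_eq[symmetric] using assms by blast
  qed (use assms in \<open>auto intro: single_carrier add_singles_carrier\<close>)
  then show ?thesis using assms by (simp add: coset_single)
qed

lemma tensor_elem_add_left:
  assumes "b \<in> carrier B" "b' \<in> carrier B" "c \<in> carrier C"
  shows "te (b \<oplus>\<^bsub>B\<^esub> b') c = te b c \<oplus>\<^bsub>T\<^esub> te b' c"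
proof -
  have "te (b \<oplus>\<^bsub>B\<^esub> b') c = tensor_ideal B C +>\<^bsub>BC\<^esub> (single (b, c) 1 + single (b', c) 1)"
    unfolding tensor_elem_def
  proof (rule tensor_coset_cong)
    show "single (b \<oplus>\<^bsub>B\<^esub> b', c) 1 - (single (b, c) 1 + single (b', c) 1) \<in> tensor_relations B C"
      unfolding tensor_relations_def diff_diff_eq[symmetric] using assms by blast
  qed (use assms in \<open>auto intro: single_carrier add_singles_carrier\<close>)
  then show ?thesis using assms by (simp add: coset_add_singles)
qed

lemma tensor_elem_add_right:
  assumes "b \<in> carrier B" "c \<in> carrier C" "c' \<in> carrier C"
  shows "te b (c \<oplus>\<^bsub>C\<^esub> c') = te b c \<oplus>\<^bsub>T\<^esub> te b c'"
proof -
  have "te b (c \<oplus>\<^bsub>C\<^esub> c') = tensor_ideal B C +>\<^bsub>BC\<^esub> (single (b, c) 1 + single (b, c') 1)"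
    unfolding tensor_elem_def
  proof (rule tensor_coset_cong)
    show "single (b, c \<oplus>\<^bsub>C\<^esub> c') 1 - (single (b, c) 1 + single (b, c') 1) \<in> tensor_relations B C"
      unfolding tensor_relations_def diff_diff_eq[symmetric] using assms by blast
  qed (use assms in \<open>auto intro: single_carrier add_singles_carrier\<close>)
  then show ?thesis using assms by (simp add: coset_add_singles)
qed

lemma tensor_elem_mult:
  assumes "b \<in> carrier B" "b' \<in> carrier B" "c \<in> carrier C" "c' \<in> carrier C"
  shows "te b c \<otimes>\<^bsub>T\<^esub> te b' c' = te (b \<otimes>\<^bsub>B\<^esub> b') (c \<otimes>\<^bsub>C\<^esub> c')"
  unfolding tensor_elem_def
  by (subst algebra_homD(3)[OF tensor_hom, symmetric]) (simp_all add: assms single_carrier)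

lemma tensor_elem_one: "te \<one>\<^bsub>B\<^esub> \<one>\<^bsub>C\<^esub> = \<one>\<^bsub>T\<^esub>"
  using algebra_homD(4)[OF tensor_hom] by (simp add: tensor_elem_def)

lemma tensor_left_hom: "(\<lambda>b. te b \<one>\<^bsub>C\<^esub>) \<in> algebra_hom B T"
  by (auto simp: algebra_hom_def ring_hom_def tensor_elem_mult tensor_elem_one tensor_elem_add_left
      tensor_elem_smult_left)

lemma tensor_right_hom: "(\<lambda>c. te \<one>\<^bsub>B\<^esub> c) \<in> algebra_hom C T"
  by (auto simp: algebra_hom_def ring_hom_def tensor_elem_mult tensor_elem_one tensor_elem_add_right
      tensor_elem_smult_right)

text \<open>
  The pure tensors span the tensor product, and bilinearity expands each of them in products of
  spanning elements of the factors.
\<close>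

lemma tensor_span:
  assumes S: "vector_subspace T S"
    and B: "\<And>b. b \<in> carrier B \<Longrightarrow> \<exists>f. b = lincomb B g f \<and> g ` keys f \<subseteq> carrier B \<and>
      (\<forall>i\<in>keys f. i \<in> I)"
    and C: "\<And>c. c \<in> carrier C \<Longrightarrow> \<exists>f. c = lincomb C h f \<and> h ` keys f \<subseteq> carrier C \<and>
      (\<forall>j\<in>keys f. j \<in> J)"
    and gh: "\<And>i j. i \<in> I \<Longrightarrow> j \<in> J \<Longrightarrow> g i \<in> carrier B \<Longrightarrow> h j \<in> carrier C \<Longrightarrow> te (g i) (h j) \<in> S"
  shows "carrier T \<subseteq> S"
proof
  fix X assume "X \<in> carrier T"
  then obtain f where f: "keys f \<subseteq> carrier (B \<times>\<times> C)"
      "X = lincomb T (\<lambda>w. tensor_ideal B C +>\<^bsub>BC\<^esub> single w 1) f"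
    using quot_monoid_algebra_lincomb[OF monoid_BC tensor_ideal] unfolding tensor_algebra_def by blast
  have te: "te b c \<in> S" if bc: "b \<in> carrier B" "c \<in> carrier C" for b c
  proof -
    obtain fb where fb: "b = lincomb B g fb" "g ` keys fb \<subseteq> carrier B"
        "\<forall>i\<in>keys fb. i \<in> I"
      using B[OF bc(1)] by blast
    obtain fc where fc: "c = lincomb C h fc" "h ` keys fc \<subseteq> carrier C"
        "\<forall>j\<in>keys fc. j \<in> J"
      using C[OF bc(2)] by blast
    have 1: "linear_map_on B (carrier B) T (\<lambda>b. te b c)"
      using bc(2) by (auto simp: linear_map_on_def tensor_elem_add_left tensor_elem_smult_left)
    have 2: "linear_map_on C (carrier C) T (\<lambda>c. te b c)" if "b \<in> carrier B" for b
      using that by (auto simp: linear_map_on_def tensor_elem_add_right tensor_elem_smult_right)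
    have "te b c = lincomb T (\<lambda>i. te (g i) c) fb"
      unfolding fb(1) by (rule B.linear_map_on_lincomb[OF T.unital_algebra_axioms B.subspace_carrier 1])
        (use fb in auto)
    also have "\<dots> \<in> S"
    proof (rule T.subspace_lincomb[OF S])
      fix i assume i: "i \<in> keys fb"
      then have gi: "g i \<in> carrier B" using fb by blast
      have "te (g i) c = lincomb T (\<lambda>j. te (g i) (h j)) fc"
        unfolding fc(1)
        by (rule C.linear_map_on_lincomb[OF T.unital_algebra_axioms C.subspace_carrier 2[OF gi]])
          (use fc in auto)
      also have "\<dots> \<in> S"
        by (rule T.subspace_lincomb[OF S]) (use fb fc gh gi i in blast)
      finally show "te (g i) c \<in> S" .
    qed
    finally show ?thesis .
  qed
  show "X \<in> S" unfolding f(2)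
  proof (rule T.subspace_lincomb[OF S])
    fix w assume "w \<in> keys f"
    then have "fst w \<in> carrier B" "snd w \<in> carrier C" using f(1) by auto
    then show "tensor_ideal B C +>\<^bsub>BC\<^esub> single w 1 \<in> S"
      using te[of "fst w" "snd w"] by (simp add: tensor_elem_def)
  qed
qed

end

section \<open>The Weyl algebra with polynomial coefficients\<close>

lemma monoid_free_monoid: "monoid (free_monoid G)"
  by (auto simp: free_monoid_def intro!: monoidI)

lemma monoid_exponent_monoid: "monoid (exponent_monoid I)"
  by (auto simp: exponent_monoid_def exponents_def intro!: monoidI)

lemma (in unital_algebra) monoid_algebra_minus:
  fixes M :: "('w, 'b) monoid_scheme"
  assumes "monoid M" "f \<in> carrier (monoid_algebra M)" "g \<in> carrier (monoid_algebra M)"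
  shows "f \<ominus>\<^bsub>monoid_algebra M\<^esub> g = f - (g :: 'w \<Rightarrow>\<^sub>0 'k)"
  using unital_algebra.a_minus_smult[OF unital_algebra_monoid_algebra[OF assms(1)] assms(2,3)] by simp

text \<open>
  The coordinates \<open>t\<^sub>j\<close> of the polynomial factor are the images of the variables with
  index above \<open>2n\<close>.
\<close>

definition t_gen :: "nat \<Rightarrow> nat \<Rightarrow> nat \<Rightarrow> 'k::field weyl_poly" where
  "t_gen n m j = tensor_elem (weyl_algebra n) (poly_algebra {2*n+1..2*n+m})
     \<one>\<^bsub>(weyl_algebra n :: ('k, _) module)\<^esub> (poly_var j)"

\<comment> \<open>Keeps the index sets \<open>{2*n+1..2*n+m}\<close> in the form in which they are stated.\<close>
declare One_nat_def [simp del]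

locale weyl_poly = fixes n m :: nat and K :: "'k::field itself"
begin

abbreviation "F \<equiv> (free_algebra (weyl_gens n) :: ('k, weyl_gen list \<Rightarrow>\<^sub>0 'k) module)"
abbreviation "W \<equiv> (weyl_algebra n :: ('k, 'k weyl) module)"
abbreviation "P \<equiv> (poly_algebra {2*n+1..2*n+m} :: ('k, 'k poly_rep) module)"
abbreviation "A \<equiv> (weyl_poly_algebra n m :: ('k, 'k weyl_poly) module)"
abbreviation "word u \<equiv> (weyl_ideal n +>\<^bsub>F\<^esub> single u 1 :: 'k weyl)"
abbreviation "Q i \<equiv> (q_gen n m i :: 'k weyl_poly)"
abbreviation "D i \<equiv> (p_gen n m i :: 'k weyl_poly)"
abbreviation "t j \<equiv> (t_gen n m j :: 'k weyl_poly)"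

lemma algebra_F: "unital_algebra F"
  unfolding free_algebra_def by (rule unital_algebra_monoid_algebra[OF monoid_free_monoid])

lemma carrier_F: "f \<in> carrier F \<longleftrightarrow> keys f \<subseteq> lists (weyl_gens n)"
  by (simp add: free_algebra_def carrier_monoid_algebra free_monoid_def)

lemma gens [simp]: "i \<in> {1..n} \<Longrightarrow> Qgen i \<in> weyl_gens n" "i \<in> {1..n} \<Longrightarrow> Pgen i \<in> weyl_gens n"
  by (auto simp: weyl_gens_def)

lemma diff_F: "f \<in> carrier F \<Longrightarrow> g \<in> carrier F \<Longrightarrow> f - g \<in> carrier F"
  using Poly_Mapping.keys_diff[of f g] unfolding carrier_F by blast

lemma single_F: "u \<in> lists (weyl_gens n) \<Longrightarrow> single u c \<in> carrier F"
  by (simp add: carrier_F)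

lemma weyl_relations_carrier: "weyl_relations n \<subseteq> carrier F"
  unfolding weyl_relations_def by (auto intro!: diff_F single_F)

lemma weyl_ideal: "algebra_ideal F (weyl_ideal n)"
  unfolding weyl_ideal_def
  by (intro algebra_ideal.intro algebra_F ring.genideal_ideal weyl_relations_carrier
      unital_algebra.axioms(1)[OF algebra_F])

lemma algebra_W: "unital_algebra W"
  unfolding weyl_algebra_def by (rule algebra_ideal.unital_algebra_quot[OF weyl_ideal])

lemma algebra_P: "unital_algebra P"
  unfolding poly_algebra_def by (rule unital_algebra_monoid_algebra[OF monoid_exponent_monoid])

sublocale TP: tensor_product W P
  by (rule tensor_product.intro[OF algebra_W algebra_P])

sublocale A: unital_algebra A
  unfolding weyl_poly_algebra_def by (rule TP.T.unital_algebra_axioms)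

lemma hom_F: "(\<lambda>f. weyl_ideal n +>\<^bsub>F\<^esub> f) \<in> algebra_hom F W"
  unfolding weyl_algebra_def by (rule algebra_ideal.quot_hom[OF weyl_ideal])

lemma word_closed [simp]: "u \<in> lists (weyl_gens n) \<Longrightarrow> word u \<in> carrier W"
  by (rule algebra_homD(1)[OF hom_F]) (simp add: carrier_F)

lemma word_append:
  "u \<in> lists (weyl_gens n) \<Longrightarrow> v \<in> lists (weyl_gens n) \<Longrightarrow> word u \<otimes>\<^bsub>W\<^esub> word v = word (u @ v)"
  by (subst algebra_homD(3)[OF hom_F, symmetric])
    (simp_all add: carrier_F, simp add: free_algebra_def free_monoid_def)

lemma word_Nil: "word [] = \<one>\<^bsub>W\<^esub>"
  using algebra_homD(4)[OF hom_F] by (simp add: free_algebra_def free_monoid_def)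

lemma coset_cong:
  assumes "f - g \<in> weyl_relations n" "f \<in> carrier F" "g \<in> carrier F"
  shows "weyl_ideal n +>\<^bsub>F\<^esub> f = weyl_ideal n +>\<^bsub>F\<^esub> g"
proof -
  have "weyl_relations n \<subseteq> (weyl_ideal n :: (weyl_gen list \<Rightarrow>\<^sub>0 'k) set)"
    unfolding weyl_ideal_def
    by (rule ring.genideal_self[OF unital_algebra.axioms(1)[OF algebra_F] weyl_relations_carrier])
  moreover have "f \<ominus>\<^bsub>F\<^esub> g = f - g"
    using assms(2,3) TP.B.monoid_algebra_minus[OF monoid_free_monoid] unfolding free_algebra_def by blast
  ultimately show ?thesis
    using assms by (subst algebra_ideal.coset_eq_iff[OF weyl_ideal]) auto
qed

lemma weyl_commutation:
  assumes ij: "i \<in> {1..n}" "j \<in> {1..n}"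
  shows "word [Pgen i] \<otimes>\<^bsub>W\<^esub> word [Qgen j]
      = word [Qgen j] \<otimes>\<^bsub>W\<^esub> word [Pgen i] \<oplus>\<^bsub>W\<^esub> (if i = j then 1 else 0) \<odot>\<^bsub>W\<^esub> \<one>\<^bsub>W\<^esub>"
    and "word [Pgen i] \<otimes>\<^bsub>W\<^esub> word [Pgen j] = word [Pgen j] \<otimes>\<^bsub>W\<^esub> word [Pgen i]"
    and "word [Qgen i] \<otimes>\<^bsub>W\<^esub> word [Qgen j] = word [Qgen j] \<otimes>\<^bsub>W\<^esub> word [Qgen i]"
proof -
  let ?s = "\<lambda>u. single u 1 :: weyl_gen list \<Rightarrow>\<^sub>0 'k"
  let ?d = "single [] (if i = j then 1 else 0) :: weyl_gen list \<Rightarrow>\<^sub>0 'k"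
  have "word [Pgen i, Qgen j] = weyl_ideal n +>\<^bsub>F\<^esub> (?s [Qgen j, Pgen i] + ?d)"
  proof (rule coset_cong)
    show "?s [Pgen i, Qgen j] - (?s [Qgen j, Pgen i] + ?d) \<in> weyl_relations n"
      unfolding weyl_relations_def diff_diff_eq[symmetric] using ij by blast
    show "?s [Qgen j, Pgen i] + ?d \<in> carrier F"
      using ij ring.ring_simprules(1)[OF unital_algebra.axioms(1)[OF algebra_F] single_F single_F,
          of "[Qgen j, Pgen i]" "[]"]
      by (simp add: free_algebra_def)
  qed (use ij in \<open>simp add: single_F\<close>)
  also have "\<dots> = weyl_ideal n +>\<^bsub>F\<^esub> (?s [Qgen j, Pgen i] \<oplus>\<^bsub>F\<^esub> (if i = j then 1 else 0) \<odot>\<^bsub>F\<^esub> \<one>\<^bsub>F\<^esub>)"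
    by (simp add: free_algebra_def free_monoid_def)
  also have "\<dots> = word [Qgen j, Pgen i] \<oplus>\<^bsub>W\<^esub> (if i = j then 1 else 0) \<odot>\<^bsub>W\<^esub> \<one>\<^bsub>W\<^esub>"
    unfolding algebra_homD(4)[OF hom_F, symmetric]
    using ij unital_algebra.axioms(1)[OF algebra_F, THEN ring.ring_simprules(6)]
      unital_algebra.smult_closed[OF algebra_F]
    by (simp add: algebra_homD(2,5)[OF hom_F] single_F)
  finally show "word [Pgen i] \<otimes>\<^bsub>W\<^esub> word [Qgen j]
      = word [Qgen j] \<otimes>\<^bsub>W\<^esub> word [Pgen i] \<oplus>\<^bsub>W\<^esub> (if i = j then 1 else 0) \<odot>\<^bsub>W\<^esub> \<one>\<^bsub>W\<^esub>"
    using ij by (simp add: word_append)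
  have "word [Pgen i, Pgen j] = word [Pgen j, Pgen i]"
  proof (rule coset_cong)
    show "?s [Pgen i, Pgen j] - ?s [Pgen j, Pgen i] \<in> weyl_relations n"
      unfolding weyl_relations_def using ij by blast
  qed (use ij in \<open>simp_all add: single_F\<close>)
  then show "word [Pgen i] \<otimes>\<^bsub>W\<^esub> word [Pgen j] = word [Pgen j] \<otimes>\<^bsub>W\<^esub> word [Pgen i]"
    using ij by (simp add: word_append)
  have "word [Qgen i, Qgen j] = word [Qgen j, Qgen i]"
  proof (rule coset_cong)
    show "?s [Qgen i, Qgen j] - ?s [Qgen j, Qgen i] \<in> weyl_relations n"
      unfolding weyl_relations_def using ij by blast
  qed (use ij in \<open>simp_all add: single_F\<close>)
  then show "word [Qgen i] \<otimes>\<^bsub>W\<^esub> word [Qgen j] = word [Qgen j] \<otimes>\<^bsub>W\<^esub> word [Qgen i]"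
    using ij by (simp add: word_append)
qed

lemma left_hom: "(\<lambda>b. tensor_elem W P b \<one>\<^bsub>P\<^esub>) \<in> algebra_hom W A"
  unfolding weyl_poly_algebra_def by (rule TP.tensor_left_hom)

lemma right_hom: "(\<lambda>c. tensor_elem W P \<one>\<^bsub>W\<^esub> c) \<in> algebra_hom P A"
  unfolding weyl_poly_algebra_def by (rule TP.tensor_right_hom)

lemma left_right:
  assumes "b \<in> carrier W" "c \<in> carrier P"
  shows "tensor_elem W P b \<one>\<^bsub>P\<^esub> \<otimes>\<^bsub>A\<^esub> tensor_elem W P \<one>\<^bsub>W\<^esub> c = tensor_elem W P b c"
    and "tensor_elem W P \<one>\<^bsub>W\<^esub> c \<otimes>\<^bsub>A\<^esub> tensor_elem W P b \<one>\<^bsub>P\<^esub> = tensor_elem W P b c"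
  using assms by (simp_all add: weyl_poly_algebra_def TP.tensor_elem_mult)

lemma Q_eq: "Q i = tensor_elem W P (word [Qgen i]) \<one>\<^bsub>P\<^esub>"
  and D_eq: "D i = tensor_elem W P (word [Pgen i]) \<one>\<^bsub>P\<^esub>"
  and t_eq: "t j = tensor_elem W P \<one>\<^bsub>W\<^esub> (poly_var j)"
  by (simp_all add: q_gen_def p_gen_def t_gen_def weyl_elem_def)

lemma single_P [simp]: "\<epsilon> \<in> exponents {2*n+1..2*n+m} \<Longrightarrow> single \<epsilon> c \<in> carrier P"
  by (simp add: poly_algebra_def carrier_monoid_algebra exponent_monoid_def)

lemma poly_var_closed [simp]: "j \<in> {2*n+1..2*n+m} \<Longrightarrow> poly_var j \<in> carrier P"
  unfolding poly_var_def by (rule single_P) (auto simp: exponents_def)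

lemma gen_closed [simp]:
  "i \<in> {1..n} \<Longrightarrow> Q i \<in> carrier A" "i \<in> {1..n} \<Longrightarrow> D i \<in> carrier A"
  "j \<in> {2*n+1..2*n+m} \<Longrightarrow> t j \<in> carrier A"
  unfolding Q_eq D_eq t_eq
  by (auto intro!: algebra_homD(1)[OF left_hom] algebra_homD(1)[OF right_hom])

lemma P_commute:
  assumes "i \<in> {2*n+1..2*n+m}" "j \<in> {2*n+1..2*n+m}"
  shows "poly_var i \<otimes>\<^bsub>P\<^esub> poly_var j = poly_var j \<otimes>\<^bsub>P\<^esub> poly_var i"
  by (simp add: poly_algebra_def poly_var_def exponent_monoid_def add.commute)

lemma gen_commutation:
  shows "i \<in> {1..n} \<Longrightarrow> j \<in> {1..n} \<Longrightarrow>
      D i \<otimes>\<^bsub>A\<^esub> Q j = Q j \<otimes>\<^bsub>A\<^esub> D i \<oplus>\<^bsub>A\<^esub> (if i = j then 1 else 0) \<odot>\<^bsub>A\<^esub> \<one>\<^bsub>A\<^esub>"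
    and "i \<in> {1..n} \<Longrightarrow> j \<in> {1..n} \<Longrightarrow> D i \<otimes>\<^bsub>A\<^esub> D j = D j \<otimes>\<^bsub>A\<^esub> D i"
    and "i \<in> {1..n} \<Longrightarrow> j \<in> {1..n} \<Longrightarrow> Q i \<otimes>\<^bsub>A\<^esub> Q j = Q j \<otimes>\<^bsub>A\<^esub> Q i"
    and "i \<in> {1..n} \<Longrightarrow> j \<in> {2*n+1..2*n+m} \<Longrightarrow> D i \<otimes>\<^bsub>A\<^esub> t j = t j \<otimes>\<^bsub>A\<^esub> D i"
    and "i \<in> {1..n} \<Longrightarrow> j \<in> {2*n+1..2*n+m} \<Longrightarrow> Q i \<otimes>\<^bsub>A\<^esub> t j = t j \<otimes>\<^bsub>A\<^esub> Q i"
    and "i \<in> {2*n+1..2*n+m} \<Longrightarrow> j \<in> {2*n+1..2*n+m} \<Longrightarrow> t i \<otimes>\<^bsub>A\<^esub> t j = t j \<otimes>\<^bsub>A\<^esub> t i"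
proof -
  note L = algebra_homD[OF left_hom] and R = algebra_homD[OF right_hom]
  show "D i \<otimes>\<^bsub>A\<^esub> Q j = Q j \<otimes>\<^bsub>A\<^esub> D i \<oplus>\<^bsub>A\<^esub> (if i = j then 1 else 0) \<odot>\<^bsub>A\<^esub> \<one>\<^bsub>A\<^esub>"
    if "i \<in> {1..n}" "j \<in> {1..n}"
    unfolding Q_eq D_eq L(4)[symmetric] using that
    by (simp only: L(2,3,5)[symmetric] weyl_commutation(1) word_closed lists.intros gens
        TP.B.m_closed TP.B.one_closed TP.B.smult_closed)
  show "D i \<otimes>\<^bsub>A\<^esub> D j = D j \<otimes>\<^bsub>A\<^esub> D i" if "i \<in> {1..n}" "j \<in> {1..n}"
    unfolding D_eq using that by (simp add: L(3)[symmetric] weyl_commutation(2)[OF that])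
  show "Q i \<otimes>\<^bsub>A\<^esub> Q j = Q j \<otimes>\<^bsub>A\<^esub> Q i" if "i \<in> {1..n}" "j \<in> {1..n}"
    unfolding Q_eq using that by (simp add: L(3)[symmetric] weyl_commutation(3)[OF that])
  show "D i \<otimes>\<^bsub>A\<^esub> t j = t j \<otimes>\<^bsub>A\<^esub> D i" "Q i \<otimes>\<^bsub>A\<^esub> t j = t j \<otimes>\<^bsub>A\<^esub> Q i"
    if "i \<in> {1..n}" "j \<in> {2*n+1..2*n+m}"
    unfolding D_eq Q_eq t_eq using that by (simp_all only: left_right word_closed lists.intros gens poly_var_closed)
  show "t i \<otimes>\<^bsub>A\<^esub> t j = t j \<otimes>\<^bsub>A\<^esub> t i" if "i \<in> {2*n+1..2*n+m}" "j \<in> {2*n+1..2*n+m}"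
    unfolding t_eq using that by (simp only: R(3)[symmetric] P_commute poly_var_closed)
qed

text \<open>
  The products of a word in the \<open>q\<^sub>i\<close>, \<open>p\<^sub>i\<close> with a monomial in the \<open>t\<^sub>j\<close> span \<open>A\<close>.  Each of them
  arises from \<open>1\<close> by left multiplications, first with the \<open>t\<^sub>j\<close> and then with the letters of the word.
\<close>

lemma generation:
  assumes S: "vector_subspace A S" and one: "\<one>\<^bsub>A\<^esub> \<in> S"
    and Q: "\<And>i a. i \<in> {1..n} \<Longrightarrow> a \<in> S \<Longrightarrow> Q i \<otimes>\<^bsub>A\<^esub> a \<in> S"
    and D: "\<And>i a. i \<in> {1..n} \<Longrightarrow> a \<in> S \<Longrightarrow> D i \<otimes>\<^bsub>A\<^esub> a \<in> S"
    and t: "\<And>j a. j \<in> {2*n+1..2*n+m} \<Longrightarrow> a \<in> S \<Longrightarrow> t j \<otimes>\<^bsub>A\<^esub> a \<in> S"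
  shows "carrier A \<subseteq> S"
proof -
  note L = algebra_homD[OF left_hom] and R = algebra_homD[OF right_hom]
  have poly: "tensor_elem W P \<one>\<^bsub>W\<^esub> (single \<epsilon> 1) \<in> S" if "\<epsilon> \<in> exponents {2*n+1..2*n+m}" for \<epsilon>
    using that
  proof (induction "\<Sum>j\<in>{2*n+1..2*n+m}. \<epsilon> j" arbitrary: \<epsilon>)
    case 0
    then have "\<epsilon> = (\<lambda>i. 0)" by (auto simp: exponents_def fun_eq_iff)
    then have "single \<epsilon> 1 = \<one>\<^bsub>P\<^esub>" by (simp add: poly_algebra_def exponent_monoid_def)
    then show ?case using R(4) one by simp
  next
    case (Suc N)
    then obtain j where j: "j \<in> {2*n+1..2*n+m}" "\<epsilon> j \<noteq> 0"
      by (metis sum.neutral nat.distinct(1))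
    let ?\<eta> = "\<epsilon>(j := \<epsilon> j - 1)"
    have \<eta>: "?\<eta> \<in> exponents {2*n+1..2*n+m}" using Suc.prems by (auto simp: exponents_def)
    have "(\<Sum>i\<in>{2*n+1..2*n+m}. \<epsilon> i) = Suc (\<Sum>i\<in>{2*n+1..2*n+m}. ?\<eta> i)"
      using j by (simp add: sum.remove[of _ j])
    then have IH: "tensor_elem W P \<one>\<^bsub>W\<^esub> (single ?\<eta> 1) \<in> S"
      using Suc.hyps \<eta> by simp
    have "(\<lambda>i. (if i = j then 1 else 0) + ?\<eta> i) = \<epsilon>" using j by auto
    then have "single \<epsilon> 1 = poly_var j \<otimes>\<^bsub>P\<^esub> single ?\<eta> 1"
      by (simp add: poly_algebra_def exponent_monoid_def poly_var_def)
    then have "tensor_elem W P \<one>\<^bsub>W\<^esub> (single \<epsilon> 1)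
        = t j \<otimes>\<^bsub>A\<^esub> tensor_elem W P \<one>\<^bsub>W\<^esub> (single ?\<eta> 1)"
      unfolding t_eq using j \<eta> by (simp only: R(3) single_P poly_var_closed)
    then show ?case using t[OF j(1) IH] by simp
  qed
  have prod: "tensor_elem W P (word u) (single \<epsilon> 1) \<in> S"
    if "u \<in> lists (weyl_gens n)" and \<epsilon>: "\<epsilon> \<in> exponents {2*n+1..2*n+m}" for u \<epsilon>
    using that(1)
  proof (induction u rule: lists.induct)
    case Nil
    then show ?case using poly[OF \<epsilon>] by (simp add: word_Nil)
  next
    case (Cons g u)
    have g1: "[g] \<in> lists (weyl_gens n)" using Cons by simp
    have "tensor_elem W P (word (g # u)) (single \<epsilon> 1)
        = tensor_elem W P (word [g] \<otimes>\<^bsub>W\<^esub> word u) (\<one>\<^bsub>P\<^esub> \<otimes>\<^bsub>P\<^esub> single \<epsilon> 1)"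
      using Cons \<epsilon> g1 by (simp add: word_append)
    also have "\<dots> = tensor_elem W P (word [g]) \<one>\<^bsub>P\<^esub> \<otimes>\<^bsub>A\<^esub> tensor_elem W P (word u) (single \<epsilon> 1)"
      unfolding weyl_poly_algebra_def
      by (rule TP.tensor_elem_mult[symmetric]) (use Cons \<epsilon> in auto)
    finally show ?case using Cons Q D unfolding Q_eq D_eq by (auto simp: weyl_gens_def)
  qed
  have "carrier (tensor_algebra W P) \<subseteq> S"
  proof (rule TP.tensor_span)
    show "vector_subspace (tensor_algebra W P) S" using S by (simp add: weyl_poly_algebra_def)
    fix b assume "b \<in> carrier W"
    then obtain f where "keys f \<subseteq> lists (weyl_gens n)" "b = lincomb W word f"
      using quot_monoid_algebra_lincomb[OF monoid_free_monoid weyl_ideal[unfolded free_algebra_def]]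
      unfolding weyl_algebra_def free_algebra_def by (auto simp: free_monoid_def)
    then show "\<exists>f. b = lincomb W word f \<and> word ` keys f \<subseteq> carrier W \<and>
        (\<forall>i\<in>keys f. i \<in> lists (weyl_gens n))"
      by (intro exI[of _ f]) (auto intro!: word_closed)
  next
    fix c assume c: "c \<in> carrier P"
    then have "keys c \<subseteq> exponents {2*n+1..2*n+m}"
      by (simp add: poly_algebra_def carrier_monoid_algebra exponent_monoid_def)
    moreover have "c = lincomb P (\<lambda>\<epsilon>. single \<epsilon> 1) c"
      using c unfolding poly_algebra_def by (rule lincomb_monoid_algebra[OF monoid_exponent_monoid, symmetric])
    ultimately show "\<exists>f. c = lincomb P (\<lambda>\<epsilon>. single \<epsilon> 1) f \<and>
        (\<lambda>\<epsilon>. single \<epsilon> 1) ` keys f \<subseteq> carrier P \<and>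
        (\<forall>\<epsilon>\<in>keys f. \<epsilon> \<in> exponents {2*n+1..2*n+m})"
      by (intro exI[of _ c]) (auto intro!: single_P)
  qed (rule prod)
  then show ?thesis by (simp add: weyl_poly_algebra_def)
qed

end

section \<open>Differential operators and independence of the central monomials\<close>

abbreviation X :: "nat \<Rightarrow> 'k::field poly_rep" where "X \<equiv> poly_var"

lemma plinear_eqI:
  assumes "plinear T" "plinear T'" "\<And>i. T (single i 1) = T' (single i 1)"
  shows "T f = T' f"
proof -
  have "T f = T (pm_extend (\<lambda>i. single i 1) f)" by (simp add: pm_extend_singles)
  also have "\<dots> = T' (pm_extend (\<lambda>i. single i 1) f)"
    by (simp add: plinear_apply_pm_extend[OF assms(1)] plinear_apply_pm_extend[OF assms(2)] assms(3))
  finally show ?thesis by (simp add: pm_extend_singles)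
qed

lemma pscale_mult: "pscale c f = single 0 c * (f :: 'k::field poly_rep)"
  unfolding pscale_def by (rule mult_map_scale_conv_mult)

lemma pscale_mult_left: "pscale c f * g = pscale c (f * g)" for g :: "'k::field poly_rep"
  by (simp add: pscale_mult mult.assoc)

lemma single_zero_exponent: "single (\<lambda>i. 0) 1 = (1 :: 'k::field poly_rep)"
  unfolding single_one[symmetric] zero_fun_def ..

lemma plinear_mult: "plinear (\<lambda>f. c * f)" for c :: "'k::field poly_rep"
  by (rule plinearI) (simp_all add: distrib_left pscale_mult mult_ac)

lemma plinear_add: "plinear S \<Longrightarrow> plinear T \<Longrightarrow> plinear (\<lambda>f. S f + T f)"
  by (rule plinearI) (simp_all add: module_hom.add module_hom.scale pm.scale_right_distrib add_ac)

lemma plinear_comp: "plinear S \<Longrightarrow> plinear T \<Longrightarrow> plinear (\<lambda>f. S (T f))"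
  by (rule plinearI) (simp_all add: module_hom.add module_hom.scale)

lemma plinear_id: "plinear (\<lambda>f. f)"
  by (rule plinearI) simp_all

lemma plinear_pscale: "plinear (pscale c)"
  by (rule plinearI) (simp_all add: pm.scale_right_distrib mult.commute)

lemma poly_hderiv_eq:
  "poly_hderiv i j = pm_extend (\<lambda>\<epsilon>. single (\<epsilon>(i := \<epsilon> i - j)) (of_nat (\<epsilon> i choose j)))"
  by (rule ext) (simp add: poly_hderiv_def pm_extend_def mult.commute)

lemma plinear_poly_hderiv: "plinear (poly_hderiv i j)"
  unfolding poly_hderiv_eq by (rule plinear_pm_extend)

abbreviation \<Delta> :: "nat \<Rightarrow> 'k::field poly_rep \<Rightarrow> 'k poly_rep" where "\<Delta> i \<equiv> poly_hderiv i 1"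

lemma \<Delta>_single: "\<Delta> i (single \<epsilon> c) = single (\<epsilon>(i := \<epsilon> i - 1)) (of_nat (\<epsilon> i) * c)"
  by (simp add: poly_hderiv_eq choose_one mult.commute)

lemma \<Delta>_X_mult: "\<Delta> i (X j * f) = X j * \<Delta> i f + pscale (if i = j then 1 else 0) f"
proof (rule plinear_eqI[where T = "\<lambda>f. \<Delta> i (X j * f)"])
  show "plinear (\<lambda>f. \<Delta> i (X j * f))" by (rule plinear_comp[OF plinear_poly_hderiv plinear_mult])
  show "plinear (\<lambda>f. X j * \<Delta> i f + pscale (if i = j then 1 else 0) f)"
    by (rule plinear_add[OF plinear_comp[OF plinear_mult plinear_poly_hderiv] plinear_pscale])
  fix \<epsilon>
  show "\<Delta> i (X j * single \<epsilon> 1)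
      = X j * \<Delta> i (single \<epsilon> 1) + pscale (if i = j then 1 else 0) (single \<epsilon> 1)"
  proof (cases "i = j")
    case True
    show ?thesis
    proof (cases "\<epsilon> j = 0")
      case True
      have *: "((\<lambda>k. if k = j then 1 else 0) + \<epsilon>)(j := 0) = \<epsilon>" using True by auto
      show ?thesis using \<open>i = j\<close> True by (simp add: poly_var_def mult_single \<Delta>_single *)
    next
      case False
      have *: "((\<lambda>k. if k = j then 1 else 0) + \<epsilon>)(j := \<epsilon> j) = \<epsilon>"
        "(\<lambda>k. if k = j then 1 else 0) + \<epsilon>(j := \<epsilon> j - 1) = \<epsilon>" using False by auto
      show ?thesis using \<open>i = j\<close>
        by (simp add: poly_var_def mult_single \<Delta>_single * single_add[symmetric] add.commute[of 1])
    qed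
  next
    case False
    have "((\<lambda>k. if k = j then 1 else 0) + \<epsilon>)(i := \<epsilon> i - 1) = (\<lambda>k. if k = j then 1 else 0) + \<epsilon>(i := \<epsilon> i - 1)"
      using False by auto
    then show ?thesis using False by (simp add: poly_var_def mult_single \<Delta>_single)
  qed
qed

lemma \<Delta>_commute: "\<Delta> i (\<Delta> j f) = \<Delta> j (\<Delta> i f)"
proof (rule plinear_eqI[where T = "\<lambda>f. \<Delta> i (\<Delta> j f)" and T' = "\<lambda>f. \<Delta> j (\<Delta> i f)"])
  show "\<Delta> i (\<Delta> j (single \<epsilon> 1)) = \<Delta> j (\<Delta> i (single \<epsilon> 1))" for \<epsilon> :: "nat \<Rightarrow> nat"
    by (cases "i = j") (simp_all add: \<Delta>_single fun_upd_twist mult.commute)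
qed (rule plinear_comp[OF plinear_poly_hderiv plinear_poly_hderiv])+

lemma \<Delta>_mult_constant:
  assumes "\<And>\<epsilon>. \<epsilon> \<in> keys c \<Longrightarrow> \<epsilon> i = 0"
  shows "\<Delta> i (c * f) = c * \<Delta> i f"
proof (rule plinear_eqI[where T = "\<lambda>f. \<Delta> i (c * f)" and T' = "\<lambda>f. c * \<Delta> i f"])
  fix \<eta> :: "nat \<Rightarrow> nat"
  let ?s = "single \<eta> 1"
  have lin: "plinear (\<lambda>c. \<Delta> i (c * ?s))" "plinear (\<lambda>c. c * \<Delta> i ?s)"
    using plinear_comp[OF plinear_poly_hderiv plinear_mult[of ?s]] plinear_mult[of "\<Delta> i ?s"]
    by (simp_all add: mult.commute)
  have "\<Delta> i (single \<epsilon> 1 * ?s) = single \<epsilon> 1 * \<Delta> i ?s"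
    if "\<epsilon> \<in> keys c" for \<epsilon>
  proof -
    have "(\<epsilon> + \<eta>)(i := \<eta> i - 1) = \<epsilon> + \<eta>(i := \<eta> i - 1)" using assms[OF that] by auto
    then show ?thesis using assms[OF that] by (simp add: mult_single \<Delta>_single)
  qed
  then have "pm_extend (\<lambda>\<epsilon>. \<Delta> i (single \<epsilon> 1 * ?s)) c
      = pm_extend (\<lambda>\<epsilon>. single \<epsilon> 1 * \<Delta> i ?s) c"
    by (rule pm_extend_cong)
  then show "\<Delta> i (c * ?s) = c * \<Delta> i ?s"
    by (simp only: plinear_apply_pm_extend[OF lin(1), symmetric]
        plinear_apply_pm_extend[OF lin(2), symmetric] pm_extend_singles)
qed (rule plinear_comp[OF plinear_poly_hderiv plinear_mult] plinear_comp[OF plinear_mult plinear_poly_hderiv])+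

text \<open>
  In characteristic \<open>p\<close> the usual representation \<open>p\<^sub>i \<mapsto> \<partial>\<^sub>i\<close> on polynomials in the \<open>q\<^sub>i\<close> kills
  \<open>p\<^sub>i\<^sup>p\<close>.  Adjoining one more variable per \<open>p\<^sub>i\<close> and adding it to \<open>\<partial>\<^sub>i\<close> remedies this: the \<open>p\<close>-th power
  becomes multiplication by \<open>X\<^sub>n\<^sub>+\<^sub>i\<^sup>p\<close>.
\<close>

primrec gen_action :: "nat \<Rightarrow> weyl_gen \<Rightarrow> 'k::field poly_rep \<Rightarrow> 'k poly_rep" where
  "gen_action n (Qgen i) f = X i * f"
| "gen_action n (Pgen i) f = X (n + i) * f + \<Delta> i f"

lemma plinear_gen_action: "plinear (gen_action n g :: 'k::field poly_rep \<Rightarrow> 'k poly_rep)"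
proof (cases g)
  case (Qgen i)
  then have "gen_action n g = (\<lambda>f :: 'k poly_rep. X i * f)" by (simp add: fun_eq_iff)
  then show ?thesis by (simp add: plinear_mult)
next
  case (Pgen i)
  then have "gen_action n g = (\<lambda>f :: 'k poly_rep. X (n + i) * f + \<Delta> i f)" by (simp add: fun_eq_iff)
  then show ?thesis by (simp add: plinear_add[OF plinear_mult plinear_poly_hderiv])
qed

lemma plinear_word_action: "plinear (foldr (gen_action n) u)"
proof (induction u)
  case (Cons g u)
  then show ?case using plinear_comp[OF plinear_gen_action] by (simp add: o_def)
qed (simp add: id_def plinear_id)

context weyl_poly
begin

lemma F_action:
  "algebra_action F (\<lambda>f x. pm_extend (\<lambda>u. foldr (gen_action n) u x) f)"
  unfolding free_algebra_def
  by (rule algebra_action_monoid_algebra[OF monoid_free_monoid])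
    (simp_all add: plinear_word_action free_monoid_def)

lemma weyl_relations_act_zero:
  fixes r :: "weyl_gen list \<Rightarrow>\<^sub>0 'k"
  assumes "r \<in> weyl_relations n"
  shows "pm_extend (\<lambda>u. foldr (gen_action n) u x) r = 0"
proof -
  consider (PQ) i j where "r = single [Pgen i, Qgen j] 1 - single [Qgen j, Pgen i] 1
        - single [] (if i = j then 1 else 0)" "i \<in> {1..n}" "j \<in> {1..n}"
    | (PP) i j where "r = single [Pgen i, Pgen j] 1 - single [Pgen j, Pgen i] 1"
        "i \<in> {1..n}" "j \<in> {1..n}"
    | (QQ) i j where "r = single [Qgen i, Qgen j] 1 - single [Qgen j, Qgen i] 1"
        "i \<in> {1..n}" "j \<in> {1..n}"
    using assms unfolding weyl_relations_def by blast
  then show ?thesis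
  proof cases
    case PQ
    then show ?thesis
      by (simp add: pm_extend_diff \<Delta>_X_mult distrib_left mult.left_commute)
  next
    case PP
    then have "i \<noteq> n + j" "j \<noteq> n + i" by auto
    with PP show ?thesis
      by (simp add: pm_extend_diff \<Delta>_X_mult distrib_left mult.left_commute \<Delta>_commute[of i j]
          module_hom.add[OF plinear_poly_hderiv])
  next
    case QQ
    then show ?thesis by (simp add: pm_extend_diff mult_ac)
  qed
qed

lemma W_action:
  "\<exists>\<rho> :: 'k weyl \<Rightarrow> _. algebra_action W \<rho> \<and> (\<forall>f\<in>carrier F. \<forall>x. \<rho> (weyl_ideal n +>\<^bsub>F\<^esub> f) x = pm_extend (\<lambda>u. foldr (gen_action n) u x) f)"
  using unital_algebra.algebra_action_quot[OF algebra_F F_action weyl_relations_carrier weyl_relations_act_zero]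
  unfolding weyl_algebra_def weyl_ideal_def by metis

lemma P_mult: 
  "c \<otimes>\<^bsub>P\<^esub> c' = c * c'"
proof -
  have *: "f * g = pm_extend (\<lambda>u. pm_extend (\<lambda>v. single (u + v) 1) g) f" for f g :: "'k poly_rep"
  proof (rule plinear_eqI[where T = "\<lambda>f. f * g"])
    show "plinear (\<lambda>f. f * g)" using plinear_mult[of g] by (simp add: mult.commute)
    show "single u 1 * g
        = pm_extend (\<lambda>u. pm_extend (\<lambda>v. single (u + v) 1) g) (single u 1)" for u
      by (rule plinear_eqI[where T = "\<lambda>g. single u 1 * g"])
        (simp_all add: plinear_mult mult_single plinear_pm_extend plus_fun_def)
  qed (rule plinear_pm_extend)
  have "u \<otimes>\<^bsub>exponent_monoid I\<^esub> v = u + v" for u v I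
    by (simp add: exponent_monoid_def fun_eq_iff)
  then show ?thesis
    by (simp add: * poly_algebra_def monoid_algebra_mult)
qed

text \<open>
  The coefficients in \<open>P\<close> involve only variables with index above \<open>2n\<close>, which are constants for
  every \<open>\<partial>\<^sub>i\<close> with \<open>i \<le> n\<close>.
\<close>

lemma word_action_P:
  fixes c :: "'k poly_rep"
  assumes c: "c \<in> carrier P" and "u \<in> lists (weyl_gens n)"
  shows "foldr (gen_action n) u (c * x) = c * foldr (gen_action n) u x"
  using assms(2)
proof (induction u rule: lists.induct)
  case (Cons g u)
  have "gen_action n g (c * y) = c * gen_action n g y" for y
  proof (cases g)
    case (Pgen i)
    then have i: "i \<in> {1..n}" using Cons by (auto simp: weyl_gens_def)
    have "\<Delta> i (c * y) = c * \<Delta> i y"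
    proof (rule \<Delta>_mult_constant)
      fix \<epsilon> assume "\<epsilon> \<in> keys c"
      then have "\<epsilon> \<in> exponents {2*n+1..2*n+m}" 
        using c by (auto simp: poly_algebra_def carrier_monoid_algebra exponent_monoid_def)
      then show "\<epsilon> i = 0" using i by (auto simp: exponents_def)
    qed
    then show ?thesis using Pgen by (simp add: mult_ac distrib_left)
  qed (simp add: mult_ac)
  with Cons show ?case by simp
qed simp

text \<open>
  The Weyl algebra acts by \<open>gen_action\<close>, the polynomial factor by multiplication.  These actions
  commute, so they combine to an action of the tensor product.
\<close>

lemma A_action:
  "\<exists>\<rho> :: 'k weyl_poly \<Rightarrow> _. algebra_action A \<rho> \<and>
     (\<forall>i\<in>{1..n}. \<forall>x. \<rho> (Q i) x = X i * x) \<and>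
     (\<forall>i\<in>{1..n}. \<forall>x. \<rho> (D i) x = X (n + i) * x + \<Delta> i x) \<and>
     (\<forall>j\<in>{2*n+1..2*n+m}. \<forall>x. \<rho> (t j) x = X j * x)"
proof -
  obtain \<rho>W :: "'k weyl \<Rightarrow> 'k poly_rep \<Rightarrow> 'k poly_rep" where \<rho>W: "algebra_action W \<rho>W"
    and \<rho>Wf: "\<And>f x. f \<in> carrier F \<Longrightarrow> \<rho>W (weyl_ideal n +>\<^bsub>F\<^esub> f) x = pm_extend (\<lambda>u. foldr (gen_action n) u x) f"
    using W_action by blast
  note W = algebra_actionD[OF \<rho>W]
  have comm: "\<rho>W b (c * x) = c * \<rho>W b x" if b: "b \<in> carrier W" and c: "c \<in> carrier P" for b c x
  proof -
    obtain f where f: "f \<in> carrier F" "b = weyl_ideal n +>\<^bsub>F\<^esub> f"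
      using b algebra_ideal.carrier_quot[OF weyl_ideal] unfolding weyl_algebra_def by auto
    have "\<rho>W b (c * x) = pm_extend (\<lambda>u. c * foldr (gen_action n) u x) f"
      unfolding f(2) \<rho>Wf[OF f(1)]
    proof (rule pm_extend_cong)
      fix u assume "u \<in> keys f"
      then have "u \<in> lists (weyl_gens n)" using f(1) unfolding carrier_F by blast
      then show "foldr (gen_action n) u (c * x) = c * foldr (gen_action n) u x"
        by (rule word_action_P[OF c])
    qed
    also have "\<dots> = c * \<rho>W b x"
      unfolding f(2) \<rho>Wf[OF f(1)] by (rule plinear_apply_pm_extend[OF plinear_mult, symmetric])
    finally show ?thesis .
  qed
  define \<rho>1 where "\<rho>1 = (\<lambda>(b, c) x. \<rho>W b (c * x))"
  have act: "algebra_action TP.BC (\<lambda>f x. pm_extend (\<lambda>w. \<rho>1 w x) f)"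
  proof (rule algebra_action_monoid_algebra[OF TP.monoid_BC])
    fix u v :: "'k weyl \<times> 'k poly_rep" and x
    assume u: "u \<in> carrier (W \<times>\<times> P)"
    then show "plinear (\<rho>1 u)"
      by (cases u) (auto simp: \<rho>1_def intro!: plinear_comp[OF W(1)] plinear_mult)
    assume v: "v \<in> carrier (W \<times>\<times> P)"
    show "\<rho>1 (u \<otimes>\<^bsub>W \<times>\<times> P\<^esub> v) x = \<rho>1 u (\<rho>1 v x)"
      using u v by (cases u; cases v) (auto simp: \<rho>1_def W(4) P_mult comm[symmetric] mult.left_commute mult.assoc)
  next
    fix x show "\<rho>1 \<one>\<^bsub>W \<times>\<times> P\<^esub> x = x"
      by (simp add: \<rho>1_def W(2) poly_algebra_def exponent_monoid_def single_zero_exponent)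
  qed
  have P_add: "c \<oplus>\<^bsub>P\<^esub> c' = c + c'" "k \<odot>\<^bsub>P\<^esub> c = pscale k c" for c c' k
    by (simp_all add: poly_algebra_def)
  have zero: "pm_extend (\<lambda>w. \<rho>1 w x) r = 0" if "r \<in> tensor_relations W P" for r x
    using that unfolding tensor_relations_def
    by (auto simp: pm_extend_diff \<rho>1_def W P_add distrib_right module_hom.add[OF W(1)]
        module_hom.scale[OF W(1)] pscale_mult_left)
  obtain \<rho> where \<rho>: "algebra_action (algebra_quot TP.BC (tensor_ideal W P)) \<rho>"
      "\<forall>a\<in>carrier TP.BC. \<rho> (tensor_ideal W P +>\<^bsub>TP.BC\<^esub> a) = (\<lambda>x. pm_extend (\<lambda>w. \<rho>1 w x) a)"
    using unital_algebra.algebra_action_quot[OF TP.algebra_BC act TP.tensor_relations_carrier zero]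
    unfolding tensor_ideal_def by blast
  have te: "\<rho> (tensor_elem W P b c) x = \<rho>W b (c * x)" if "b \<in> carrier W" "c \<in> carrier P" for b c x
    using \<rho>(2) TP.single_carrier[OF that, of 1] by (simp add: tensor_elem_def \<rho>1_def)
  have P1: "\<one>\<^bsub>P\<^esub> * x = x" for x :: "'k poly_rep"
    by (simp add: poly_algebra_def exponent_monoid_def single_zero_exponent)
  have g: "\<rho>W (word [g]) x = gen_action n g x" if "g \<in> weyl_gens n" for g x
    using \<rho>Wf[OF single_F[of "[g]" 1], of x] that by simp
  show ?thesis
  proof (intro exI[of _ \<rho>] conjI ballI allI)
    show "algebra_action A \<rho>" using \<rho>(1) by (simp add: weyl_poly_algebra_def tensor_algebra_def)
  qed (simp_all add: Q_eq D_eq t_eq te P1 g W(2))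
qed

end

lemma one_le_Suc [simp]: "1 \<le> Suc n"
  by simp

section \<open>Binomial coefficients in characteristic \<open>p\<close>\<close>

lemma Suc_times_choose_Suc: "Suc j * (a choose Suc j) = (a - j) * (a choose j)"
proof (cases a)
  case (Suc b)
  have "Suc j * (a choose Suc j) = a * ((a - 1) choose j)"
    using Suc Suc_times_binomial[of j b] by (simp add: mult.commute)
  then show ?thesis by (simp add: binomial_absorb_comp)
qed simp

lemma prod_falling: "(\<Prod>l<j. a - l) = fact j * (a choose j)" for a :: nat
proof (induction j)
  case (Suc j)
  have "(\<Prod>l<Suc j. a - l) = fact j * ((a - j) * (a choose j))" using Suc by (simp add: mult_ac)
  also have "\<dots> = fact (Suc j) * (a choose Suc j)"
    unfolding Suc_times_choose_Suc[symmetric] by (simp add: algebra_simps)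
  finally show ?case .
qed (simp add: One_nat_def)

lemma prime_CHAR: "CHAR('k::field) > 0 \<Longrightarrow> prime CHAR('k)"
  by (rule prime_CHAR_semidom)

lemma fact_nonzero_CHAR:
  assumes "j < CHAR('k::field)"
  shows "(of_nat (fact j) :: 'k) \<noteq> 0"
proof -
  have "prime CHAR('k)" using assms by (intro prime_CHAR) auto
  then show ?thesis using assms by (simp add: of_nat_eq_0_iff_char_dvd prime_dvd_fact_iff del: of_nat_fact)
qed

text \<open>
  The case \<open>j < p\<close> of Lucas' theorem: \<open>j! (a choose j)\<close> is the product of the \<open>a - l\<close> for \<open>l < j\<close>, whose
  residue depends only on that of \<open>a\<close>, and \<open>j!\<close> is invertible.
\<close>

lemma of_nat_choose_mod_CHAR:
  assumes "j < CHAR('k::field)"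
  shows "(of_nat (a choose j) :: 'k) = of_nat (a mod CHAR('k) choose j)"
proof -
  have *: "of_nat (fact j) * of_nat (a choose j) = (\<Prod>l<j. of_nat a - of_nat l :: 'k)" for a
  proof -
    have "(of_nat (\<Prod>l<j. a - l) :: 'k) = (\<Prod>l<j. of_nat a - of_nat l)"
    proof (cases "j \<le> a")
      case False
      then have "(\<Prod>l<j. a - l) = 0" "(\<Prod>l<j. of_nat a - of_nat l :: 'k) = 0"
        by (auto intro!: prod_zero bexI[of _ a])
      then show ?thesis by (simp only: of_nat_0)
    next
      case True
      then have "of_nat (a - l) = (of_nat a - of_nat l :: 'k)" if "l < j" for l
        using that by (intro of_nat_diff) auto
      then show ?thesis by (simp add: of_nat_prod)
    qed
    then show ?thesis by (simp add: prod_falling del: of_nat_fact)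
  qed
  have "(of_nat (a mod CHAR('k)) :: 'k) = of_nat a"
    by (simp add: of_nat_eq_iff_cong_CHAR cong_def)
  then have "(of_nat (fact j) :: 'k) * of_nat (a choose j) = of_nat (fact j) * of_nat (a mod CHAR('k) choose j)"
    by (simp only: *)
  then show ?thesis using fact_nonzero_CHAR[OF assms] by simp
qed

text \<open>
  Replacing \<open>a\<close> by its residue \<open>r < p\<close> turns the truncated sum into the full alternating sum, whose
  value is \<open>(1 - 1)\<^sup>r\<close>.
\<close>

lemma truncated_alternating_sum:
  assumes "CHAR('k::field) > 0"
  shows "(\<Sum>j<CHAR('k). (- 1) ^ j * of_nat (a choose j)) = (if CHAR('k) dvd a then 1 else 0 :: 'k)"
proof -
  let ?p = "CHAR('k)"
  let ?r = "a mod ?p"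
  have "(\<Sum>j<?p. (- 1) ^ j * of_nat (a choose j)) = (\<Sum>j<?p. (- 1) ^ j * of_nat (?r choose j) :: 'k)"
    by (intro sum.cong refl arg_cong[where f = "(*) _"] of_nat_choose_mod_CHAR) simp
  also have "\<dots> = (\<Sum>j\<le>?r. (- 1) ^ j * of_nat (?r choose j))"
  proof (rule sum.mono_neutral_right)
    have "?r < ?p" using assms by (rule mod_less_divisor)
    then show "{..?r} \<subseteq> {..<?p}" by (simp add: subset_iff)
    show "\<forall>j\<in>{..<?p} - {..?r}. (- 1) ^ j * of_nat (?r choose j) = (0 :: 'k)"
      by (auto simp: binomial_eq_0)
  qed simp
  also have "\<dots> = (if ?p dvd a then 1 else 0)"
  proof (cases "?p dvd a")
    case True
    then have "?r = 0" by simp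
    then have "(\<Sum>j\<le>?r. (- 1) ^ j * of_nat (?r choose j) :: 'k) = (\<Sum>j\<le>0. (- 1) ^ j * of_nat (0 choose j))"
      by simp
    then show ?thesis using True by simp
  next
    case False
    then have "?r > 0" by (simp add: dvd_eq_mod_eq_0)
    then have "(\<Sum>j\<le>?r. (- 1) ^ j * of_nat (?r choose j) :: 'k) = 0" by (rule choose_alternating_sum)
    then show ?thesis using False by simp
  qed
  finally show ?thesis .
qed

text \<open>
  The residue on the right is digit number \<open>k\<close> of \<open>a\<close> in base \<open>p\<close>.  Because
  \<open>(1 + X)^(p^k) = 1 + X^(p^k)\<close>, both sides increase by \<open>1\<close> when \<open>a\<close> increases by \<open>p^k\<close>.
\<close>

lemma of_nat_choose_prime_power:
  assumes "CHAR('k::field) > 0"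
  shows "(of_nat (a choose CHAR('k) ^ k) :: 'k) = of_nat (a div CHAR('k) ^ k)"
proof -
  let ?p = "CHAR('k)" and ?P = "CHAR('k) ^ k"
  have p: "prime ?p" using assms by (rule prime_CHAR)
  have P: "?P > 0" using assms by simp
  have inner: "(of_nat (?P choose j) :: 'k) = 0" if j: "0 < j" "j < ?P" for j
    unfolding of_nat_eq_0_iff_char_dvd
  proof (rule ccontr)
    assume "\<not> ?p dvd (?P choose j)"
    then have "coprime ?p (?P choose j)" by (rule prime_imp_coprime[OF p])
    then have "coprime ?P (?P choose j)" by (rule coprime_power_left_iff[THEN iffD2, OF disjI1])
    moreover have "?P dvd j * (?P choose j)"
      unfolding times_binomial_minus1_eq[OF j(1), of ?P] by (rule dvd_triv_left)
    ultimately have "?P dvd j" by (simp only: coprime_dvd_mult_left_iff)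
    then have "?P \<le> j" using j(1) by (rule dvd_imp_le)
    then show False using j(2) by linarith
  qed
  have step: "(of_nat ((?P + b) choose ?P) :: 'k) = of_nat (b choose ?P) + 1" for b
  proof -
    have "(of_nat ((?P + b) choose ?P) :: 'k) = (\<Sum>j\<le>?P. of_nat (?P choose j) * of_nat (b choose (?P - j)))"
      unfolding vandermonde[symmetric] of_nat_sum of_nat_mult ..
    also have "\<dots> = (\<Sum>j\<in>{0, ?P}. of_nat (?P choose j) * of_nat (b choose (?P - j)))"
    proof (rule sum.mono_neutral_right)
      show "\<forall>j\<in>{..?P} - {0, ?P}. (of_nat (?P choose j) * of_nat (b choose (?P - j)) :: 'k) = 0"
      proof
        fix j assume "j \<in> {..?P} - {0, ?P}"
        then have "0 < j" "j < ?P" by auto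
        then show "(of_nat (?P choose j) * of_nat (b choose (?P - j)) :: 'k) = 0"
          by (simp only: inner mult_zero_left)
      qed
    qed auto
    also have "\<dots> = of_nat (b choose ?P) + 1"
    proof -
      have "0 \<noteq> ?P" using P by linarith
      then show ?thesis by simp
    qed
    finally show ?thesis .
  qed
  show ?thesis
  proof (induction a rule: less_induct)
    case (less a)
    show ?case
    proof (cases "a < ?P")
      case False
      then have "(of_nat (a choose ?P) :: 'k) = of_nat ((a - ?P) choose ?P) + 1"
        using step[of "a - ?P"] by simp
      also have "\<dots> = of_nat (a div ?P)"
      proof -
        have "a - ?P < a" using False P by linarith
        then have "(of_nat ((a - ?P) choose ?P) :: 'k) = of_nat ((a - ?P) div ?P)" by (rule less)
        moreover have "a div ?P = Suc ((a - ?P) div ?P)"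
          using False P by (intro le_div_geq) auto
        ultimately show ?thesis by (simp only: of_nat_Suc add.commute)
      qed
      finally show ?thesis .
    qed (simp add: binomial_eq_0)
  qed
qed

section \<open>Ordered monomials\<close>

context unital_algebra
begin

lemma Pi_Suc_iff: "y \<in> {1..Suc r} \<rightarrow> C \<longleftrightarrow> y \<in> {1..r} \<rightarrow> C \<and> y (Suc r) \<in> C"
  by (simp add: atLeastAtMostSuc_conv Pi_iff conj_commute)

lemma foldr_pow_mult:
  assumes "\<And>i. i \<in> set xs \<Longrightarrow> y i \<in> carrier A" "b \<in> carrier A"
  shows "foldr (\<lambda>i a. y i [^] (\<epsilon> i :: nat) \<otimes> a) xs b \<in> carrier A"
    and "foldr (\<lambda>i a. y i [^] \<epsilon> i \<otimes> a) xs b = foldr (\<lambda>i a. y i [^] \<epsilon> i \<otimes> a) xs \<one> \<otimes> b"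
proof -
  have cl: "foldr (\<lambda>i a. y i [^] \<epsilon> i \<otimes> a) xs b \<in> carrier A"
    if "b \<in> carrier A" "\<And>i. i \<in> set xs \<Longrightarrow> y i \<in> carrier A" for b xs
    using that by (induction xs) auto
  show "foldr (\<lambda>i a. y i [^] (\<epsilon> i :: nat) \<otimes> a) xs b \<in> carrier A"
    using cl assms by blast
  show "foldr (\<lambda>i a. y i [^] \<epsilon> i \<otimes> a) xs b = foldr (\<lambda>i a. y i [^] \<epsilon> i \<otimes> a) xs \<one> \<otimes> b"
    using assms
  proof (induction xs)
    case (Cons x xs)
    have "foldr (\<lambda>i a. y i [^] \<epsilon> i \<otimes> a) xs \<one> \<in> carrier A"
      by (rule cl) (use Cons.prems in auto)
    with Cons show ?case by (simp add: m_assoc)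
  qed simp
qed

lemma monomial_closed [simp]:
  assumes "y \<in> {1..r} \<rightarrow> carrier A"
  shows "monomial_in A r y \<epsilon> \<in> carrier A"
  unfolding monomial_in_def by (rule foldr_pow_mult(1)) (use assms in auto)

lemma monomial_0 [simp]: "monomial_in A 0 y \<epsilon> = \<one>"
  by (simp add: monomial_in_def One_nat_def)

lemma monomial_Suc:
  assumes "y \<in> {1..Suc r} \<rightarrow> carrier A"
  shows "monomial_in A (Suc r) y \<epsilon> = monomial_in A r y \<epsilon> \<otimes> y (Suc r) [^] \<epsilon> (Suc r)"
proof -
  have yw: "y (Suc r) \<in> carrier A" using assms by (simp add: Pi_Suc_iff)
  have "[1..<Suc (Suc r)] = [1..<Suc r] @ [Suc r]" by (rule upt_Suc_append) simp
  then have "monomial_in A (Suc r) y \<epsilon>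
      = foldr (\<lambda>i a. y i [^] \<epsilon> i \<otimes> a) [1..<Suc r] (y (Suc r) [^] \<epsilon> (Suc r))"
    using yw unfolding monomial_in_def by simp
  also have "\<dots> = monomial_in A r y \<epsilon> \<otimes> y (Suc r) [^] \<epsilon> (Suc r)"
    unfolding monomial_in_def by (rule foldr_pow_mult(2)) (use assms yw in auto)
  finally show ?thesis .
qed

lemma pow_commute:
  "z \<in> carrier A \<Longrightarrow> a \<in> carrier A \<Longrightarrow> z \<otimes> a = a \<otimes> z \<Longrightarrow> z \<otimes> a [^] (k::nat) = a [^] k \<otimes> z"
  by (metis group_commutes_pow)

lemma monomial_commute:
  assumes "y \<in> {1..r} \<rightarrow> carrier A" "z \<in> carrier A" "\<And>i. i \<in> {1..r} \<Longrightarrow> z \<otimes> y i = y i \<otimes> z"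
  shows "z \<otimes> monomial_in A r y \<epsilon> = monomial_in A r y \<epsilon> \<otimes> z"
  using assms
proof (induction r)
  case (Suc r)
  let ?m = "monomial_in A r y \<epsilon>" and ?w = "y (Suc r) [^] \<epsilon> (Suc r)"
  have y: "y \<in> {1..r} \<rightarrow> carrier A" "y (Suc r) \<in> carrier A"
    using Suc.prems(1) by (simp_all add: Pi_Suc_iff)
  have IH: "z \<otimes> ?m = ?m \<otimes> z" using Suc.prems(2,3) y by (intro Suc.IH) auto
  have w: "z \<otimes> ?w = ?w \<otimes> z" using Suc.prems(2,3) y by (intro pow_commute) auto
  have cl: "?m \<in> carrier A" "?w \<in> carrier A" using y by auto
  have "z \<otimes> (?m \<otimes> ?w) = (z \<otimes> ?m) \<otimes> ?w" using cl Suc.prems(2) by (simp add: m_assoc)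
  also have "\<dots> = ?m \<otimes> (z \<otimes> ?w)" unfolding IH using cl Suc.prems(2) by (simp add: m_assoc)
  also have "\<dots> = (?m \<otimes> ?w) \<otimes> z" unfolding w using cl Suc.prems(2) by (simp add: m_assoc)
  finally show ?case unfolding monomial_Suc[OF Suc.prems(1)] .
qed simp

lemma monomial_cong:
  assumes "y \<in> {1..r} \<rightarrow> carrier A" "\<And>i. i \<in> {1..r} \<Longrightarrow> \<epsilon> i = \<eta> i"
  shows "monomial_in A r y \<epsilon> = monomial_in A r y \<eta>"
  using assms
proof (induction r)
  case (Suc r)
  have "monomial_in A r y \<epsilon> = monomial_in A r y \<eta>"
    using Suc.prems by (intro Suc.IH) (auto simp: Pi_Suc_iff)
  moreover have "\<epsilon> (Suc r) = \<eta> (Suc r)" using Suc.prems(2) by auto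
  ultimately show ?case unfolding monomial_Suc[OF Suc.prems(1)] by simp
qed simp

lemma monomial_zero:
  assumes "y \<in> {1..r} \<rightarrow> carrier A" "\<And>i. i \<in> {1..r} \<Longrightarrow> \<epsilon> i = 0"
  shows "monomial_in A r y \<epsilon> = \<one>"
  using assms
proof (induction r)
  case (Suc r)
  have "monomial_in A r y \<epsilon> = \<one>"
    using Suc.prems by (intro Suc.IH) (auto simp: Pi_Suc_iff)
  moreover have "\<epsilon> (Suc r) = 0" using Suc.prems(2) by auto
  ultimately show ?case unfolding monomial_Suc[OF Suc.prems(1)] by simp
qed simp

definition commuting_family :: "nat \<Rightarrow> (nat \<Rightarrow> 'a) \<Rightarrow> bool" where
  "commuting_family r y \<longleftrightarrow> y \<in> {1..r} \<rightarrow> carrier A \<and> (\<forall>i\<in>{1..r}. \<forall>j\<in>{1..r}. y i \<otimes> y j = y j \<otimes> y i)"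

lemma commuting_familyD:
  assumes "commuting_family r y"
  shows "y \<in> {1..r} \<rightarrow> carrier A" "i \<in> {1..r} \<Longrightarrow> j \<in> {1..r} \<Longrightarrow> y i \<otimes> y j = y j \<otimes> y i"
  using assms by (auto simp: commuting_family_def)

lemma monomial_mult_var:
  assumes "commuting_family r y" "i \<in> {1..r}"
  shows "y i [^] k \<otimes> monomial_in A r y \<epsilon> = monomial_in A r y (\<epsilon>(i := \<epsilon> i + k))"
  using assms
proof (induction r)
  case (Suc r)
  let ?w = "y (Suc r)"
  note yS = commuting_familyD(1)[OF Suc.prems(1)]
  have y: "y \<in> {1..r} \<rightarrow> carrier A" "?w \<in> carrier A"
    using yS by (simp_all add: Pi_Suc_iff)
  have mc: "monomial_in A r y \<eta> \<in> carrier A" for \<eta> using y by simp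
  show ?case
  proof (cases "i = Suc r")
    case True
    have comm: "?w [^] k \<otimes> monomial_in A r y \<epsilon> = monomial_in A r y \<epsilon> \<otimes> ?w [^] k"
    proof (rule monomial_commute[OF y(1)])
      fix j assume j: "j \<in> {1..r}"
      show "?w [^] k \<otimes> y j = y j \<otimes> ?w [^] k"
        by (rule pow_commute[symmetric])
          (use y j commuting_familyD(2)[OF Suc.prems(1), of j "Suc r"] in auto)
    qed (use y in auto)
    have "?w [^] k \<otimes> (monomial_in A r y \<epsilon> \<otimes> ?w [^] \<epsilon> (Suc r))
        = (?w [^] k \<otimes> monomial_in A r y \<epsilon>) \<otimes> ?w [^] \<epsilon> (Suc r)"
      using y mc by (simp add: m_assoc)
    also have "\<dots> = monomial_in A r y \<epsilon> \<otimes> ?w [^] (\<epsilon> (Suc r) + k)"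
      unfolding comm using y mc by (simp add: m_assoc nat_pow_mult add.commute)
    also have "\<dots> = monomial_in A r y (\<epsilon>(i := \<epsilon> i + k)) \<otimes> ?w [^] (\<epsilon> (Suc r) + k)"
      by (rule arg_cong[where f = "\<lambda>m. m \<otimes> _"], rule monomial_cong) (use y True in auto)
    finally show ?thesis using True unfolding monomial_Suc[OF yS] by simp
  next
    case False
    then have i: "i \<in> {1..r}" using Suc.prems by auto
    then have yi: "y i \<in> carrier A" using y by auto
    have "commuting_family r y" using Suc.prems(1) by (auto simp: commuting_family_def)
    then have IH: "y i [^] k \<otimes> monomial_in A r y \<epsilon> = monomial_in A r y (\<epsilon>(i := \<epsilon> i + k))"
      using i by (rule Suc.IH)
    have "y i [^] k \<otimes> (monomial_in A r y \<epsilon> \<otimes> ?w [^] \<epsilon> (Suc r))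
        = (y i [^] k \<otimes> monomial_in A r y \<epsilon>) \<otimes> ?w [^] \<epsilon> (Suc r)"
      using y yi mc by (simp add: m_assoc)
    then show ?thesis using False by (simp add: monomial_Suc[OF yS] IH del: fun_upd_apply) simp
  qed
qed simp

lemma ad_one [simp]: "v \<in> carrier A \<Longrightarrow> ad A v \<one> = \<zero>"
  by (simp add: ad_eq_zero_iff)

lemma ad_pow:
  assumes v: "v \<in> carrier A" and y: "y \<in> carrier A" and ad: "ad A v y = c \<odot> \<one>"
  shows "ad A v (y [^] k) = (c * of_nat k) \<odot> y [^] (k - 1)"
proof (induction k)
  case 0
  then show ?case using v by simp
next
  case (Suc k)
  have "ad A v (y [^] Suc k) = ad A v (y [^] k) \<otimes> y \<oplus> y [^] k \<otimes> ad A v y"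
    using v y by (simp add: ad_mult)
  also have "ad A v (y [^] k) \<otimes> y = (c * of_nat k) \<odot> y [^] k"
  proof (cases k)
    case (Suc l)
    then have "y [^] (k - 1) \<otimes> y = y [^] k" by simp
    then show ?thesis unfolding Suc.IH using y by (simp add: smult_mult_left)
  qed (use v y in simp)
  also have "y [^] k \<otimes> ad A v y = c \<odot> y [^] k"
    using y by (simp add: smult_mult_right ad)
  also have "(c * of_nat k) \<odot> y [^] k \<oplus> c \<odot> y [^] k = (c * of_nat (Suc k)) \<odot> y [^] k"
    using y by (simp add: smult_l_distr[symmetric] distrib_left add.commute)
  finally show ?case by simp
qed

lemma ad_monomial:
  assumes "v \<in> carrier A" "i \<in> {1..r}" "y \<in> {1..r} \<rightarrow> carrier A"
    and "\<And>j. j \<in> {1..r} \<Longrightarrow> ad A v (y j) = (if j = i then c else 0) \<odot> \<one>"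
  shows "ad A v (monomial_in A r y \<epsilon>) = (c * of_nat (\<epsilon> i)) \<odot> monomial_in A r y (\<epsilon>(i := \<epsilon> i - 1))"
  using assms
proof (induction r)
  case (Suc r)
  let ?w = "y (Suc r)"
  have v: "v \<in> carrier A" by fact
  have y: "y \<in> {1..r} \<rightarrow> carrier A" "?w \<in> carrier A"
    using Suc.prems(3) by (simp_all add: Pi_Suc_iff)
  have mc: "monomial_in A r y \<eta> \<in> carrier A" for \<eta> using y by simp
  have adw: "ad A v (?w [^] \<epsilon> (Suc r))
      = ((if Suc r = i then c else 0) * of_nat (\<epsilon> (Suc r))) \<odot> ?w [^] (\<epsilon> (Suc r) - 1)"
    by (rule ad_pow[OF v y(2)]) (use Suc.prems(4) in auto)
  show ?case
  proof (cases "i = Suc r")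
    case True
    have "ad A v (monomial_in A r y \<epsilon>) = \<zero>"
    proof (subst ad_eq_zero_iff[OF v mc], rule monomial_commute[OF y(1) v])
      fix j assume j: "j \<in> {1..r}"
      then have "y j \<in> carrier A" using y(1) by auto
      moreover from this have "ad A v (y j) = \<zero>" using Suc.prems(4)[of j] True j by auto
      ultimately show "v \<otimes> y j = y j \<otimes> v" using v by (simp add: ad_eq_zero_iff)
    qed
    moreover have "monomial_in A r y (\<epsilon>(i := \<epsilon> i - 1)) = monomial_in A r y \<epsilon>"
      by (rule monomial_cong) (use y True in auto)
    ultimately show ?thesis
      using v y True mc by (simp add: monomial_Suc[OF Suc.prems(3)] ad_mult adw smult_mult_right del: fun_upd_apply) simp
  next
    case False
    then have i: "i \<in> {1..r}" using Suc.prems(2) by auto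
    have IH: "ad A v (monomial_in A r y \<epsilon>) = (c * of_nat (\<epsilon> i)) \<odot> monomial_in A r y (\<epsilon>(i := \<epsilon> i - 1))"
      by (rule Suc.IH) (use Suc.prems y i in auto)
    show ?thesis
      using v y False mc by (simp add: monomial_Suc[OF Suc.prems(3)] ad_mult adw IH smult_mult_left del: fun_upd_apply) simp
  qed
qed simp

end

section \<open>The calculus of a Weyl family\<close>

text \<open>
  The sign \<open>e\<close> covers both normal forms at once: interchanging the roles of the \<open>q\<^sub>i\<close> and \<open>p\<^sub>i\<close>, or
  passing to the opposite algebra, changes it.
\<close>

locale weyl_family = unital_algebra A for A :: "('k::field, 'a) module" (structure) +
  fixes n :: nat and Q P :: "nat \<Rightarrow> 'a" and e :: 'k
  assumes Q: "commuting_family n Q" and P: "commuting_family n P"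
    and e2: "e * e = 1"
    and PQ: "i \<in> {1..n} \<Longrightarrow> j \<in> {1..n} \<Longrightarrow> ad A (P i) (Q j) = (if i = j then e else 0) \<odot> \<one>"
begin

definition commutant :: "'a set" where
  "commutant = {z \<in> carrier A. \<forall>i\<in>{1..n}. P i \<otimes> z = z \<otimes> P i \<and> Q i \<otimes> z = z \<otimes> Q i}"

definition B :: "(nat \<Rightarrow> nat) \<Rightarrow> (nat \<Rightarrow> nat) \<Rightarrow> 'a \<Rightarrow> 'a" where
  "B a b z = monomial_in A n Q a \<otimes> monomial_in A n P b \<otimes> z"

lemmas Q_Pi = commuting_familyD(1)[OF Q] and P_Pi = commuting_familyD(1)[OF P]

lemma Q_closed [simp]: "i \<in> {1..n} \<Longrightarrow> Q i \<in> carrier A"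
  and P_closed [simp]: "i \<in> {1..n} \<Longrightarrow> P i \<in> carrier A"
  using Q_Pi P_Pi by auto

lemma mons_closed [simp]: "monomial_in A n Q a \<in> carrier A" "monomial_in A n P b \<in> carrier A"
  using Q_Pi P_Pi by auto

lemma commutant_closed: "z \<in> commutant \<Longrightarrow> z \<in> carrier A"
  by (simp add: commutant_def)

lemma B_closed [simp]: "z \<in> commutant \<Longrightarrow> B a b z \<in> carrier A"
  by (simp add: B_def commutant_closed)

lemma B_cong:
  assumes "\<And>i. i \<in> {1..n} \<Longrightarrow> a i = a' i" "\<And>i. i \<in> {1..n} \<Longrightarrow> b i = b' i"
  shows "B a b z = B a' b' z"
  unfolding B_def using assms monomial_cong[OF Q_Pi, of a a'] monomial_cong[OF P_Pi, of b b'] by simp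

lemma QP:
  assumes "i \<in> {1..n}" "j \<in> {1..n}"
  shows "ad A (Q i) (P j) = (if j = i then - e else 0) \<odot> \<one>"
proof -
  have "ad A (Q i) (P j) = \<ominus> ad A (P j) (Q i)"
    unfolding ad_def using assms Q_closed P_closed by algebra
  also have "\<dots> = (if j = i then - e else 0) \<odot> \<one>"
    using assms by (simp add: PQ smult_minus_left)
  finally show ?thesis .
qed

lemma ad_P_B:
  assumes i: "i \<in> {1..n}" and z: "z \<in> commutant"
  shows "ad A (P i) (B a b z) = (e * of_nat (a i)) \<odot> B (a(i := a i - 1)) b z"
proof -
  have zc: "z \<in> carrier A" using z by (rule commutant_closed)
  have 1: "ad A (P i) (monomial_in A n Q a) = (e * of_nat (a i)) \<odot> monomial_in A n Q (a(i := a i - 1))"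
    by (rule ad_monomial) (use i Q_Pi PQ in auto)
  have 2: "ad A (P i) (monomial_in A n P b) = \<zero>"
  proof -
    have "P i \<otimes> monomial_in A n P b = monomial_in A n P b \<otimes> P i"
      by (rule monomial_commute[OF P_Pi P_closed[OF i]]) (rule commuting_familyD(2)[OF P i])
    then show ?thesis using ad_eq_zero_iff[OF P_closed[OF i] mons_closed(2)] by simp
  qed
  have 3: "ad A (P i) z = \<zero>" using z i zc by (subst ad_eq_zero_iff) (auto simp: commutant_def)
  show ?thesis
    using i zc unfolding B_def by (simp add: ad_mult 1 2 3 smult_mult_left)
qed

lemma ad_Q_B:
  assumes i: "i \<in> {1..n}" and z: "z \<in> commutant"
  shows "ad A (Q i) (B a b z) = (- e * of_nat (b i)) \<odot> B a (b(i := b i - 1)) z"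
proof -
  have zc: "z \<in> carrier A" using z by (rule commutant_closed)
  have 1: "ad A (Q i) (monomial_in A n P b) = (- e * of_nat (b i)) \<odot> monomial_in A n P (b(i := b i - 1))"
    by (rule ad_monomial) (use i P_Pi QP in auto)
  have 2: "ad A (Q i) (monomial_in A n Q a) = \<zero>"
  proof -
    have "Q i \<otimes> monomial_in A n Q a = monomial_in A n Q a \<otimes> Q i"
      by (rule monomial_commute[OF Q_Pi Q_closed[OF i]]) (rule commuting_familyD(2)[OF Q i])
    then show ?thesis using ad_eq_zero_iff[OF Q_closed[OF i] mons_closed(1)] by simp
  qed
  have 3: "ad A (Q i) z = \<zero>" using z i zc by (subst ad_eq_zero_iff) (auto simp: commutant_def)
  show ?thesis
    using i zc unfolding B_def by (simp add: ad_mult 1 2 3 smult_mult_left smult_mult_right)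
qed

lemma Q_pow_B:
  assumes "i \<in> {1..n}" "z \<in> commutant"
  shows "Q i [^] k \<otimes> B a b z = B (a(i := a i + k)) b z"
  unfolding B_def monomial_mult_var[OF Q assms(1), symmetric]
  using assms by (simp add: m_assoc commutant_closed)

text \<open>
  In the absence of the \<open>Q\<^sub>i\<close>, a factor \<open>P\<^sub>i\<close> on the left is absorbed without commutators.  This is why
  the projections that remove the \<open>Q\<^sub>i\<close> have to act before those that remove the \<open>P\<^sub>i\<close>.
\<close>

lemma P_pow_B:
  assumes "i \<in> {1..n}" "z \<in> commutant" "\<And>i. i \<in> {1..n} \<Longrightarrow> a i = 0"
  shows "P i [^] k \<otimes> B a b z = B a (b(i := b i + k)) z"
proof -
  have "monomial_in A n Q a = \<one>" by (rule monomial_zero[OF Q_Pi]) (rule assms(3))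
  then show ?thesis
    unfolding B_def monomial_mult_var[OF P assms(1), symmetric]
    using assms(1,2) by (simp add: m_assoc commutant_closed)
qed

end

context unital_algebra
begin

text \<open>
  The projections onto the centre and those onto the constants are Taylor series truncated at \<open>p\<close>: each
  term lowers an exponent \<open>a\<close> by \<open>j\<close> by means of a derivation (\<open>F\<close>) and raises it again by a
  multiplication (\<open>G\<close>).  So \<open>b\<close> is an eigenvector, and its eigenvalue is a truncated alternating sum of
  binomial coefficients.
\<close>

lemma truncated_series:
  assumes char: "CHAR('k) = p" "p > 0" and b: "b \<in> carrier A"
    and F: "\<And>j. j < p \<Longrightarrow> F j = (d j * of_nat (fact j * (a choose j))) \<odot> g j"
    and g: "\<And>j. j < p \<Longrightarrow> g j \<in> carrier A"
    and G: "\<And>j x. j < p \<Longrightarrow> linear_op (G j)" and Gg: "\<And>j. j < p \<Longrightarrow> j \<le> a \<Longrightarrow> G j (g j) = b"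
    and cd: "\<And>j. j < p \<Longrightarrow> c j * d j = (- 1) ^ j"
  shows "(\<Oplus>j\<in>{..<p}. (c j / of_nat (fact j)) \<odot> G j (F j)) = (if p dvd a then 1 else 0) \<odot> b"
proof -
  have "(\<Oplus>j\<in>{..<p}. (c j / of_nat (fact j)) \<odot> G j (F j)) = (\<Oplus>j\<in>{..<p}. ((- 1) ^ j * of_nat (a choose j)) \<odot> b)"
  proof (rule finsum_cong')
    fix j assume j: "j \<in> {..<p}"
    have Gj: "G j x \<in> carrier A" "G j (k \<odot> x) = k \<odot> G j x" if "x \<in> carrier A" for x k
      using G[of j] j that by (auto simp: linear_map_on_def)
    have nz: "(of_nat (fact j) :: 'k) \<noteq> 0" using fact_nonzero_CHAR[where 'k = 'k, of j] j char by simp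
    have "c j / of_nat (fact j) * (d j * of_nat (fact j * (a choose j))) = c j * d j * of_nat (a choose j)"
      using nz by (simp del: of_nat_fact)
    also have "\<dots> = (- 1) ^ j * of_nat (a choose j)" using cd j by simp
    finally have coeff: "c j / of_nat (fact j) * (d j * of_nat (fact j * (a choose j))) = (- 1) ^ j * of_nat (a choose j)" .
    have "(c j / of_nat (fact j)) \<odot> G j (F j) = ((- 1) ^ j * of_nat (a choose j)) \<odot> G j (g j)"
      using j g Gj unfolding coeff[symmetric] by (simp add: F smult_smult)
    also have "\<dots> = ((- 1) ^ j * of_nat (a choose j)) \<odot> b"
    proof (cases "j \<le> a")
      case False
      then show ?thesis using b Gj(1)[OF g] j by (simp add: binomial_eq_0)
    qed (use Gg j in simp)
    finally show "(c j / of_nat (fact j)) \<odot> G j (F j) = ((- 1) ^ j * of_nat (a choose j)) \<odot> b" .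
  qed (use b in auto)
  also have "\<dots> = (\<Sum>j<p. (- 1) ^ j * of_nat (a choose j)) \<odot> b"
    using b by (intro finsum_smult_const) auto
  also have "(\<Sum>j<p. (- 1) ^ j * of_nat (a choose j) :: 'k) = (if p dvd a then 1 else 0)"
    using truncated_alternating_sum[where 'k = 'k, of a] char by simp
  finally show ?thesis .
qed

text \<open>
  Iterated differentiation of a \<open>k\<close>-th power; \<open>j! (k choose j)\<close> is the falling factorial.
\<close>

lemma funpow_lowering:
  assumes M: "\<And>k. M k \<in> carrier A" and F: "\<And>c k. F (c \<odot> M k) = (c * d * of_nat k) \<odot> M (k - 1)"
  shows "(F ^^ j) (M k) = (d ^ j * of_nat (fact j * (k choose j))) \<odot> M (k - j)"
proof (induction j)
  case 0
  show ?case using M by simp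
next
  case (Suc j)
  have "(F ^^ Suc j) (M k) = (d ^ j * of_nat (fact j * (k choose j)) * d * of_nat (k - j)) \<odot> M (k - j - 1)"
    by (simp only: funpow.simps o_apply Suc F)
  also have "d ^ j * of_nat (fact j * (k choose j)) * d * of_nat (k - j)
      = d ^ Suc j * of_nat (fact j * ((k - j) * (k choose j)))"
    by (simp add: mult_ac)
  also have "\<dots> = d ^ Suc j * of_nat (fact (Suc j) * (k choose Suc j))"
    unfolding Suc_times_choose_Suc[symmetric] by (simp only: fact_Suc mult_ac of_nat_id)
  finally show ?case by (simp add: Suc_eq_plus1)
qed

text \<open>
  Differentiation by several variables.  The operators for different indices do not disturb each
  other, because \<open>F i\<close> looks at, and changes, the exponent number \<open>i\<close> only.
\<close>

lemma foldr_lowering: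
  fixes b \<alpha> :: "'i \<Rightarrow> nat"
  assumes "distinct xs" "b \<in> S" and M: "\<And>b. b \<in> S \<Longrightarrow> M b \<in> carrier A"
    and F: "\<And>i c b. i \<in> set xs \<Longrightarrow> b \<in> S \<Longrightarrow> F i (c \<odot> M b) = (c * of_nat (k i (b i))) \<odot> M (b(i := b i - \<alpha> i))"
    and S: "\<And>b b'. b \<in> S \<Longrightarrow> (\<And>i. b' i \<le> b i) \<Longrightarrow> b' \<in> S"
  shows "foldr F xs (M b) = of_nat (\<Prod>i\<in>set xs. k i (b i)) \<odot> M (\<lambda>i. if i \<in> set xs then b i - \<alpha> i else b i)"
  using assms(1) F
proof (induction xs)
  case Nil
  then show ?case using M \<open>b \<in> S\<close> by simp
next
  case (Cons i xs)
  let ?b = "\<lambda>i. if i \<in> set xs then b i - \<alpha> i else b i"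
  have i: "i \<notin> set xs" using Cons.prems(1) by simp
  have bS: "?b \<in> S" by (rule S[OF \<open>b \<in> S\<close>]) auto
  have upd: "?b(i := ?b i - \<alpha> i) = (\<lambda>j. if j \<in> set (i # xs) then b j - \<alpha> j else b j)"
    using i by auto
  have prod: "(\<Prod>i\<in>set (i # xs). k i (b i)) = (\<Prod>i\<in>set xs. k i (b i)) * k i (?b i)"
    using i by simp
  have "foldr F xs (M b) = of_nat (\<Prod>i\<in>set xs. k i (b i)) \<odot> M ?b"
    using Cons.prems by (intro Cons.IH) auto
  moreover have "F i (c \<odot> M ?b) = (c * of_nat (k i (?b i))) \<odot> M (?b(i := ?b i - \<alpha> i))" for c
    by (rule Cons.prems(2)[OF _ bS]) simp
  ultimately have "foldr F (i # xs) (M b)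
      = (of_nat (\<Prod>i\<in>set xs. k i (b i)) * of_nat (k i (?b i))) \<odot> M (?b(i := ?b i - \<alpha> i))"
    by (simp only: foldr.simps o_apply)
  then show ?case by (simp only: upd prod of_nat_mult)
qed

lemma linear_op_left_ad_series:
  assumes "u \<in> carrier A" "v \<in> carrier A"
  shows "linear_op (left_ad_series A p c u v)"
  unfolding left_ad_series_def using assms
  by (intro linear_map_on_finsum linear_map_on_smult linear_map_on_lmult linear_op_funpow linear_op_ad) auto

end

context weyl_family
begin

lemma ad_P_pow_B:
  assumes "i \<in> {1..n}" "z \<in> commutant"
  shows "(ad A (P i) ^^ j) (B a b z)
    = (e ^ j * of_nat (fact j * (a i choose j))) \<odot> B (a(i := a i - j)) b z"
proof -
  let ?M = "\<lambda>k. B (a(i := k)) b z"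
  have M: "?M k \<in> carrier A" for k using assms by simp
  have "ad A (P i) (c \<odot> ?M k) = (c * e * of_nat k) \<odot> ?M (k - 1)" for c k
    using assms by (simp only: ad_smult ad_P_B smult_smult B_closed P_closed Q_closed smult_closed ad_closed fun_upd_same fun_upd_upd mult.assoc)
  from funpow_lowering[where M = ?M, OF M this, of j "a i"] show ?thesis by simp
qed

lemma ad_Q_pow_B:
  assumes "i \<in> {1..n}" "z \<in> commutant"
  shows "(ad A (Q i) ^^ j) (B a b z)
    = ((- e) ^ j * of_nat (fact j * (b i choose j))) \<odot> B a (b(i := b i - j)) z"
proof -
  let ?M = "\<lambda>k. B a (b(i := k)) z"
  have M: "?M k \<in> carrier A" for k using assms by simp
  have "ad A (Q i) (c \<odot> ?M k) = (c * (- e) * of_nat k) \<odot> ?M (k - 1)" for c k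
    using assms by (simp only: ad_smult ad_Q_B smult_smult B_closed P_closed Q_closed smult_closed ad_closed fun_upd_same fun_upd_upd mult.assoc)
  from funpow_lowering[where M = ?M, OF M this, of j "b i"] show ?thesis by simp
qed

text \<open>
  For \<open>e = 1\<close> these are the factors of \<open>\<Phi>\<^sub>\<sigma>\<close>, and those of \<open>\<Psi>\<^sub>\<sigma>\<close> are obtained for \<open>e = -1\<close> in the
  opposite algebra.
\<close>

definition center_factor :: "nat \<Rightarrow> nat \<Rightarrow> 'a \<Rightarrow> 'a" where
  "center_factor p i = (if i \<le> n then left_ad_series A p (- e) (Q i) (P i)
     else left_ad_series A p e (P (i - n)) (Q (i - n)))"

lemma e_power: "e ^ j * e ^ j = 1"
  by (simp add: e2 power_mult_distrib[symmetric])

lemma linear_op_center_factor: "i \<in> {1..2*n} \<Longrightarrow> linear_op (center_factor p i)"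
proof -
  assume "i \<in> {1..2*n}"
  then consider "i \<le> n" "i \<in> {1..n}" | "\<not> i \<le> n" "i - n \<in> {1..n}" by fastforce
  then show ?thesis
    by cases (simp_all only: center_factor_def if_True if_False linear_op_left_ad_series P_closed Q_closed)
qed

text \<open>
  The series lowers the exponent of \<open>Q\<^sub>i\<close> by \<open>ad P\<^sub>i\<close> and restores it; as \<open>a\<^sub>i < p\<close>, divisibility by \<open>p\<close>
  means \<open>a\<^sub>i = 0\<close>.
\<close>

lemma center_factor_Q:
  assumes char: "CHAR('k) = p" "p > 0" and i: "i \<in> {1..n}" and z: "z \<in> commutant" and a: "a i < p"
  shows "center_factor p i (B a b z) = (if a i = 0 then 1 else 0) \<odot> B a b z"
proof -
  have "center_factor p i (B a b z) = (\<Oplus>j\<in>{..<p}. ((- e) ^ j / of_nat (fact j)) \<odot> (Q i [^] j \<otimes> (ad A (P i) ^^ j) (B a b z)))"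
    using i by (simp add: center_factor_def left_ad_series_def)
  also have "\<dots> = (if p dvd a i then 1 else 0) \<odot> B a b z"
  proof (rule truncated_series[OF char, where G = "\<lambda>j x. Q i [^] j \<otimes> x" and F = "\<lambda>j. (ad A (P i) ^^ j) (B a b z)"])
    show "(ad A (P i) ^^ j) (B a b z) = (e ^ j * of_nat (fact j * (a i choose j))) \<odot> B (a(i := a i - j)) b z" for j
      by (rule ad_P_pow_B[OF i z])
    show "(- e) ^ j * e ^ j = (- 1) ^ j" for j
      using e_power[of j] by (subst power_minus) simp
    show "linear_op (\<lambda>x. Q i [^] j \<otimes> x)" for j :: nat
      by (intro linear_map_on_lmult linear_op_id nat_pow_closed Q_closed i)
    show "Q i [^] j \<otimes> B (a(i := a i - j)) b z = B a b z" if "j \<le> a i" for j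
      using that by (simp add: Q_pow_B[OF i z])
  qed (use z in auto)
  also have "p dvd a i \<longleftrightarrow> a i = 0" using a by (auto dest: dvd_imp_le)
  finally show ?thesis .
qed

lemma center_factor_P:
  assumes char: "CHAR('k) = p" "p > 0" and i: "i \<in> {1..n}" and z: "z \<in> commutant" and b: "b i < p"
    and a: "\<And>i. i \<in> {1..n} \<Longrightarrow> a i = 0"
  shows "center_factor p (n + i) (B a b z) = (if b i = 0 then 1 else 0) \<odot> B a b z"
proof -
  have "center_factor p (n + i) (B a b z) = (\<Oplus>j\<in>{..<p}. (e ^ j / of_nat (fact j)) \<odot> (P i [^] j \<otimes> (ad A (Q i) ^^ j) (B a b z)))"
    using i by (simp add: center_factor_def left_ad_series_def)
  also have "\<dots> = (if p dvd b i then 1 else 0) \<odot> B a b z"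
  proof (rule truncated_series[OF char, where G = "\<lambda>j x. P i [^] j \<otimes> x" and F = "\<lambda>j. (ad A (Q i) ^^ j) (B a b z)"])
    show "(ad A (Q i) ^^ j) (B a b z) = ((- e) ^ j * of_nat (fact j * (b i choose j))) \<odot> B a (b(i := b i - j)) z" for j
      by (rule ad_Q_pow_B[OF i z])
    show "e ^ j * (- e) ^ j = (- 1) ^ j" for j
      using e_power[of j] by (subst power_minus) (simp add: mult.left_commute)
    show "linear_op (\<lambda>x. P i [^] j \<otimes> x)" for j :: nat
      by (intro linear_map_on_lmult linear_op_id nat_pow_closed P_closed i)
    show "P i [^] j \<otimes> B a (b(i := b i - j)) z = B a b z" if "j \<le> b i" for j
    proof -
      have "P i [^] j \<otimes> B a (b(i := b i - j)) z = B a ((b(i := b i - j))(i := (b(i := b i - j)) i + j)) z"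
        by (rule P_pow_B[OF i z]) (rule a)
      then show ?thesis using that by simp
    qed
  qed (use z in auto)
  also have "p dvd b i \<longleftrightarrow> b i = 0" using b by (auto dest: dvd_imp_le)
  finally show ?thesis .
qed

text \<open>
  When the first factor that removes a \<open>P\<^sub>i\<close> comes, either no \<open>Q\<^sub>j\<close> is left, so that \<open>center_factor_P\<close>
  applies, or the product has already been killed.
\<close>

lemma fold_center_factors:
  assumes char: "CHAR('k) = p" "p > 0" and z: "z \<in> commutant"
    and ab: "\<And>i. i \<in> {1..n} \<Longrightarrow> a i < p \<and> b i < p" and k: "k \<le> 2 * n"
  shows "fold (center_factor p) [1..<Suc k] (B a b z)
    = (if (\<forall>i\<in>{1..n}. i \<le> k \<longrightarrow> a i = 0) \<and> (\<forall>i\<in>{1..n}. n + i \<le> k \<longrightarrow> b i = 0) then 1 else 0) \<odot> B a b z"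
  using k
proof (induction k)
  case 0
  then show ?case using z by (simp add: One_nat_def)
next
  case (Suc k)
  let ?c = "\<lambda>k. if (\<forall>i\<in>{1..n}. i \<le> k \<longrightarrow> a i = 0) \<and> (\<forall>i\<in>{1..n}. n + i \<le> k \<longrightarrow> b i = 0) then 1 else 0 :: 'k"
  have IH: "fold (center_factor p) [1..<Suc k] (B a b z) = ?c k \<odot> B a b z"
    using Suc by simp
  have upt: "[1..<Suc (Suc k)] = [1..<Suc k] @ [Suc k]" by (rule upt_Suc_append) simp
  have "fold (center_factor p) [1..<Suc (Suc k)] (B a b z) = center_factor p (Suc k) (?c k \<odot> B a b z)"
    unfolding upt fold_append o_apply IH by simp
  also have "\<dots> = ?c k \<odot> center_factor p (Suc k) (B a b z)"
    by (rule linear_op_smultD[OF linear_op_center_factor]) (use Suc.prems z in auto)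
  also have "\<dots> = ?c (Suc k) \<odot> B a b z"
  proof (cases "Suc k \<le> n")
    case True
    then have i: "Suc k \<in> {1..n}" by simp
    have "center_factor p (Suc k) (B a b z) = (if a (Suc k) = 0 then 1 else 0) \<odot> B a b z"
      by (rule center_factor_Q[OF char i z]) (use ab i in auto)
    moreover have "?c k * (if a (Suc k) = 0 then 1 else 0) = ?c (Suc k)"
      using True i by (auto simp: le_Suc_eq)
    ultimately show ?thesis using z by (simp only: smult_smult B_closed)
  next
    case False
    define i where "i = Suc k - n"
    have i: "i \<in> {1..n}" "Suc k = n + i" using False Suc.prems by (auto simp: i_def)
    show ?thesis
    proof (cases "\<forall>i\<in>{1..n}. a i = 0")
      case True
      have "center_factor p (Suc k) (B a b z) = (if b i = 0 then 1 else 0) \<odot> B a b z"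
        unfolding i(2) by (rule center_factor_P[OF char i(1) z]) (use ab i True in auto)
      moreover have "?c k * (if b i = 0 then 1 else 0) = ?c (Suc k)"
      proof -
        have "n + j \<le> Suc k \<longleftrightarrow> n + j \<le> k \<or> j = i" for j using i(2) by linarith
        then show ?thesis using True i(1) by auto
      qed
      ultimately show ?thesis using z by (simp only: smult_smult B_closed)
    next
      case nz: False
      have "\<not> (\<forall>i\<in>{1..n}. i \<le> k \<longrightarrow> a i = 0)" "\<not> (\<forall>i\<in>{1..n}. i \<le> Suc k \<longrightarrow> a i = 0)"
        using nz False by force+
      then have "?c k = 0" "?c (Suc k) = 0" by auto
      moreover have "center_factor p (Suc k) (B a b z) \<in> carrier A"
        using linear_op_center_factor[of "Suc k" p] Suc.prems z by (auto simp: linear_map_on_def)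
      ultimately show ?thesis using z by simp
    qed
  qed
  finally show ?case .
qed

text \<open>
  For \<open>e = 1\<close> this is \<open>\<delta>\<^sup>[\<^sup>\<alpha>\<^sup>,\<^sup>\<beta>\<^sup>]\<close>.  For both signs, \<open>e ad P\<^sub>i\<close> and \<open>- e ad Q\<^sub>i\<close> act on normally ordered
  products as the partial derivatives by \<open>Q\<^sub>i\<close> and \<open>P\<^sub>i\<close>.
\<close>

definition taylor :: "(nat \<Rightarrow> nat) \<Rightarrow> (nat \<Rightarrow> nat) \<Rightarrow> 'a \<Rightarrow> 'a" where
  "taylor \<alpha> \<beta> a = inverse (of_nat (multi_fact n \<alpha> * multi_fact n \<beta>)) \<odot>
     comp_prod n (\<lambda>i. (\<lambda>x. e \<odot> ad A (P i) x) ^^ \<alpha> i)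
       (comp_prod n (\<lambda>j. (\<lambda>x. (- e) \<odot> ad A (Q j) x) ^^ \<beta> j) a)"

lemma scaled_ad_P_pow:
  assumes "i \<in> {1..n}" "z \<in> commutant"
  shows "((\<lambda>x. e \<odot> ad A (P i) x) ^^ j) (B a b z) = of_nat (fact j * (a i choose j)) \<odot> B (a(i := a i - j)) b z"
proof -
  let ?M = "\<lambda>k. B (a(i := k)) b z"
  have M: "?M k \<in> carrier A" for k using assms by simp
  have "e \<odot> ad A (P i) (c \<odot> ?M k) = (c * 1 * of_nat k) \<odot> ?M (k - 1)" for c k
  proof -
    have "e \<odot> ad A (P i) (c \<odot> ?M k) = (e * (c * (e * of_nat k))) \<odot> ?M (k - 1)"
      using assms by (simp only: ad_smult ad_P_B smult_smult B_closed P_closed Q_closed smult_closed ad_closed fun_upd_same fun_upd_upd)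
    also have "e * (c * (e * of_nat k)) = (e * e) * (c * of_nat k)" by (simp add: mult_ac)
    finally show ?thesis by (simp only: e2 mult_1_left mult_1_right)
  qed
  from funpow_lowering[where M = ?M and F = "\<lambda>x. e \<odot> ad A (P i) x", OF M this, of j "a i"]
  show ?thesis by simp
qed

lemma scaled_ad_Q_pow:
  assumes "i \<in> {1..n}" "z \<in> commutant"
  shows "((\<lambda>x. (- e) \<odot> ad A (Q i) x) ^^ j) (B a b z) = of_nat (fact j * (b i choose j)) \<odot> B a (b(i := b i - j)) z"
proof -
  let ?M = "\<lambda>k. B a (b(i := k)) z"
  have M: "?M k \<in> carrier A" for k using assms by simp
  have "(- e) \<odot> ad A (Q i) (c \<odot> ?M k) = (c * 1 * of_nat k) \<odot> ?M (k - 1)" for c k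
  proof -
    have "(- e) \<odot> ad A (Q i) (c \<odot> ?M k) = ((- e) * (c * ((- e) * of_nat k))) \<odot> ?M (k - 1)"
      using assms by (simp only: ad_smult ad_Q_B smult_smult B_closed P_closed Q_closed smult_closed ad_closed fun_upd_same fun_upd_upd)
    also have "(- e) * (c * ((- e) * of_nat k)) = (e * e) * (c * of_nat k)" by (simp add: mult_ac)
    finally show ?thesis by (simp only: e2 mult_1_left mult_1_right)
  qed
  from funpow_lowering[where M = ?M and F = "\<lambda>x. (- e) \<odot> ad A (Q i) x", OF M this, of j "b i"]
  show ?thesis by simp
qed

lemma foldr_scaled_ad_P:
  assumes "distinct xs" "set xs \<subseteq> {1..n}" and z: "z \<in> commutant"
  shows "foldr (\<lambda>i. (\<lambda>x. e \<odot> ad A (P i) x) ^^ \<alpha> i) xs (B a b z)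
    = of_nat (\<Prod>i\<in>set xs. fact (\<alpha> i) * (a i choose \<alpha> i)) \<odot> B (\<lambda>i. if i \<in> set xs then a i - \<alpha> i else a i) b z"
proof (rule foldr_lowering[where S = UNIV and M = "\<lambda>a. B a b z"])
  fix i a' c assume "i \<in> set xs"
  then have i: "i \<in> {1..n}" using assms(2) by blast
  have "linear_op ((\<lambda>x. e \<odot> ad A (P i) x) ^^ \<alpha> i)"
    by (intro linear_op_funpow linear_map_on_smult linear_op_ad P_closed i)
  then show "((\<lambda>x. e \<odot> ad A (P i) x) ^^ \<alpha> i) (c \<odot> B a' b z)
      = (c * of_nat (fact (\<alpha> i) * (a' i choose \<alpha> i))) \<odot> B (a'(i := a' i - \<alpha> i)) b z"
    by (simp only: linear_op_smultD B_closed[OF z] scaled_ad_P_pow[OF i z] smult_smult)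
qed (use assms in simp_all)

lemma foldr_scaled_ad_Q:
  assumes "distinct xs" "set xs \<subseteq> {1..n}" and z: "z \<in> commutant"
  shows "foldr (\<lambda>i. (\<lambda>x. (- e) \<odot> ad A (Q i) x) ^^ \<beta> i) xs (B a b z)
    = of_nat (\<Prod>i\<in>set xs. fact (\<beta> i) * (b i choose \<beta> i)) \<odot> B a (\<lambda>i. if i \<in> set xs then b i - \<beta> i else b i) z"
proof (rule foldr_lowering[where S = UNIV and M = "\<lambda>b. B a b z"])
  fix i b' c assume "i \<in> set xs"
  then have i: "i \<in> {1..n}" using assms(2) by blast
  have "linear_op ((\<lambda>x. (- e) \<odot> ad A (Q i) x) ^^ \<beta> i)"
    by (intro linear_op_funpow linear_map_on_smult linear_op_ad Q_closed i)
  then show "((\<lambda>x. (- e) \<odot> ad A (Q i) x) ^^ \<beta> i) (c \<odot> B a b' z)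
      = (c * of_nat (fact (\<beta> i) * (b' i choose \<beta> i))) \<odot> B a (b'(i := b' i - \<beta> i)) z"
    by (simp only: linear_op_smultD B_closed[OF z] scaled_ad_Q_pow[OF i z] smult_smult)
qed (use assms in simp_all)

lemma linear_op_comp_prod_ad_P: "linear_op (comp_prod n (\<lambda>i. (\<lambda>x. c \<odot> ad A (P i) x) ^^ \<alpha> i))"
  and linear_op_comp_prod_ad_Q: "linear_op (comp_prod n (\<lambda>i. (\<lambda>x. c \<odot> ad A (Q i) x) ^^ \<alpha> i))"
  unfolding comp_prod_def
  by (intro linear_op_foldr linear_op_funpow linear_map_on_smult linear_op_ad P_closed Q_closed; auto)+

lemma linear_op_taylor: "linear_op (taylor \<alpha> \<beta>)"
  unfolding taylor_def[abs_def]
  by (intro linear_map_on_smult linear_op_comp[OF linear_op_comp_prod_ad_P linear_op_comp_prod_ad_Q])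

lemma linear_op_center: "linear_op (comp_prod_rev (2*n) (center_factor p))"
proof -
  have "linear_op (foldr (center_factor p) (rev [1..<Suc (2*n)]))"
    by (rule linear_op_foldr, rule linear_op_center_factor) auto
  then show ?thesis by (simp add: comp_prod_rev_def foldr_conv_fold del: upt_Suc)
qed

lemma taylor_B:
  assumes char: "CHAR('k) = p" "p > 0" and z: "z \<in> commutant"
    and \<alpha>\<beta>: "\<And>i. i \<in> {1..n} \<Longrightarrow> \<alpha> i < p \<and> \<beta> i < p"
  shows "taylor \<alpha> \<beta> (B a b z) = of_nat ((\<Prod>i\<in>{1..n}. a i choose \<alpha> i) * (\<Prod>i\<in>{1..n}. b i choose \<beta> i)) \<odot>
    B (\<lambda>i. a i - \<alpha> i) (\<lambda>i. b i - \<beta> i) z"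
proof -
  have set: "set [1..<Suc n] = {1..n}" by auto
  let ?Ca = "\<Prod>i\<in>{1..n}. a i choose \<alpha> i" and ?Cb = "\<Prod>i\<in>{1..n}. b i choose \<beta> i"
  have 1: "comp_prod n (\<lambda>j. (\<lambda>x. (- e) \<odot> ad A (Q j) x) ^^ \<beta> j) (B a b z)
      = of_nat (multi_fact n \<beta> * ?Cb) \<odot> B a (\<lambda>i. if i \<in> {1..n} then b i - \<beta> i else b i) z"
    unfolding comp_prod_def using foldr_scaled_ad_Q[of "[1..<Suc n]" z \<beta> a b] z
    unfolding set by (simp add: multi_fact_def prod.distrib del: upt_Suc)
  have 2: "comp_prod n (\<lambda>i. (\<lambda>x. e \<odot> ad A (P i) x) ^^ \<alpha> i) (B a b' z)
      = of_nat (multi_fact n \<alpha> * ?Ca) \<odot> B (\<lambda>i. if i \<in> {1..n} then a i - \<alpha> i else a i) b' z" for b'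
    unfolding comp_prod_def using foldr_scaled_ad_P[of "[1..<Suc n]" z \<alpha> a b'] z
    unfolding set by (simp add: multi_fact_def prod.distrib del: upt_Suc)
  have lin': "linear_op (comp_prod n (\<lambda>i. (\<lambda>x. e \<odot> ad A (P i) x) ^^ \<alpha> i))"
    by (rule linear_op_comp_prod_ad_P)
  have nz: "(of_nat (multi_fact n \<alpha> * multi_fact n \<beta>) :: 'k) \<noteq> 0"
    unfolding multi_fact_def of_nat_mult of_nat_prod
    using fact_nonzero_CHAR[where 'k = 'k] \<alpha>\<beta> char by (auto simp del: of_nat_fact)
  have "taylor \<alpha> \<beta> (B a b z) = (inverse (of_nat (multi_fact n \<alpha> * multi_fact n \<beta>)) *
      (of_nat (multi_fact n \<beta> * ?Cb) * of_nat (multi_fact n \<alpha> * ?Ca))) \<odot>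
      B (\<lambda>i. if i \<in> {1..n} then a i - \<alpha> i else a i) (\<lambda>i. if i \<in> {1..n} then b i - \<beta> i else b i) z"
    unfolding taylor_def 1 linear_op_smultD[OF lin' B_closed[OF z]] 2 using z
    by (simp add: smult_smult mult.assoc)
  also have "inverse (of_nat (multi_fact n \<alpha> * multi_fact n \<beta>)) *
      (of_nat (multi_fact n \<beta> * ?Cb) * of_nat (multi_fact n \<alpha> * ?Ca)) = (of_nat (?Ca * ?Cb) :: 'k)"
    using nz by (simp add: field_simps)
  also have "B (\<lambda>i. if i \<in> {1..n} then a i - \<alpha> i else a i) (\<lambda>i. if i \<in> {1..n} then b i - \<beta> i else b i) z
      = B (\<lambda>i. a i - \<alpha> i) (\<lambda>i. b i - \<beta> i) z"
    by (rule B_cong) auto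
  finally show ?thesis .
qed

text \<open>
  Differentiation kills the products in which an exponent is smaller than the wanted one and
  turns the wanted product into \<open>z\<close>.  In the remaining ones some exponent is too large; a factor
  \<open>Q\<^sub>i\<close> or \<open>P\<^sub>i\<close> survives in them, and the projection removes them.
\<close>

theorem center_coefficient:
  assumes char: "CHAR('k) = p" "p > 0" and z: "z \<in> commutant"
    and ab: "a \<in> restricted_exponents p n" "b \<in> restricted_exponents p n"
    and \<alpha>\<beta>: "\<alpha> \<in> restricted_exponents p n" "\<beta> \<in> restricted_exponents p n"
  shows "comp_prod_rev (2*n) (center_factor p) (taylor \<alpha> \<beta> (B a b z)) = (if a = \<alpha> \<and> b = \<beta> then z else \<zero>)"
proof -
  let ?C = "(\<Prod>i\<in>{1..n}. a i choose \<alpha> i) * (\<Prod>i\<in>{1..n}. b i choose \<beta> i)"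
  let ?a = "\<lambda>i. a i - \<alpha> i" and ?b = "\<lambda>i. b i - \<beta> i"
  have eq_iff: "f = g \<longleftrightarrow> (\<forall>i\<in>{1..n}. f i = g i)"
    if "f \<in> restricted_exponents p n" "g \<in> restricted_exponents p n" for f g :: "nat \<Rightarrow> nat"
  proof (intro iffI ext)
    fix i assume "\<forall>i\<in>{1..n}. f i = g i"
    moreover have "i \<notin> {1..n} \<Longrightarrow> f i = 0" "i \<notin> {1..n} \<Longrightarrow> g i = 0"
      using that by (simp_all add: restricted_exponents_def exponents_def del: atLeastAtMost_iff)
    ultimately show "f i = g i" by (cases "i \<in> {1..n}") (simp_all del: atLeastAtMost_iff)
  qed simp
  have t: "taylor \<alpha> \<beta> (B a b z) = of_nat ?C \<odot> B ?a ?b z"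
    by (rule taylor_B[OF char z]) (use \<alpha>\<beta> in \<open>auto simp: restricted_exponents_def\<close>)
  have "comp_prod_rev (2*n) (center_factor p) (taylor \<alpha> \<beta> (B a b z))
      = of_nat ?C \<odot> fold (center_factor p) [1..<Suc (2*n)] (B ?a ?b z)"
    unfolding t comp_prod_rev_def[symmetric]
    by (rule linear_op_smultD[OF linear_op_center B_closed[OF z]])
  also have "fold (center_factor p) [1..<Suc (2*n)] (B ?a ?b z)
    = (if (\<forall>i\<in>{1..n}. i \<le> 2*n \<longrightarrow> ?a i = 0) \<and> (\<forall>i\<in>{1..n}. n + i \<le> 2*n \<longrightarrow> ?b i = 0) then 1 else 0) \<odot> B ?a ?b z"
    by (rule fold_center_factors[OF char z])
      (use ab in \<open>auto simp: restricted_exponents_def less_imp_diff_less\<close>)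
  also have "((\<forall>i\<in>{1..n}. i \<le> 2*n \<longrightarrow> ?a i = 0) \<and> (\<forall>i\<in>{1..n}. n + i \<le> 2*n \<longrightarrow> ?b i = 0))
      \<longleftrightarrow> (\<forall>i\<in>{1..n}. a i \<le> \<alpha> i \<and> b i \<le> \<beta> i)"
    by auto
  also have "of_nat ?C \<odot> ((if \<forall>i\<in>{1..n}. a i \<le> \<alpha> i \<and> b i \<le> \<beta> i then 1 else 0) \<odot> B ?a ?b z)
      = (if a = \<alpha> \<and> b = \<beta> then z else \<zero>)"
  proof (cases "\<forall>i\<in>{1..n}. a i \<le> \<alpha> i \<and> b i \<le> \<beta> i")
    case True
    show ?thesis
    proof (cases "a = \<alpha> \<and> b = \<beta>")
      case eq: True
      then have "?C = 1" by simp
      moreover have "monomial_in A n Q ?a = \<one>" "monomial_in A n P ?b = \<one>"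
        using monomial_zero[OF Q_Pi, of ?a] monomial_zero[OF P_Pi, of ?b] eq by auto
      ultimately show ?thesis using True eq z by (simp add: B_def commutant_closed)
    next
      case False
      then obtain i where i: "i \<in> {1..n}" "a i \<noteq> \<alpha> i \<or> b i \<noteq> \<beta> i"
        unfolding eq_iff[OF ab(1) \<alpha>\<beta>(1)] eq_iff[OF ab(2) \<alpha>\<beta>(2)] by blast
      have "a i \<le> \<alpha> i" "b i \<le> \<beta> i" using True i(1) by blast+
      then have "a i < \<alpha> i \<or> b i < \<beta> i" using i(2) by linarith
      then have "(\<Prod>i\<in>{1..n}. a i choose \<alpha> i) = 0 \<or> (\<Prod>i\<in>{1..n}. b i choose \<beta> i) = 0"
      proof
        assume "a i < \<alpha> i"
        then have "\<exists>i\<in>{1..n}. a i choose \<alpha> i = 0" using i(1) binomial_eq_0 by blast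
        then have "(\<Prod>i\<in>{1..n}. a i choose \<alpha> i) = 0" by (rule prod_zero[OF finite_atLeastAtMost])
        then show ?thesis ..
      next
        assume "b i < \<beta> i"
        then have "\<exists>i\<in>{1..n}. b i choose \<beta> i = 0" using i(1) binomial_eq_0 by blast
        then have "(\<Prod>i\<in>{1..n}. b i choose \<beta> i) = 0" by (rule prod_zero[OF finite_atLeastAtMost])
        then show ?thesis ..
      qed
      then have "?C = 0" by (simp only: mult_eq_0_iff)
      then have "(of_nat ?C :: 'k) = 0" by (simp only: of_nat_0)
      moreover have "(if a = \<alpha> \<and> b = \<beta> then z else \<zero>) = \<zero>" using False by auto
      ultimately show ?thesis using z by (simp only: smult_zero_left smult_closed B_closed)
    qed
  next
    case False
    then have "\<not> (a = \<alpha> \<and> b = \<beta>)" by auto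
    then show ?thesis
      by (simp only: False if_False smult_zero_left[OF B_closed[OF z]] smult_zero_right)
  qed
  finally show ?thesis .
qed

end

section \<open>Normal forms\<close>

context unital_algebra
begin

lemma pow_1: "a \<in> carrier A \<Longrightarrow> a [^] (1::nat) = a"
  by (simp add: One_nat_def)

lemma lincomb_pscale:
  assumes "\<And>i. i \<in> keys f \<Longrightarrow> g i \<in> carrier A"
  shows "lincomb A g (pscale c f) = c \<odot> lincomb A g f"
proof -
  have "lincomb A g (pscale c f) = (\<Oplus>i\<in>keys f. lookup (pscale c f) i \<odot> g i)"
    by (rule lincomb_superset) (use assms keys_pscale[of c f] in auto)
  also have "\<dots> = (\<Oplus>i\<in>keys f. c \<odot> (lookup f i \<odot> g i))"
    by (rule finsum_cong') (use assms in \<open>auto simp: smult_smult\<close>)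
  also have "\<dots> = c \<odot> lincomb A g f"
    unfolding lincomb_def by (rule smult_finsum[symmetric]) (use assms in auto)
  finally show ?thesis .
qed

lemma vector_subspace_lincombs:
  assumes "\<And>i. i \<in> I \<Longrightarrow> g i \<in> carrier A"
  shows "vector_subspace A {lincomb A g f | f. keys f \<subseteq> I}" (is "vector_subspace A ?S")
  unfolding vector_subspace_def
proof (intro conjI allI ballI)
  show "?S \<subseteq> carrier A" using assms by (auto intro!: lincomb_closed)
  show "\<zero> \<in> ?S" using lincomb_zero by (metis (mono_tags, lifting) empty_subsetI keys_zero mem_Collect_eq)
  fix a assume "a \<in> ?S"
  then obtain f where f: "a = lincomb A g f" "keys f \<subseteq> I" by blast
  {
    fix b assume "b \<in> ?S"
    then obtain h where h: "b = lincomb A g h" "keys h \<subseteq> I" by blast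
    have "a \<oplus> b = lincomb A g (f + h)"
      unfolding f h by (rule lincomb_add[symmetric]) (use f h assms in blast)
    moreover have "keys (f + h) \<subseteq> I" using Poly_Mapping.keys_add[of f h] f h by blast
    ultimately show "a \<oplus> b \<in> ?S" by blast
  }
  fix c
  have "c \<odot> a = lincomb A g (pscale c f)"
    unfolding f by (rule lincomb_pscale[symmetric]) (use f assms in blast)
  moreover have "keys (pscale c f) \<subseteq> I" using keys_pscale[of c f] f by blast
  ultimately show "c \<odot> a \<in> ?S" by blast
qed

lemma lincomb_generator:
  assumes "i \<in> I" "g i \<in> carrier A"
  shows "g i \<in> {lincomb A g f | f. keys f \<subseteq> I}"
proof -
  have "lincomb A g (single i 1) = g i" using assms(2) by (simp add: lincomb_single)
  moreover have "keys (single i (1::'k)) \<subseteq> I" using assms(1) by simp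
  ultimately show ?thesis by (metis (mono_tags, lifting) mem_Collect_eq)
qed

end

text \<open>
  The maps \<open>kq\<close> and \<open>kp\<close> tell which central generators are the \<open>p\<close>-th powers of the \<open>Q\<^sub>i\<close> and \<open>P\<^sub>i\<close>; as
  parameters they allow for the interchange of the two halves of the family.
\<close>

locale weyl_center = weyl_family A n Q P e
  for A :: "('k::field, 'a) module" (structure) and n Q P e +
  fixes s p :: nat and x :: "nat \<Rightarrow> 'a" and kq kp :: "nat \<Rightarrow> nat"
  assumes x: "commuting_family s x" and x_commutant: "j \<in> {1..s} \<Longrightarrow> x j \<in> commutant"
    and p: "p > 0"
    and kq: "i \<in> {1..n} \<Longrightarrow> kq i \<in> {1..s}" "i \<in> {1..n} \<Longrightarrow> Q i [^] p = x (kq i)"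
    and kp: "i \<in> {1..n} \<Longrightarrow> kp i \<in> {1..s}" "i \<in> {1..n} \<Longrightarrow> P i [^] p = x (kp i)"
    and generated: "\<And>S. vector_subspace A S \<Longrightarrow> \<one> \<in> S \<Longrightarrow>
      (\<And>i a. i \<in> {1..n} \<Longrightarrow> a \<in> S \<Longrightarrow> Q i \<otimes> a \<in> S) \<Longrightarrow>
      (\<And>i a. i \<in> {1..n} \<Longrightarrow> a \<in> S \<Longrightarrow> P i \<otimes> a \<in> S) \<Longrightarrow>
      (\<And>j a. j \<in> {1..s} \<Longrightarrow> a \<in> S \<Longrightarrow> x j \<otimes> a \<in> S) \<Longrightarrow> carrier A \<subseteq> S"

context weyl_family
begin

lemma commutant_monomial:
  assumes x: "commuting_family s x" and "\<And>j. j \<in> {1..s} \<Longrightarrow> x j \<in> commutant"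
  shows "monomial_in A s x \<gamma> \<in> commutant"
  unfolding commutant_def
proof (intro CollectI conjI ballI)
  note xPi = commuting_familyD(1)[OF x]
  show "monomial_in A s x \<gamma> \<in> carrier A" using xPi by simp
  fix i assume i: "i \<in> {1..n}"
  show "P i \<otimes> monomial_in A s x \<gamma> = monomial_in A s x \<gamma> \<otimes> P i"
    by (rule monomial_commute[OF xPi P_closed[OF i]]) (use assms(2) i in \<open>auto simp: commutant_def\<close>)
  show "Q i \<otimes> monomial_in A s x \<gamma> = monomial_in A s x \<gamma> \<otimes> Q i"
    by (rule monomial_commute[OF xPi Q_closed[OF i]]) (use assms(2) i in \<open>auto simp: commutant_def\<close>)
qed

lemma commutant_commutes:
  assumes "c \<in> commutant"
  shows "c \<otimes> monomial_in A n Q a = monomial_in A n Q a \<otimes> c"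
    and "c \<otimes> monomial_in A n P a = monomial_in A n P a \<otimes> c"
  by (rule monomial_commute[OF Q_Pi commutant_closed[OF assms]],
      use assms in \<open>auto simp: commutant_def\<close>)
    (rule monomial_commute[OF P_Pi commutant_closed[OF assms]],
      use assms in \<open>auto simp: commutant_def\<close>)

lemma commutant_B:
  assumes c: "c \<in> commutant" and z: "z \<in> commutant"
  shows "c \<otimes> B a b z = B a b (c \<otimes> z)"
proof -
  note cl = commutant_closed[OF c] commutant_closed[OF z]
  have "c \<otimes> B a b z = (c \<otimes> monomial_in A n Q a) \<otimes> (monomial_in A n P b \<otimes> z)"
    unfolding B_def using cl by (simp add: m_assoc)
  also have "\<dots> = monomial_in A n Q a \<otimes> ((c \<otimes> monomial_in A n P b) \<otimes> z)"
    unfolding commutant_commutes(1)[OF c] using cl by (simp add: m_assoc)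
  also have "\<dots> = B a b (c \<otimes> z)"
    unfolding commutant_commutes(2)[OF c] B_def using cl by (simp add: m_assoc)
  finally show ?thesis .
qed

lemma P_mult_B:
  assumes i: "i \<in> {1..n}" and z: "z \<in> commutant"
  shows "P i \<otimes> B a b z = (e * of_nat (a i)) \<odot> B (a(i := a i - 1)) b z \<oplus> B a (b(i := b i + 1)) z"
proof -
  note cl = commutant_closed[OF z] P_closed[OF i]
  have "P i \<otimes> B a b z = ad A (P i) (B a b z) \<oplus> B a b z \<otimes> P i"
    unfolding ad_def using cl(2) B_closed[OF z, of a b] by algebra
  also have "B a b z \<otimes> P i = monomial_in A n Q a \<otimes> ((monomial_in A n P b \<otimes> P i) \<otimes> z)"
    unfolding B_def using z i cl by (simp add: m_assoc commutant_def)
  also have "monomial_in A n P b \<otimes> P i = P i \<otimes> monomial_in A n P b"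
    by (rule monomial_commute[OF P_Pi cl(2), symmetric]) (rule commuting_familyD(2)[OF P i])
  also have "\<dots> = monomial_in A n P (b(i := b i + 1))"
    using monomial_mult_var[OF P i, of 1 b] cl by (simp add: One_nat_def)
  also have "monomial_in A n Q a \<otimes> (monomial_in A n P (b(i := b i + 1)) \<otimes> z) = B a (b(i := b i + 1)) z"
    unfolding B_def using cl by (simp add: m_assoc)
  finally show ?thesis unfolding ad_P_B[OF i z] .
qed

end

context weyl_center
begin

definition basis :: "(nat \<Rightarrow> nat) \<times> (nat \<Rightarrow> nat) \<times> (nat \<Rightarrow> nat) \<Rightarrow> 'a" where
  "basis = (\<lambda>(a, b, \<gamma>). B a b (monomial_in A s x \<gamma>))"

abbreviation "index \<equiv> restricted_exponents p n \<times> restricted_exponents p n \<times> exponents {1..s}"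

lemma mon_commutant: "monomial_in A s x \<gamma> \<in> commutant"
  using x x_commutant by (rule commutant_monomial)

lemma basis_closed: "basis t \<in> carrier A"
  by (cases t) (simp add: basis_def mon_commutant)

lemma x_mult_mon: "j \<in> {1..s} \<Longrightarrow> x j \<otimes> monomial_in A s x \<gamma> = monomial_in A s x (\<gamma>(j := \<gamma> j + 1))"
  using monomial_mult_var[OF x, of j 1 \<gamma>] pow_1[OF commutant_closed[OF x_commutant]] by simp

lemma restricted_update:
  "a \<in> restricted_exponents p n \<Longrightarrow> i \<in> {1..n} \<Longrightarrow> k < p \<Longrightarrow> a(i := k) \<in> restricted_exponents p n"
  by (auto simp: restricted_exponents_def exponents_def)

lemma exponents_update: "\<gamma> \<in> exponents {1..s} \<Longrightarrow> j \<in> {1..s} \<Longrightarrow> \<gamma>(j := k) \<in> exponents {1..s}"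
  by (auto simp: exponents_def)

text \<open>
  The span of the normally ordered products contains \<open>1\<close> and is stable under left multiplication by
  the generators.  Such a multiplication raises an exponent and, for \<open>P\<^sub>i\<close>, adds a commutator
  term with a lower exponent of \<open>Q\<^sub>i\<close>.  When an exponent reaches \<open>p\<close>, the \<open>p\<close>-th power is central
  and moves to the last factor.
\<close>

lemma normal_form:
  assumes "a \<in> carrier A"
  shows "\<exists>f. keys f \<subseteq> index \<and> a = lincomb A basis f"
proof -
  define S where "S = {lincomb A basis f | f. keys f \<subseteq> index}"
  have S: "vector_subspace A S" unfolding S_def by (rule vector_subspace_lincombs) (rule basis_closed)
  have basis_S: "B a b (monomial_in A s x \<gamma>) \<in> S"
    if "a \<in> restricted_exponents p n" "b \<in> restricted_exponents p n" "\<gamma> \<in> exponents {1..s}" for a b \<gamma>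
  proof -
    have "basis (a, b, \<gamma>) \<in> S"
      unfolding S_def using that by (intro lincomb_generator[where g = basis] basis_closed) simp
    then show ?thesis by (simp add: basis_def)
  qed
  have reduce: "u \<otimes> a \<in> S" if u: "u \<in> carrier A" and a: "a \<in> S"
    and uB: "\<And>a b \<gamma>. a \<in> restricted_exponents p n \<Longrightarrow> b \<in> restricted_exponents p n \<Longrightarrow> \<gamma> \<in> exponents {1..s} \<Longrightarrow>
      u \<otimes> B a b (monomial_in A s x \<gamma>) \<in> S" for u a
  proof -
    obtain f where f: "keys f \<subseteq> index" "a = lincomb A basis f" using a unfolding S_def by blast
    have "u \<otimes> a = lincomb A (\<lambda>t. u \<otimes> basis t) f"
      unfolding f(2) by (rule linear_map_on_lincomb[OF unital_algebra_axioms subspace_carrier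
          linear_map_on_lmult[OF u linear_op_id]]) (rule basis_closed)
    also have "\<dots> \<in> S"
    proof (rule subspace_lincomb[OF S])
      fix t assume "t \<in> keys f"
      then have "t \<in> index" using f(1) by blast
      then show "u \<otimes> basis t \<in> S" using uB by (cases t) (simp add: basis_def)
    qed
    finally show ?thesis .
  qed
  have x_S: "x j \<otimes> B a b (monomial_in A s x \<gamma>) \<in> S"
    if j: "j \<in> {1..s}" and "a \<in> restricted_exponents p n" "b \<in> restricted_exponents p n" "\<gamma> \<in> exponents {1..s}"
    for a b \<gamma> j
    unfolding commutant_B[OF x_commutant[OF j] mon_commutant] x_mult_mon[OF j]
    by (intro basis_S exponents_update that)
  have "carrier A \<subseteq> S"
  proof (rule generated[OF S])
    have "B (\<lambda>i. 0) (\<lambda>i. 0) (monomial_in A s x (\<lambda>i. 0)) \<in> S"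
      by (rule basis_S) (use p in \<open>auto simp: restricted_exponents_def exponents_def\<close>)
    moreover have "B (\<lambda>i. 0) (\<lambda>i. 0) (monomial_in A s x (\<lambda>i. 0)) = \<one>"
      unfolding B_def
      by (simp add: monomial_zero[OF Q_Pi] monomial_zero[OF P_Pi] monomial_zero[OF commuting_familyD(1)[OF x]])
    ultimately show "\<one> \<in> S" by simp
  next
    fix j a assume j: "j \<in> {1..s}" and a: "a \<in> S"
    show "x j \<otimes> a \<in> S"
      by (rule reduce[OF commutant_closed[OF x_commutant[OF j]] a]) (rule x_S[OF j])
  next
    fix i a assume i: "i \<in> {1..n}" and "a \<in> S"
    from Q_closed[OF i] this(2) show "Q i \<otimes> a \<in> S"
    proof (rule reduce)
      fix a b \<gamma> assume ab: "a \<in> restricted_exponents p n" "b \<in> restricted_exponents p n" "\<gamma> \<in> exponents {1..s}"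
      have "Q i \<otimes> B a b (monomial_in A s x \<gamma>) = B (a(i := a i + 1)) b (monomial_in A s x \<gamma>)"
        using Q_pow_B[OF i mon_commutant, of 1 a b \<gamma>] pow_1[OF Q_closed[OF i]] by simp
      also have "\<dots> \<in> S"
      proof (cases "a i + 1 < p")
        case True
        then show ?thesis by (intro basis_S restricted_update ab i)
      next
        case False
        have "a i < p" using ab(1) i unfolding restricted_exponents_def by blast
        with False have "a i + 1 = p" by linarith
        then have "B (a(i := a i + 1)) b (monomial_in A s x \<gamma>) = Q i [^] p \<otimes> B (a(i := 0)) b (monomial_in A s x \<gamma>)"
          by (simp add: Q_pow_B[OF i mon_commutant])
        also have "\<dots> \<in> S"
          unfolding kq(2)[OF i] by (intro x_S kq(1) ab i p restricted_update)
        finally show ?thesis .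
      qed
      finally show "Q i \<otimes> B a b (monomial_in A s x \<gamma>) \<in> S" .
    qed
  next
    fix i a assume i: "i \<in> {1..n}" and "a \<in> S"
    from P_closed[OF i] this(2) show "P i \<otimes> a \<in> S"
    proof (rule reduce)
      fix a b \<gamma> assume ab: "a \<in> restricted_exponents p n" "b \<in> restricted_exponents p n" "\<gamma> \<in> exponents {1..s}"
      let ?z = "monomial_in A s x \<gamma>"
      have lt: "a i < p" "b i < p" using ab i unfolding restricted_exponents_def by blast+
      have 1: "B (a(i := a i - 1)) b ?z \<in> S"
        by (intro basis_S restricted_update ab i less_imp_diff_less lt)
      have "B a (b(i := b i + 1)) ?z \<in> S"
      proof (cases "b i + 1 < p")
        case True
        then show ?thesis by (intro basis_S restricted_update ab i)
      next
        case False
        with lt have "b i + 1 = p" by linarith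
        then have "monomial_in A n P (b(i := b i + 1)) = P i [^] p \<otimes> monomial_in A n P (b(i := 0))"
          by (simp add: monomial_mult_var[OF P i])
        also have "\<dots> = monomial_in A n P (b(i := 0)) \<otimes> x (kp i)"
          unfolding kp(2)[OF i] by (rule commutant_commutes(2)[OF x_commutant[OF kp(1)[OF i]]])
        finally have "B a (b(i := b i + 1)) ?z = B a (b(i := 0)) (x (kp i) \<otimes> ?z)"
          unfolding B_def using x_commutant[OF kp(1)[OF i]] mon_commutant[of \<gamma>]
          by (simp add: m_assoc commutant_closed)
        also have "\<dots> = B a (b(i := 0)) (monomial_in A s x (\<gamma>(kp i := \<gamma> (kp i) + 1)))"
          unfolding x_mult_mon[OF kp(1)[OF i]] ..
        also have "\<dots> \<in> S"
          by (intro basis_S restricted_update exponents_update kp(1) ab i p)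
        finally show ?thesis .
      qed
      with 1 S show "P i \<otimes> B a b ?z \<in> S"
        unfolding P_mult_B[OF i mon_commutant] by (auto simp: vector_subspace_def)
    qed
  qed
  then show ?thesis using assms unfolding S_def by blast
qed

end

section \<open>The opposite algebra\<close>

definition opposite :: "('k, 'a) module \<Rightarrow> ('k, 'a) module" where
  "opposite A = A\<lparr>monoid.mult := \<lambda>a b. b \<otimes>\<^bsub>A\<^esub> a\<rparr>"

lemma opposite_simps [simp]:
  "carrier (opposite A) = carrier A" "\<one>\<^bsub>opposite A\<^esub> = \<one>\<^bsub>A\<^esub>" "\<zero>\<^bsub>opposite A\<^esub> = \<zero>\<^bsub>A\<^esub>"
  "a \<oplus>\<^bsub>opposite A\<^esub> b = a \<oplus>\<^bsub>A\<^esub> b" "c \<odot>\<^bsub>opposite A\<^esub> a = c \<odot>\<^bsub>A\<^esub> a"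
  "a \<otimes>\<^bsub>opposite A\<^esub> b = b \<otimes>\<^bsub>A\<^esub> a"
  by (simp_all add: opposite_def)

lemma opposite_additive [simp]:
  "finsum (opposite A) = finsum A" "a_inv (opposite A) = a_inv A"
  "a \<ominus>\<^bsub>opposite A\<^esub> b = a \<ominus>\<^bsub>A\<^esub> b" "linear_map_on (opposite A) S (opposite A) F = linear_map_on A S A F"
  by (simp_all add: finsum_def[abs_def] a_inv_def a_minus_def linear_map_on_def opposite_def)

context unital_algebra
begin

lemma unital_algebra_opposite: "unital_algebra (opposite A)"
proof (intro unital_algebra.intro unital_algebra_axioms.intro ringI abelian_groupI monoidI,
    unfold opposite_simps)
  show "\<exists>y\<in>carrier A. y \<oplus> x = \<zero>" if "x \<in> carrier A" for x
    using l_neg[OF that] a_inv_closed[OF that] by blast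
qed (simp_all add: m_assoc l_distr r_distr a_ac smult_l_distr smult_r_distr smult_smult
    smult_mult_left smult_mult_right)

lemma pow_opposite [simp]:
  assumes "a \<in> carrier A"
  shows "a [^]\<^bsub>opposite A\<^esub> (k::nat) = a [^] k"
proof (induction k)
  case (Suc k)
  have "a [^]\<^bsub>opposite A\<^esub> Suc k = a \<otimes> a [^] k"
    using Suc by (simp add: nat_pow_def)
  then show ?case using assms by (simp add: nat_pow_comm[of a 1 k, simplified] pow_commute)
qed (simp add: nat_pow_def)

lemma ad_opposite: "v \<in> carrier A \<Longrightarrow> a \<in> carrier A \<Longrightarrow> ad (opposite A) v a = (- 1) \<odot> ad A v a"
  unfolding ad_def opposite_additive opposite_simps a_inv_smult[symmetric, OF minus_closed[OF m_closed m_closed]]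
  by algebra

lemma monomial_opposite:
  assumes "commuting_family r y"
  shows "monomial_in (opposite A) r y \<epsilon> = monomial_in A r y \<epsilon>"
  using assms
proof (induction r)
  interpret O: unital_algebra "opposite A" by (rule unital_algebra_opposite)
  case 0
  then show ?case by simp
next
  interpret O: unital_algebra "opposite A" by (rule unital_algebra_opposite)
  case (Suc r)
  note yS = commuting_familyD(1)[OF Suc.prems]
  have y: "y \<in> {1..r} \<rightarrow> carrier A" "y (Suc r) \<in> carrier A" using yS by (simp_all add: Pi_Suc_iff)
  have IH: "monomial_in (opposite A) r y \<epsilon> = monomial_in A r y \<epsilon>"
  proof (rule Suc.IH)
    show "commuting_family r y"
      using Suc.prems by (simp add: commuting_family_def Pi_Suc_iff atLeastAtMostSuc_conv)
  qed
  have "monomial_in (opposite A) (Suc r) y \<epsilon> = y (Suc r) [^] \<epsilon> (Suc r) \<otimes> monomial_in A r y \<epsilon>"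
    using yS y(2) by (simp add: O.monomial_Suc IH)
  also have "\<dots> = monomial_in A r y \<epsilon> \<otimes> y (Suc r) [^] \<epsilon> (Suc r)"
  proof (rule monomial_commute[OF y(1)])
    fix j assume j: "j \<in> {1..r}"
    show "y (Suc r) [^] \<epsilon> (Suc r) \<otimes> y j = y j \<otimes> y (Suc r) [^] \<epsilon> (Suc r)"
      by (rule pow_commute[symmetric])
        (use y j commuting_familyD(2)[OF Suc.prems, of j "Suc r"] in auto)
  qed (use y in auto)
  finally show ?case by (simp add: monomial_Suc[OF yS])
qed

lemma ad_opposite_pow:
  assumes "v \<in> carrier A" "a \<in> carrier A"
  shows "(ad (opposite A) v ^^ j) a = (- 1) ^ j \<odot> (ad A v ^^ j) a \<and> (ad A v ^^ j) a \<in> carrier A"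
  using assms by (induction j) (auto simp: ad_opposite ad_smult smult_smult)

text \<open>
  The operators \<open>\<Psi>\<close> thus become operators of type \<open>\<Phi>\<close>; the sign of the coefficient changes because the
  commutator does.
\<close>

lemma left_ad_series_opposite:
  assumes "u \<in> carrier A" "v \<in> carrier A" "a \<in> carrier A"
  shows "left_ad_series (opposite A) p c u v a = right_ad_series A p (- c) u v a"
  unfolding left_ad_series_def right_ad_series_def opposite_additive opposite_simps
proof (rule finsum_cong')
  fix j assume "j \<in> {..<p}"
  note ad = ad_opposite_pow[OF assms(2,3), of j]
  have "c ^ j * (- 1) ^ j = (- c) ^ j"
    by (simp add: power_mult_distrib[symmetric])
  then show "(c ^ j / of_nat (fact j)) \<odot> ((ad (opposite A) v ^^ j) a \<otimes> u [^]\<^bsub>opposite A\<^esub> j)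
      = ((- c) ^ j / of_nat (fact j)) \<odot> ((ad A v ^^ j) a \<otimes> u [^] j)"
    using ad assms by (simp add: smult_mult_left smult_smult del: of_nat_fact)
qed (use assms ad_opposite_pow in auto)

end

context weyl_family
begin

lemma weyl_family_opposite: "weyl_family (opposite A) n Q P (- e)"
proof -
  interpret O: unital_algebra "opposite A" by (rule unital_algebra_opposite)
  show ?thesis
  proof
    show "O.commuting_family n Q" using Q by (simp add: O.commuting_family_def commuting_family_def)
    show "O.commuting_family n P" using P by (simp add: O.commuting_family_def commuting_family_def)
    show "- e * - e = 1" using e2 by simp
    show "ad (opposite A) (P i) (Q j) = (if i = j then - e else 0) \<odot>\<^bsub>opposite A\<^esub> \<one>\<^bsub>opposite A\<^esub>"
      if "i \<in> {1..n}" "j \<in> {1..n}" for i j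
      using ad_opposite[OF P_closed[OF that(1)] Q_closed[OF that(2)]] by (simp add: PQ[OF that] smult_smult)
  qed
qed

text \<open>This gives access to the normal form in which the \<open>p\<^sub>i\<close> precede the \<open>q\<^sub>i\<close>.\<close>

lemma weyl_family_swap: "weyl_family A n P Q (- e)"
proof
  show "- e * - e = 1" using e2 by simp
  show "ad A (Q i) (P j) = (if i = j then - e else 0) \<odot> \<one>" if "i \<in> {1..n}" "j \<in> {1..n}" for i j
    using QP[OF that] by (auto split: if_splits)
qed (rule Q P)+

end

section \<open>Higher derivations and the projection onto the constants\<close>

lemma sub_mult_div: "(a - b * q) div b = a div b - (q :: nat)" if "b > 0"
proof (cases "b * q \<le> a")
  case True
  then have "a = b * q + (a - b * q)" by simp
  then have "a div b = q + (a - b * q) div b" using that by (metis div_mult_self4 less_not_refl2)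
  then show ?thesis by simp
next
  case False
  then have "a div b < q" using that by (simp add: less_mult_imp_div_less mult.commute)
  then show ?thesis using False by simp
qed

lemma exponents_fun_upd: "\<epsilon> \<in> exponents I \<Longrightarrow> i \<in> I \<Longrightarrow> \<epsilon>(i := k) \<in> exponents I"
  by (auto simp: exponents_def)

lemma carrier_poly_algebra: "f \<in> carrier (poly_algebra I) \<longleftrightarrow> keys f \<subseteq> exponents I"
  by (simp add: poly_algebra_def carrier_monoid_algebra exponent_monoid_def)

locale polynomial_subalgebra = unital_algebra A for A :: "('k::field, 'a) module" (structure) +
  fixes s p :: nat and x :: "nat \<Rightarrow> 'a"
  assumes char: "CHAR('k) = p" and p: "p > 0" and x: "commuting_family s x"
    and independent: "inj_on (poly_value A s x) (carrier (poly_algebra {1..s}))"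
begin

abbreviation "E \<equiv> exponents {1..s}"

abbreviation mon :: "(nat \<Rightarrow> nat) \<Rightarrow> 'a" where "mon \<equiv> monomial_in A s x"

lemma mon_closed [simp]: "mon \<epsilon> \<in> carrier A"
  using commuting_familyD(1)[OF x] by simp

lemma poly_value_lincomb: "poly_value A s x f = lincomb A mon f"
  by (simp add: poly_value_def lincomb_def)

definition Z :: "'a set" where
  "Z = {lincomb A mon f | f. keys f \<subseteq> E}"

lemma Z_subspace: "vector_subspace A Z"
  unfolding Z_def by (rule vector_subspace_lincombs) simp

lemma mon_Z [simp]: "\<epsilon> \<in> E \<Longrightarrow> mon \<epsilon> \<in> Z"
  unfolding Z_def by (rule lincomb_generator[where g = mon]) auto

lemma Z_carrier: "z \<in> Z \<Longrightarrow> z \<in> carrier A"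
  using Z_subspace by (auto simp: vector_subspace_def)

lemma Z_smult: "z \<in> Z \<Longrightarrow> c \<odot> z \<in> Z"
  using Z_subspace by (auto simp: vector_subspace_def)

text \<open>
  Higher derivations depend on coordinates and are linear on \<open>Z\<close> only; stability of \<open>Z\<close> makes such
  operators composable.
\<close>

definition Z_operator :: "('a \<Rightarrow> 'a) \<Rightarrow> bool" where
  "Z_operator F \<longleftrightarrow> linear_map_on A Z A F \<and> (\<forall>z\<in>Z. F z \<in> Z)"

lemma Z_operator_lincomb:
  "Z_operator F \<Longrightarrow> (\<And>i. i \<in> keys f \<Longrightarrow> g i \<in> Z) \<Longrightarrow>
    F (lincomb A g f) = lincomb A (\<lambda>i. F (g i)) f"
  by (rule linear_map_on_lincomb[OF unital_algebra_axioms Z_subspace]) (auto simp: Z_operator_def)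

lemma Z_operator_smult: "Z_operator F \<Longrightarrow> z \<in> Z \<Longrightarrow> F (c \<odot> z) = c \<odot> F z"
  by (simp add: Z_operator_def linear_map_on_def)

lemma Z_operator_comp: "Z_operator F \<Longrightarrow> Z_operator G \<Longrightarrow> Z_operator (\<lambda>z. F (G z))"
  by (auto simp: Z_operator_def linear_map_on_def)

lemma Z_operator_id: "Z_operator (\<lambda>z. z)"
  using Z_carrier by (auto simp: Z_operator_def linear_map_on_def)

lemma Z_operator_funpow: "Z_operator F \<Longrightarrow> Z_operator (F ^^ j)"
proof (induction j)
  case 0
  show ?case using Z_operator_id by (simp add: id_def)
next
  case (Suc j)
  then show ?case using Z_operator_comp[of F "F ^^ j"] by (simp add: o_def)
qed

lemma Z_operator_foldr:
  assumes "\<And>i. i \<in> set xs \<Longrightarrow> Z_operator (F i)"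
  shows "Z_operator (foldr F xs)"
  using assms
proof (induction xs)
  case Nil
  show ?case using Z_operator_id by (simp add: id_def)
next
  case (Cons i xs)
  then show ?case using Z_operator_comp[of "F i" "foldr F xs"] by (simp add: o_def)
qed

text \<open>
  A formula for all coefficient functions \<open>f\<close> entails linearity, because both linear
  combinations depend linearly on \<open>f\<close>.
\<close>

lemma Z_operatorI:
  assumes F: "\<And>f. keys f \<subseteq> E \<Longrightarrow> F (lincomb A mon f) = lincomb A g f"
    and g: "\<And>\<epsilon>. \<epsilon> \<in> E \<Longrightarrow> g \<epsilon> \<in> Z"
  shows "Z_operator F" and "\<epsilon> \<in> E \<Longrightarrow> F (mon \<epsilon>) = g \<epsilon>"
proof -
  have gc: "g \<epsilon> \<in> carrier A" if "keys f \<subseteq> E" "\<epsilon> \<in> keys f" for f :: "(nat \<Rightarrow> nat) \<Rightarrow>\<^sub>0 'k" and \<epsilon>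
    using that g Z_carrier by blast
  show "Z_operator F"
    unfolding Z_operator_def linear_map_on_def
  proof (intro conjI ballI allI)
    fix z assume "z \<in> Z"
    then obtain f where f: "z = lincomb A mon f" "keys f \<subseteq> E" by (auto simp: Z_def)
    have Fz: "F z = lincomb A g f" unfolding f by (rule F[OF f(2)])
    show "F z \<in> Z" unfolding Fz by (rule subspace_lincomb[OF Z_subspace]) (use f(2) g in blast)
    then show "F z \<in> carrier A" by (rule Z_carrier)
    {
      fix w assume "w \<in> Z"
      then obtain h where h: "w = lincomb A mon h" "keys h \<subseteq> E" by (auto simp: Z_def)
      have Fw: "F w = lincomb A g h" unfolding h by (rule F[OF h(2)])
      have fh: "keys (f + h) \<subseteq> E" using Poly_Mapping.keys_add[of f h] f h by blast
      have "z \<oplus> w = lincomb A mon (f + h)" unfolding f h by (rule lincomb_add[symmetric]) simp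
      then have "F (z \<oplus> w) = lincomb A g (f + h)" using F[OF fh] by simp
      also have "\<dots> = F z \<oplus> F w"
        unfolding Fz Fw by (rule lincomb_add) (use gc f(2) h(2) in blast)
      finally show "F (z \<oplus> w) = F z \<oplus> F w" .
    }
    fix c
    have cf: "keys (pscale c f) \<subseteq> E" using keys_pscale[of c f] f by blast
    have "c \<odot> z = lincomb A mon (pscale c f)" unfolding f by (rule lincomb_pscale[symmetric]) simp
    then have "F (c \<odot> z) = lincomb A g (pscale c f)" using F[OF cf] by simp
    also have "\<dots> = c \<odot> F z" unfolding Fz by (rule lincomb_pscale) (use gc f(2) in blast)
    finally show "F (c \<odot> z) = c \<odot> F z" .
  qed
  assume \<epsilon>: "\<epsilon> \<in> E"
  have "mon \<epsilon> = lincomb A mon (single \<epsilon> 1)" by (simp add: lincomb_single)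
  then have "F (mon \<epsilon>) = lincomb A g (single \<epsilon> 1)"
    using F[of "single \<epsilon> 1"] \<epsilon> by simp
  then show "F (mon \<epsilon>) = g \<epsilon>" using Z_carrier[OF g[OF \<epsilon>]] by (simp add: lincomb_single)
qed

text \<open>
  By independence, the coordinates of a linear combination of monomials are its coefficients.
\<close>

lemma hderiv_lincomb:
  assumes i: "i \<in> {1..s}" and f: "keys f \<subseteq> E"
  shows "hderiv A s x i j (lincomb A mon f)
    = lincomb A (\<lambda>\<epsilon>. of_nat (\<epsilon> i choose j) \<odot> mon (\<epsilon>(i := \<epsilon> i - j))) f"
proof -
  have "z_coords A s x (lincomb A mon f) = f"
    unfolding z_coords_def poly_value_lincomb[symmetric]
    by (rule inv_into_f_f[OF independent]) (use f in \<open>simp add: carrier_poly_algebra\<close>)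
  then have "hderiv A s x i j (lincomb A mon f) = lincomb A mon (poly_hderiv i j f)"
    by (simp add: hderiv_def poly_value_lincomb)
  also have "\<dots> = (\<Oplus>\<epsilon>\<in>keys f. lincomb A mon
      (single (\<epsilon>(i := \<epsilon> i - j)) (of_nat (\<epsilon> i choose j) * lookup f \<epsilon>)))"
    unfolding poly_hderiv_def by (rule lincomb_sum) auto
  also have "\<dots> = lincomb A (\<lambda>\<epsilon>. of_nat (\<epsilon> i choose j) \<odot> mon (\<epsilon>(i := \<epsilon> i - j))) f"
    unfolding lincomb_def[of A _ f]
    by (rule finsum_cong') (auto simp: lincomb_single smult_smult mult.commute)
  finally show ?thesis .
qed

lemma hderiv_operator: "i \<in> {1..s} \<Longrightarrow> Z_operator (hderiv A s x i j)"
  by (rule Z_operatorI(1)[OF hderiv_lincomb]) (assumption | intro Z_smult mon_Z exponents_fun_upd)+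

lemma hderiv_mon:
  "i \<in> {1..s} \<Longrightarrow> \<epsilon> \<in> E \<Longrightarrow> hderiv A s x i j (mon \<epsilon>) = of_nat (\<epsilon> i choose j) \<odot> mon (\<epsilon>(i := \<epsilon> i - j))"
  by (rule Z_operatorI(2)[OF hderiv_lincomb]) (assumption | intro Z_smult mon_Z exponents_fun_upd)+

text \<open>
  Since \<open>(\<epsilon>\<^sub>i choose p\<^sup>k)\<close> is \<open>\<epsilon>\<^sub>i div p\<^sup>k\<close> in \<open>K\<close>, and since lowering \<open>\<epsilon>\<^sub>i\<close> by \<open>p\<^sup>k\<close> lowers this quotient by
  \<open>1\<close>, the operator differentiates as if \<open>\<epsilon>\<^sub>i div p\<^sup>k\<close> were the exponent.
\<close>

lemma hderiv_pow_mon: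
  assumes i: "i \<in> {1..s}" and \<epsilon>: "\<epsilon> \<in> E"
  shows "(hderiv A s x i (p ^ k) ^^ j) (mon \<epsilon>)
    = of_nat (fact j * (\<epsilon> i div p ^ k choose j)) \<odot> mon (\<epsilon>(i := \<epsilon> i - p ^ k * j))"
proof (induction j)
  case 0
  show ?case by simp
next
  case (Suc j)
  let ?d = "\<epsilon> i div p ^ k" and ?\<eta> = "\<epsilon>(i := \<epsilon> i - p ^ k * j)"
  have \<eta>: "?\<eta> \<in> E" using \<epsilon> i by (rule exponents_fun_upd)
  have pk: "p ^ k > 0" using p by simp
  have "(of_nat (?\<eta> i choose p ^ k) :: 'k) = of_nat (?d - j)"
    using of_nat_choose_prime_power[where 'k = 'k, of "?\<eta> i" k] char p sub_mult_div[OF pk, of "\<epsilon> i" j] by simp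
  moreover have "?\<eta>(i := ?\<eta> i - p ^ k) = \<epsilon>(i := \<epsilon> i - p ^ k * Suc j)" by (simp add: add.commute)
  ultimately have "hderiv A s x i (p ^ k) (mon ?\<eta>) = of_nat (?d - j) \<odot> mon (\<epsilon>(i := \<epsilon> i - p ^ k * Suc j))"
    using hderiv_mon[OF i \<eta>] by metis
  then have "(hderiv A s x i (p ^ k) ^^ Suc j) (mon \<epsilon>)
      = (of_nat (fact j * (?d choose j)) * of_nat (?d - j)) \<odot> mon (\<epsilon>(i := \<epsilon> i - p ^ k * Suc j))"
    by (simp only: funpow.simps o_apply Suc Z_operator_smult[OF hderiv_operator[OF i] mon_Z[OF \<eta>]]
        smult_smult[OF mon_closed])
  also have "of_nat (fact j * (?d choose j)) * of_nat (?d - j) = (of_nat (fact j * ((?d - j) * (?d choose j))) :: 'k)"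
    by (simp only: of_nat_mult mult_ac)
  also have "\<dots> = of_nat (fact (Suc j) * (?d choose Suc j))"
    unfolding Suc_times_choose_Suc[symmetric] by (simp only: fact_Suc mult_ac of_nat_id)
  finally show ?case .
qed

text \<open>
  The truncated series for the exponent \<open>\<epsilon>\<^sub>i div p\<^sup>k\<close>.  The factor tests whether digit number \<open>k\<close> of
  \<open>\<epsilon>\<^sub>i\<close> in base \<open>p\<close> vanishes.
\<close>

lemma phi_level_mon:
  assumes i: "i \<in> {1..s}" and \<epsilon>: "\<epsilon> \<in> E"
  shows "phi_level A p s x i k (mon \<epsilon>) = (if p dvd \<epsilon> i div p ^ k then 1 else 0) \<odot> mon \<epsilon>"
  unfolding phi_level_def
proof (rule truncated_series[OF char p, where G = "\<lambda>j y. x i [^] (p ^ k * j) \<otimes> y"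
      and F = "\<lambda>j. (hderiv A s x i (p ^ k) ^^ j) (mon \<epsilon>)" and d = "\<lambda>j. 1"])
  have xi: "x i \<in> carrier A" using commuting_familyD(1)[OF x] i by auto
  show "(hderiv A s x i (p ^ k) ^^ j) (mon \<epsilon>)
      = (1 * of_nat (fact j * (\<epsilon> i div p ^ k choose j))) \<odot> mon (\<epsilon>(i := \<epsilon> i - p ^ k * j))" for j
    using hderiv_pow_mon[OF i \<epsilon>, where k = k and j = j] by simp
  show "linear_op (\<lambda>y. x i [^] (p ^ k * j) \<otimes> y)" for j
    by (intro linear_map_on_lmult linear_op_id nat_pow_closed xi)
  show "x i [^] (p ^ k * j) \<otimes> mon (\<epsilon>(i := \<epsilon> i - p ^ k * j)) = mon \<epsilon>" if "j \<le> \<epsilon> i div p ^ k" for j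
  proof -
    have "p ^ k * j \<le> p ^ k * (\<epsilon> i div p ^ k)" using that by simp
    also have "\<dots> \<le> \<epsilon> i" by simp
    finally show ?thesis by (simp add: monomial_mult_var[OF x i])
  qed
qed auto

lemma phi_level_operator:
  assumes i: "i \<in> {1..s}"
  shows "Z_operator (phi_level A p s x i k)"
proof -
  have xi: "x i \<in> carrier A" using commuting_familyD(1)[OF x] i by auto
  have lin: "linear_map_on A Z A (phi_level A p s x i k)"
    unfolding phi_level_def[abs_def]
  proof (intro linear_map_on_finsum linear_map_on_smult linear_map_on_lmult)
    show "linear_map_on A Z A (\<lambda>u. (hderiv A s x i (p ^ k) ^^ j) u)" for j
      using Z_operator_funpow[OF hderiv_operator[OF i]] by (simp add: Z_operator_def)
  qed (use xi in auto)
  have "phi_level A p s x i k z \<in> Z" if z: "z \<in> Z" for z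
  proof -
    obtain f where f: "z = lincomb A mon f" "keys f \<subseteq> E" using z by (auto simp: Z_def)
    have "phi_level A p s x i k z = lincomb A (\<lambda>\<epsilon>. phi_level A p s x i k (mon \<epsilon>)) f"
      unfolding f(1) by (rule linear_map_on_lincomb[OF unital_algebra_axioms Z_subspace lin]) (use f(2) in auto)
    also have "\<dots> \<in> Z"
    proof (rule subspace_lincomb[OF Z_subspace])
      fix \<epsilon> assume "\<epsilon> \<in> keys f"
      then have "\<epsilon> \<in> E" using f(2) by blast
      then show "phi_level A p s x i k (mon \<epsilon>) \<in> Z" by (simp add: phi_level_mon[OF i] Z_smult)
    qed
    finally show ?thesis .
  qed
  with lin show ?thesis by (simp add: Z_operator_def)
qed

lemma fold_phi_level_operator: "i \<in> {1..s} \<Longrightarrow> Z_operator (fold (phi_level A p s x i) xs)"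
  using Z_operator_foldr[of "rev xs" "phi_level A p s x i"] phi_level_operator by (simp add: foldr_conv_fold)

text \<open>
  The lowest \<open>N\<close> digits of \<open>\<epsilon>\<^sub>i\<close> vanish exactly if \<open>p\<^sup>N\<close> divides \<open>\<epsilon>\<^sub>i\<close>.
\<close>

lemma fold_phi_level_mon:
  assumes i: "i \<in> {1..s}" and \<epsilon>: "\<epsilon> \<in> E"
  shows "fold (phi_level A p s x i) [0..<N] (mon \<epsilon>) = (if p ^ N dvd \<epsilon> i then 1 else 0) \<odot> mon \<epsilon>"
proof (induction N)
  case 0
  then show ?case by simp
next
  case (Suc N)
  have "fold (phi_level A p s x i) [0..<Suc N] (mon \<epsilon>)
      = phi_level A p s x i N ((if p ^ N dvd \<epsilon> i then 1 else 0) \<odot> mon \<epsilon>)"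
    using Suc by simp
  also have "\<dots> = (if p ^ N dvd \<epsilon> i then 1 else 0) \<odot> ((if p dvd \<epsilon> i div p ^ N then 1 else 0) \<odot> mon \<epsilon>)"
    using Z_operator_smult[OF phi_level_operator[OF i] mon_Z[OF \<epsilon>]] phi_level_mon[OF i \<epsilon>] by metis
  also have "\<dots> = (if p ^ Suc N dvd \<epsilon> i then 1 else 0) \<odot> mon \<epsilon>"
  proof -
    have "p ^ Suc N dvd \<epsilon> i \<longleftrightarrow> p ^ N dvd \<epsilon> i \<and> p dvd \<epsilon> i div p ^ N"
    proof
      assume *: "p ^ Suc N dvd \<epsilon> i"
      then have "p ^ N dvd \<epsilon> i" by (metis dvd_mult_right power_Suc)
      moreover have "p dvd \<epsilon> i div p ^ N"
        using * p by (subst dvd_div_iff_mult) (use \<open>p ^ N dvd \<epsilon> i\<close> in \<open>auto simp: mult.commute\<close>)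
      ultimately show "p ^ N dvd \<epsilon> i \<and> p dvd \<epsilon> i div p ^ N" by blast
    next
      assume "p ^ N dvd \<epsilon> i \<and> p dvd \<epsilon> i div p ^ N"
      then show "p ^ Suc N dvd \<epsilon> i" by (metis dvd_div_mult_self mult_dvd_mono dvd_refl power_Suc)
    qed
    then show ?thesis by (auto simp: smult_smult)
  qed
  finally show ?case .
qed

text \<open>
  Once \<open>N\<close> is at least every exponent of \<open>x\<^sub>i\<close> that occurs, only the exponent \<open>0\<close> is divisible by
  \<open>p\<^sup>N\<close>, because \<open>N < p\<^sup>N\<close>.  So the composites of the first \<open>N\<close> factors are eventually constant.
\<close>

lemma phi_var_lincomb:
  assumes i: "i \<in> {1..s}" and f: "keys f \<subseteq> E"
  shows "phi_var A p s x i (lincomb A mon f) = lincomb A (\<lambda>\<epsilon>. (if \<epsilon> i = 0 then 1 else 0) \<odot> mon \<epsilon>) f"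
proof -
  let ?v = "lincomb A (\<lambda>\<epsilon>. (if \<epsilon> i = 0 then 1 else 0) \<odot> mon \<epsilon>) f"
  have "prime p" using prime_CHAR[where 'k = 'k] char p by simp
  then have p2: "p \<ge> 2" by (rule prime_ge_2_nat)
  define N0 where "N0 = Max (insert 0 ((\<lambda>\<epsilon>. \<epsilon> i) ` keys f))"
  have "fold (phi_level A p s x i) [0..<N] (lincomb A mon f) = ?v" if N: "N \<ge> N0" for N
  proof -
    have "fold (phi_level A p s x i) [0..<N] (lincomb A mon f)
        = lincomb A (\<lambda>\<epsilon>. fold (phi_level A p s x i) [0..<N] (mon \<epsilon>)) f"
      by (rule Z_operator_lincomb[OF fold_phi_level_operator[OF i]]) (use f in auto)
    also have "\<dots> = ?v"
    proof (rule lincomb_cong)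
      fix \<epsilon> assume \<epsilon>: "\<epsilon> \<in> keys f"
      then have "\<epsilon> i \<le> N0" by (auto simp: N0_def)
      also have "N0 \<le> N" by fact
      also have "N < p ^ N" using p2 by (intro power_gt_expt) auto
      finally have "p ^ N dvd \<epsilon> i \<longleftrightarrow> \<epsilon> i = 0" by (auto dest: dvd_imp_le)
      then show "fold (phi_level A p s x i) [0..<N] (mon \<epsilon>) = (if \<epsilon> i = 0 then 1 else 0) \<odot> mon \<epsilon>"
        using fold_phi_level_mon[OF i, of \<epsilon> N] \<epsilon> f by auto
    qed auto
    finally show ?thesis .
  qed
  then have ev: "\<forall>\<^sub>F N in sequentially. fold (phi_level A p s x i) [0..<N] (lincomb A mon f) = ?v"
    by (auto simp: eventually_sequentially)
  show ?thesis
    unfolding phi_var_def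
  proof (rule the_equality)
    show "\<forall>\<^sub>F N in sequentially. fold (phi_level A p s x i) [0..<N] (lincomb A mon f) = ?v" by (rule ev)
    fix v assume "\<forall>\<^sub>F N in sequentially. fold (phi_level A p s x i) [0..<N] (lincomb A mon f) = v"
    with ev have "\<forall>\<^sub>F N in sequentially. v = ?v" by eventually_elim simp
    then show "v = ?v" by simp
  qed
qed

lemma phi_var_operator: "i \<in> {1..s} \<Longrightarrow> Z_operator (phi_var A p s x i)"
  by (rule Z_operatorI(1)[OF phi_var_lincomb]) (assumption | intro Z_smult mon_Z)+

lemma phi_var_mon:
  "i \<in> {1..s} \<Longrightarrow> \<epsilon> \<in> E \<Longrightarrow> phi_var A p s x i (mon \<epsilon>) = (if \<epsilon> i = 0 then 1 else 0) \<odot> mon \<epsilon>"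
  by (rule Z_operatorI(2)[OF phi_var_lincomb]) (assumption | intro Z_smult mon_Z)+

lemma set_upt_Suc: "set [1..<Suc r] = {1..r}"
  by auto

lemma phi_Z_operator: "Z_operator (phi_Z A p s x)"
  unfolding phi_Z_def comp_prod_def
  by (rule Z_operator_foldr) (simp only: set_upt_Suc phi_var_operator)

lemma phi_Z_mon:
  assumes \<epsilon>: "\<epsilon> \<in> E"
  shows "phi_Z A p s x (mon \<epsilon>) = (if \<epsilon> = (\<lambda>i. 0) then \<one> else \<zero>)"
proof -
  have "foldr (phi_var A p s x) xs (mon \<epsilon>) = (if \<forall>i\<in>set xs. \<epsilon> i = 0 then 1 else 0) \<odot> mon \<epsilon>"
    if "set xs \<subseteq> {1..s}" for xs
    using that
  proof (induction xs)
    case (Cons i xs)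
    then have i: "i \<in> {1..s}" by simp
    have "foldr (phi_var A p s x) (i # xs) (mon \<epsilon>)
        = phi_var A p s x i ((if \<forall>i\<in>set xs. \<epsilon> i = 0 then 1 else 0) \<odot> mon \<epsilon>)"
      using Cons by simp
    also have "\<dots> = (if \<forall>i\<in>set xs. \<epsilon> i = 0 then 1 else 0) \<odot> ((if \<epsilon> i = 0 then 1 else 0) \<odot> mon \<epsilon>)"
      using Z_operator_smult[OF phi_var_operator[OF i] mon_Z[OF \<epsilon>]] phi_var_mon[OF i \<epsilon>] by metis
    finally show ?case by (simp add: smult_smult)
  qed simp
  from this[of "[1..<Suc s]"] have "phi_Z A p s x (mon \<epsilon>) = (if \<forall>i\<in>{1..s}. \<epsilon> i = 0 then 1 else 0) \<odot> mon \<epsilon>"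
    unfolding phi_Z_def comp_prod_def set_upt_Suc by simp
  moreover have "(\<forall>i\<in>{1..s}. \<epsilon> i = 0) \<longleftrightarrow> \<epsilon> = (\<lambda>i. 0)"
  proof
    assume "\<forall>i\<in>{1..s}. \<epsilon> i = 0"
    then show "\<epsilon> = (\<lambda>i. 0)" using \<epsilon> unfolding exponents_def by blast
  qed simp
  moreover have "mon (\<lambda>i. 0) = \<one>" by (rule monomial_zero[OF commuting_familyD(1)[OF x]]) simp
  ultimately show ?thesis by auto
qed

lemma hderiv_multi_operator: "Z_operator (hderiv_multi A s x \<gamma>)"
  unfolding hderiv_multi_def comp_prod_def
  by (rule Z_operator_foldr) (simp only: set_upt_Suc hderiv_operator)

lemma hderiv_multi_mon:
  assumes \<epsilon>: "\<epsilon> \<in> E"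
  shows "hderiv_multi A s x \<gamma> (mon \<epsilon>) = of_nat (\<Prod>i\<in>{1..s}. \<epsilon> i choose \<gamma> i) \<odot> mon (\<lambda>i. \<epsilon> i - \<gamma> i)"
proof -
  have "foldr (\<lambda>i. hderiv A s x i (\<gamma> i)) [1..<Suc s] (mon \<epsilon>)
      = of_nat (\<Prod>i\<in>set [1..<Suc s]. \<epsilon> i choose \<gamma> i) \<odot> mon (\<lambda>i. if i \<in> set [1..<Suc s] then \<epsilon> i - \<gamma> i else \<epsilon> i)"
  proof (rule foldr_lowering[where S = E])
    fix i c \<eta> assume "i \<in> set [1..<Suc s]" and \<eta>: "\<eta> \<in> E"
    then have i: "i \<in> {1..s}" by auto
    show "hderiv A s x i (\<gamma> i) (c \<odot> mon \<eta>) = (c * of_nat (\<eta> i choose \<gamma> i)) \<odot> mon (\<eta>(i := \<eta> i - \<gamma> i))"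
      by (simp only: Z_operator_smult[OF hderiv_operator[OF i] mon_Z[OF \<eta>]] hderiv_mon[OF i \<eta>]
          smult_smult[OF mon_closed])
  next
    fix \<eta> \<eta>' :: "nat \<Rightarrow> nat" assume \<eta>: "\<eta> \<in> E" and le: "\<And>i. \<eta>' i \<le> \<eta> i"
    have "\<eta>' i = 0" if "i \<notin> {1..s}" for i
      using \<eta> le[of i] that unfolding exponents_def by simp
    then show "\<eta>' \<in> E" unfolding exponents_def by simp
  qed (use \<epsilon> in auto)
  then have "hderiv_multi A s x \<gamma> (mon \<epsilon>)
      = of_nat (\<Prod>i\<in>{1..s}. \<epsilon> i choose \<gamma> i) \<odot> mon (\<lambda>i. if i \<in> {1..s} then \<epsilon> i - \<gamma> i else \<epsilon> i)"
    unfolding hderiv_multi_def comp_prod_def set_upt_Suc by (simp del: upt_Suc)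
  also have "mon (\<lambda>i. if i \<in> {1..s} then \<epsilon> i - \<gamma> i else \<epsilon> i) = mon (\<lambda>i. \<epsilon> i - \<gamma> i)"
    by (rule monomial_cong[OF commuting_familyD(1)[OF x]]) simp
  finally show ?thesis .
qed

lemma constant_coefficient_operator: "Z_operator (\<lambda>z. phi_Z A p s x (hderiv_multi A s x \<gamma> z))"
  by (rule Z_operator_comp[OF phi_Z_operator hderiv_multi_operator])

text \<open>
  The operator \<open>\<partial>\<^sup>[\<^sup>\<gamma>\<^sup>]\<close> kills the monomials with \<open>\<epsilon>\<^sub>i < \<gamma>\<^sub>i\<close> for some \<open>i\<close> and turns \<open>x\<^sup>\<gamma>\<close> into \<open>1\<close>; the
  projection kills all nonconstant monomials that remain.  So \<open>\<phi> \<circ> \<partial>\<^sup>[\<^sup>\<gamma>\<^sup>]\<close> reads off the coefficient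
  of \<open>x\<^sup>\<gamma>\<close>.
\<close>

lemma constant_coefficient_mon:
  assumes \<epsilon>: "\<epsilon> \<in> E" and \<gamma>: "\<gamma> \<in> E"
  shows "phi_Z A p s x (hderiv_multi A s x \<gamma> (mon \<epsilon>)) = (if \<epsilon> = \<gamma> then \<one> else \<zero>)"
proof -
  let ?\<eta> = "\<lambda>i. \<epsilon> i - \<gamma> i" and ?C = "\<Prod>i\<in>{1..s}. \<epsilon> i choose \<gamma> i"
  have \<eta>: "?\<eta> \<in> E" using \<epsilon> by (auto simp: exponents_def)
  have "phi_Z A p s x (hderiv_multi A s x \<gamma> (mon \<epsilon>)) = of_nat ?C \<odot> phi_Z A p s x (mon ?\<eta>)"
    by (simp only: hderiv_multi_mon[OF \<epsilon>] Z_operator_smult[OF phi_Z_operator mon_Z[OF \<eta>]])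
  also have "\<dots> = of_nat ?C \<odot> (if ?\<eta> = (\<lambda>i. 0) then \<one> else \<zero>)"
    by (simp only: phi_Z_mon[OF \<eta>])
  also have "\<dots> = (if \<epsilon> = \<gamma> then \<one> else \<zero>)"
  proof (cases "\<epsilon> = \<gamma>")
    case False
    have "of_nat ?C = (0 :: 'k) \<or> ?\<eta> \<noteq> (\<lambda>i. 0)"
    proof (rule disjCI)
      assume "\<not> ?\<eta> \<noteq> (\<lambda>i. 0)"
      then have le: "\<epsilon> i \<le> \<gamma> i" for i by (metis diff_is_0_eq)
      obtain i where i: "\<epsilon> i \<noteq> \<gamma> i" using False by auto
      then have "\<epsilon> i < \<gamma> i" using le[of i] by linarith
      moreover from this have "i \<in> {1..s}" using \<gamma> unfolding exponents_def by force
      ultimately have "\<exists>i\<in>{1..s}. \<epsilon> i choose \<gamma> i = 0" using binomial_eq_0 by blast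
      then have "?C = 0" by (rule prod_zero[OF finite_atLeastAtMost])
      then show "of_nat ?C = (0 :: 'k)" by (simp only: of_nat_0)
    qed
    then show ?thesis
      by (elim disjE) (simp_all only: False if_False smult_zero_right if_cancel, auto simp: False)
  qed simp
  finally show ?thesis .
qed

end

section \<open>The central generators\<close>

lemma (in unital_algebra) algebra_action_lincomb:
  assumes \<rho>: "algebra_action A \<rho>" and g: "\<And>i. i \<in> keys f \<Longrightarrow> g i \<in> carrier A"
  shows "\<rho> (lincomb A g f) v = pm_extend (\<lambda>i. \<rho> (g i) v) f"
proof -
  note \<rho> = algebra_actionD[OF \<rho>]
  have "\<rho> (\<Oplus>i\<in>I. lookup f i \<odot> g i) v = (\<Sum>i\<in>I. pscale (lookup f i) (\<rho> (g i) v))"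
    if "finite I" "I \<subseteq> keys f" for I
    using that
  proof (induction I rule: finite_induct)
    case empty
    show ?case using \<rho>(5)[OF zero_closed, of 0 v] by simp
  next
    case (insert i I)
    have gI: "\<And>j. j \<in> insert i I \<Longrightarrow> g j \<in> carrier A" using g insert.prems by blast
    have "(\<Oplus>i\<in>insert i I. lookup f i \<odot> g i)
        = lookup f i \<odot> g i \<oplus> (\<Oplus>i\<in>I. lookup f i \<odot> g i)"
      by (rule finsum_insert) (use insert gI in auto)
    moreover have "(\<Oplus>i\<in>I. lookup f i \<odot> g i) \<in> carrier A"
      by (rule finsum_closed) (use gI in auto)
    ultimately show ?case using insert gI by (simp add: \<rho>)
  qed
  then show ?thesis unfolding lincomb_def pm_extend_def by simp
qed

lemma (in unital_algebra) algebra_action_pow: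
  assumes \<rho>: "algebra_action A \<rho>" and a: "a \<in> carrier A"
  shows "\<rho> (a [^] (k::nat)) v = (\<rho> a ^^ k) v"
proof (induction k arbitrary: v)
  case (Suc k)
  then show ?case using a algebra_actionD(4)[OF \<rho>, of "a [^] k" a v]
    by (simp add: funpow_swap1)
qed (simp add: algebra_actionD(2)[OF \<rho>])

lemma (in unital_algebra) add_minus_cancel_left:
  "a \<in> carrier A \<Longrightarrow> b \<in> carrier A \<Longrightarrow> a \<oplus> b \<ominus> a = b"
  by algebra

lemma X_mult_single:
  "X i * single \<eta> c = single (\<eta>(i := \<eta> i + 1)) (c :: 'k::field)"
proof -
  have "(\<lambda>j. if j = i then 1 else 0) + \<eta> = \<eta>(i := \<eta> i + 1)" by auto
  then show ?thesis by (simp add: poly_var_def mult_single)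
qed

lemma X_mult_funpow_single:
  "((\<lambda>v. X i * v) ^^ k) (single \<eta> c) = single (\<eta>(i := \<eta> i + k)) (c :: 'k::field)"
proof (induction k)
  case (Suc k)
  have "(\<eta>(i := \<eta> i + k))(i := (\<eta>(i := \<eta> i + k)) i + 1) = \<eta>(i := \<eta> i + Suc k)"
    by (simp add: Suc_eq_plus1 add.assoc)
  then show ?case by (simp only: funpow.simps o_apply Suc X_mult_single)
qed simp

text \<open>
  As long as \<open>X\<^sub>i\<close> does not occur, its derivative contributes nothing.
\<close>

lemma shifted_derivation_funpow_single:
  assumes "\<eta> i = 0" "j \<noteq> i"
  shows "((\<lambda>v. X j * v + \<Delta> i v) ^^ k) (single \<eta> c)
    = single (\<eta>(j := \<eta> j + k)) (c :: 'k::field)"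
proof (induction k)
  case (Suc k)
  have upd: "(\<eta>(j := \<eta> j + k))(j := (\<eta>(j := \<eta> j + k)) j + 1) = \<eta>(j := \<eta> j + Suc k)"
    by (simp add: Suc_eq_plus1 add.assoc)
  have zero: "\<Delta> i (single (\<eta>(j := \<eta> j + k)) c) = 0"
    using assms by (simp add: \<Delta>_single)
  show ?case by (simp only: funpow.simps o_apply Suc zero X_mult_single upd add_0_right)
qed simp

context weyl_poly
begin

lemma weyl_family: "weyl_family A n Q D 1"
proof
  show "A.commuting_family n Q" "A.commuting_family n D"
    using gen_commutation(2,3) gen_closed(1,2) by (auto simp: A.commuting_family_def)
  show "ad A (D i) (Q j) = (if i = j then 1 else 0) \<odot>\<^bsub>A\<^esub> \<one>\<^bsub>A\<^esub>" if ij: "i \<in> {1..n}" "j \<in> {1..n}" for i j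
  proof -
    have "Q j \<otimes>\<^bsub>A\<^esub> D i \<in> carrier A" using ij by simp
    then show ?thesis
      unfolding ad_def gen_commutation(1)[OF ij] by (simp add: A.add_minus_cancel_left)
  qed
qed simp

end

locale weyl_poly_char = weyl_poly n m K for n m :: nat and K :: "'k::field itself" +
  fixes p :: nat
  assumes char: "CHAR('k) = p" and p: "p > 0"
begin

sublocale WF: weyl_family A n Q D 1
  by (rule weyl_family)

abbreviation "s \<equiv> 2*n + m"
abbreviation "x j \<equiv> (x_gen p n m j :: 'k weyl_poly)"

lemma x_cases:
  assumes "j \<in> {1..s}"
  obtains (Q) "j \<in> {1..n}" "x j = Q j [^]\<^bsub>A\<^esub> p"
    | (D) i where "i \<in> {1..n}" "j = n + i" "x j = D i [^]\<^bsub>A\<^esub> p"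
    | (t) "j \<in> {2*n+1..2*n+m}" "x j = t j"
proof -
  consider "j \<le> n" | "n < j" "j \<le> 2 * n" | "2 * n < j" by linarith
  then show ?thesis
  proof cases
    case 1
    then show ?thesis using assms by (intro Q) (auto simp: x_gen_def)
  next
    case 2
    then show ?thesis by (intro D[of "j - n"]) (auto simp: x_gen_def)
  next
    case 3
    then show ?thesis using assms by (intro t) (auto simp: x_gen_def t_gen_def)
  qed
qed

lemma t_commutant: "j \<in> {2*n+1..2*n+m} \<Longrightarrow> t j \<in> WF.commutant"
  using gen_commutation(4,5) gen_closed(3) by (simp add: WF.commutant_def del: atLeastAtMost_iff)

text \<open>
  By the Leibniz rule, \<open>ad p\<^sub>i (q\<^sub>i\<^sup>p) = p q\<^sub>i\<^sup>p\<^sup>-\<^sup>1\<close>, and \<open>p\<close> is zero in \<open>K\<close>; likewise for \<open>ad q\<^sub>i (p\<^sub>i\<^sup>p)\<close>.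
\<close>

lemma x_commutant:
  assumes "j \<in> {1..s}"
  shows "x j \<in> WF.commutant"
  using assms
proof (cases j rule: x_cases)
  case Q
  have "D i \<otimes>\<^bsub>A\<^esub> x j = x j \<otimes>\<^bsub>A\<^esub> D i" if i: "i \<in> {1..n}" for i
  proof -
    have "ad A (D i) (Q j [^]\<^bsub>A\<^esub> p) = ((if i = j then 1 else 0) * of_nat p) \<odot>\<^bsub>A\<^esub> Q j [^]\<^bsub>A\<^esub> (p - 1)"
      by (rule A.ad_pow) (use i Q WF.PQ in \<open>auto simp: gen_closed\<close>)
    also have "(of_nat p :: 'k) = 0" using char by (metis of_nat_CHAR)
    finally show ?thesis using i Q by (simp add: A.ad_eq_zero_iff)
  qed
  moreover have "Q i \<otimes>\<^bsub>A\<^esub> x j = x j \<otimes>\<^bsub>A\<^esub> Q i" if i: "i \<in> {1..n}" for i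
    unfolding Q(2) by (rule A.pow_commute) (use i Q gen_commutation(3) in \<open>auto simp: gen_closed\<close>)
  ultimately show ?thesis using Q gen_closed(1) by (simp add: WF.commutant_def del: atLeastAtMost_iff)
next
  case (D k)
  have "Q i \<otimes>\<^bsub>A\<^esub> x j = x j \<otimes>\<^bsub>A\<^esub> Q i" if i: "i \<in> {1..n}" for i
  proof -
    have "ad A (Q i) (D k [^]\<^bsub>A\<^esub> p) = ((if k = i then - 1 else 0) * of_nat p) \<odot>\<^bsub>A\<^esub> D k [^]\<^bsub>A\<^esub> (p - 1)"
      by (rule A.ad_pow) (use i D WF.QP in \<open>auto simp: gen_closed\<close>)
    also have "(of_nat p :: 'k) = 0" using char by (metis of_nat_CHAR)
    finally show ?thesis using i D by (simp add: A.ad_eq_zero_iff)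
  qed
  moreover have "D i \<otimes>\<^bsub>A\<^esub> x j = x j \<otimes>\<^bsub>A\<^esub> D i" if i: "i \<in> {1..n}" for i
    unfolding D(3) by (rule A.pow_commute) (use i D gen_commutation(2) in \<open>auto simp: gen_closed\<close>)
  ultimately show ?thesis using D gen_closed(2) by (simp add: WF.commutant_def del: atLeastAtMost_iff)
next
  case t
  then show ?thesis using t_commutant by simp
qed

lemma x_commute:
  assumes i: "i \<in> {1..s}" and j: "j \<in> {1..s}"
  shows "x i \<otimes>\<^bsub>A\<^esub> x j = x j \<otimes>\<^bsub>A\<^esub> x i"
proof -
  have pow: "z \<otimes>\<^bsub>A\<^esub> x k = x k \<otimes>\<^bsub>A\<^esub> z"
    if z: "z \<in> WF.commutant" and k: "k \<in> {1..s}" "\<not> k \<in> {2*n+1..2*n+m}" for z k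
    using k(1)
  proof (cases k rule: x_cases)
    case Q
    then show ?thesis unfolding Q(2)
      by (intro A.pow_commute) (use z in \<open>auto simp: WF.commutant_def\<close>)
  next
    case (D i)
    then show ?thesis unfolding D(3)
      by (intro A.pow_commute) (use z in \<open>auto simp: WF.commutant_def\<close>)
  qed (use k in blast)
  show ?thesis
  proof (cases "j \<in> {2*n+1..2*n+m}")
    case False
    then show ?thesis using pow[OF x_commutant[OF i] j] by simp
  next
    case jt: True
    then have xj: "x j = t j" by (simp add: x_gen_def t_gen_def)
    show ?thesis
    proof (cases "i \<in> {2*n+1..2*n+m}")
      case True
      then have "x i = t i" by (simp add: x_gen_def t_gen_def)
      then show ?thesis using xj gen_commutation(6)[OF True jt] by simp
    next
      case False
      then show ?thesis using pow[OF x_commutant[OF j] i] by simp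
    qed
  qed
qed

lemma x_commuting: "A.commuting_family s x"
  unfolding A.commuting_family_def
  using x_commute x_commutant WF.commutant_closed by blast

text \<open>
  Applied to the constant polynomial \<open>1\<close>, a monomial in the \<open>x\<^sub>j\<close> gives a monomial, and different
  monomials give different ones.  The factors act from the right, the \<open>q\<^sub>i\<close> last; hence every
  \<open>X\<^sub>n\<^sub>+\<^sub>i + \<partial>\<^sub>i\<close> meets a polynomial without \<open>X\<^sub>i\<close>, on which it is multiplication by \<open>X\<^sub>n\<^sub>+\<^sub>i\<close>.
\<close>

lemma x_independent: "inj_on (poly_value A s x) (carrier (poly_algebra {1..s}))"
proof -
  obtain \<rho> :: "'k weyl_poly \<Rightarrow> 'k poly_rep \<Rightarrow> 'k poly_rep" where act: "algebra_action A \<rho>"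
    and \<rho>Q: "\<And>i v. i \<in> {1..n} \<Longrightarrow> \<rho> (Q i) v = X i * v"
    and \<rho>D: "\<And>i v. i \<in> {1..n} \<Longrightarrow> \<rho> (D i) v = X (n + i) * v + \<Delta> i v"
    and \<rho>t: "\<And>j v. j \<in> {2*n+1..2*n+m} \<Longrightarrow> \<rho> (t j) v = X j * v"
    using A_action by blast
  note \<rho> = algebra_actionD[OF act]
  \<comment> \<open>The exponent of \<open>X\<^sub>j\<close> contributed by one factor \<open>x\<^sub>j\<close>.\<close>
  define w where "w j = (if j \<le> 2*n then p else 1)" for j
  have xc: "x j \<in> carrier A" if "j \<in> {1..s}" for j
    using WF.commutant_closed[OF x_commutant[OF that]] .
  have power: "\<rho> (x k [^]\<^bsub>A\<^esub> g) (single \<eta> 1) = single (\<eta>(k := \<eta> k + w k * g)) 1"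
    if k: "k \<in> {1..s}" and \<eta>: "\<And>i. i < k \<Longrightarrow> \<eta> i = 0" for k and g :: nat and \<eta>
    using k
  proof (cases k rule: x_cases)
    case Q
    have "x k [^]\<^bsub>A\<^esub> g = Q k [^]\<^bsub>A\<^esub> (w k * g)"
      using Q by (simp add: A.nat_pow_pow w_def)
    moreover have "\<rho> (Q k) = (\<lambda>v. X k * v)" using \<rho>Q[OF Q(1)] by (simp add: fun_eq_iff)
    ultimately show ?thesis
      by (simp only: A.algebra_action_pow[OF act gen_closed(1)[OF Q(1)]] X_mult_funpow_single)
  next
    case (D i)
    have "x k [^]\<^bsub>A\<^esub> g = D i [^]\<^bsub>A\<^esub> (w k * g)"
      using D by (simp add: A.nat_pow_pow w_def)
    moreover have "\<rho> (D i) = (\<lambda>v. X k * v + \<Delta> i v)" using \<rho>D[OF D(1)] D(2) by (simp add: fun_eq_iff)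
    moreover have "\<eta> i = 0" "k \<noteq> i" using \<eta>[of i] D(1,2) by auto
    ultimately show ?thesis
      by (simp only: A.algebra_action_pow[OF act gen_closed(2)[OF D(1)]]
          shifted_derivation_funpow_single[of \<eta> i k, OF \<open>\<eta> i = 0\<close> \<open>k \<noteq> i\<close>])
  next
    case t
    have "x k [^]\<^bsub>A\<^esub> g = t k [^]\<^bsub>A\<^esub> (w k * g)" using t by (simp add: w_def)
    moreover have "\<rho> (t k) = (\<lambda>v. X k * v)" using \<rho>t[OF t(1)] by (simp add: fun_eq_iff)
    ultimately show ?thesis
      by (simp only: A.algebra_action_pow[OF act gen_closed(3)[OF t(1)]] X_mult_funpow_single)
  qed
  define \<epsilon> where "\<epsilon> k \<gamma> j = (if k \<le> j \<and> j \<le> s then w j * \<gamma> j else 0)" for k j :: nat and \<gamma> :: "nat \<Rightarrow> nat"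
  have suffix: "\<rho> (foldr (\<lambda>i a. x i [^]\<^bsub>A\<^esub> \<gamma> i \<otimes>\<^bsub>A\<^esub> a) [k..<Suc s] \<one>\<^bsub>A\<^esub>) 1 = single (\<epsilon> k \<gamma>) 1"
    if "k \<in> {1..Suc s}" for k and \<gamma> :: "nat \<Rightarrow> nat"
    using that
  proof (induction "Suc s - k" arbitrary: k)
    case 0
    then have "k = Suc s" by auto
    moreover from this have "\<epsilon> k \<gamma> = (\<lambda>j. 0)" by (auto simp: \<epsilon>_def fun_eq_iff)
    ultimately show ?case by (simp add: \<rho>(2) single_zero_exponent)
  next
    case (Suc d)
    then have k: "k \<in> {1..s}" and "Suc k \<in> {1..Suc s}" "d = Suc s - Suc k" by auto
    then have IH: "\<rho> (foldr (\<lambda>i a. x i [^]\<^bsub>A\<^esub> \<gamma> i \<otimes>\<^bsub>A\<^esub> a) [Suc k..<Suc s] \<one>\<^bsub>A\<^esub>) 1 = single (\<epsilon> (Suc k) \<gamma>) 1"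
      using Suc.hyps(1) by blast
    have upt: "[k..<Suc s] = k # [Suc k..<Suc s]" using k by (intro upt_conv_Cons) auto
    have cl: "foldr (\<lambda>i a. x i [^]\<^bsub>A\<^esub> \<gamma> i \<otimes>\<^bsub>A\<^esub> a) [Suc k..<Suc s] \<one>\<^bsub>A\<^esub> \<in> carrier A"
      by (rule A.foldr_pow_mult(1)) (use xc k in auto)
    have "\<rho> (foldr (\<lambda>i a. x i [^]\<^bsub>A\<^esub> \<gamma> i \<otimes>\<^bsub>A\<^esub> a) [k..<Suc s] \<one>\<^bsub>A\<^esub>) 1
        = \<rho> (x k [^]\<^bsub>A\<^esub> \<gamma> k) (single (\<epsilon> (Suc k) \<gamma>) 1)"
      unfolding upt using \<rho>(4)[OF A.nat_pow_closed[OF xc[OF k]] cl] IH by simp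
    also have "\<dots> = single ((\<epsilon> (Suc k) \<gamma>)(k := \<epsilon> (Suc k) \<gamma> k + w k * \<gamma> k)) 1"
      by (rule power[OF k]) (auto simp: \<epsilon>_def)
    also have "(\<epsilon> (Suc k) \<gamma>)(k := \<epsilon> (Suc k) \<gamma> k + w k * \<gamma> k) = \<epsilon> k \<gamma>"
      using k by (auto simp: \<epsilon>_def fun_eq_iff)
    finally show ?case .
  qed
  have mon: "\<rho> (monomial_in A s x \<gamma>) 1 = single (\<epsilon> 1 \<gamma>) 1" for \<gamma>
    unfolding monomial_in_def by (rule suffix) simp
  have action_value: "\<rho> (poly_value A s x f) 1 = pm_extend (\<lambda>\<gamma>. single (\<epsilon> 1 \<gamma>) 1) f" for f
    unfolding poly_value_def lincomb_def[symmetric]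
    by (subst A.algebra_action_lincomb[OF act]) (use A.commuting_familyD(1)[OF x_commuting] in \<open>auto simp: mon\<close>)
  have inj: "\<gamma> = \<gamma>'" if "\<epsilon> 1 \<gamma> = \<epsilon> 1 \<gamma>'" "\<gamma> \<in> exponents {1..s}" "\<gamma>' \<in> exponents {1..s}" for \<gamma> \<gamma>'
  proof
    fix j
    show "\<gamma> j = \<gamma>' j"
    proof (cases "j \<in> {1..s}")
      case True
      have "\<epsilon> 1 \<gamma> j = \<epsilon> 1 \<gamma>' j" using that(1) by simp
      then show ?thesis using True p by (auto simp: \<epsilon>_def w_def split: if_splits)
    next
      case False
      then show ?thesis using that(2,3) by (simp add: exponents_def del: atLeastAtMost_iff)
    qed
  qed
  have lookup: "lookup (\<rho> (poly_value A s x f) 1) (\<epsilon> 1 \<gamma>) = lookup f \<gamma>"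
    if f: "f \<in> carrier (poly_algebra {1..s})" and \<gamma>: "\<gamma> \<in> exponents {1..s}" for f \<gamma>
  proof -
    have "lookup (\<rho> (poly_value A s x f) 1) (\<epsilon> 1 \<gamma>)
        = (\<Sum>\<gamma>'\<in>keys f. (lookup f \<gamma>' when \<epsilon> 1 \<gamma>' = \<epsilon> 1 \<gamma>))"
      by (simp add: action_value pm_extend_def lookup_sum lookup_single)
    also have "\<dots> = (\<Sum>\<gamma>'\<in>keys f. if \<gamma>' = \<gamma> then lookup f \<gamma> else 0)"
      by (rule sum.cong) (use f \<gamma> inj in \<open>auto simp: when_def carrier_poly_algebra\<close>)
    also have "\<dots> = lookup f \<gamma>" by (simp add: in_keys_iff)
    finally show ?thesis .
  qed
  show ?thesis
  proof (rule inj_onI)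
    fix f g :: "'k poly_rep"
    assume f: "f \<in> carrier (poly_algebra {1..s})" and g: "g \<in> carrier (poly_algebra {1..s})"
      and eq: "poly_value A s x f = poly_value A s x g"
    show "f = g"
    proof (rule poly_mapping_eqI)
      fix \<gamma>
      show "lookup f \<gamma> = lookup g \<gamma>"
      proof (cases "\<gamma> \<in> exponents {1..s}")
        case True
        then show ?thesis using lookup[OF f True] lookup[OF g True] eq by simp
      next
        case False
        then have "\<gamma> \<notin> keys f" "\<gamma> \<notin> keys g"
          using f g by (auto simp: carrier_poly_algebra)
        then show ?thesis by (simp add: in_keys_iff)
      qed
    qed
  qed
qed

end

section \<open>Transport along automorphisms\<close>

context
  fixes A :: "('k::field, 'a) module" and B :: "('k, 'b) module" and h
  assumes A: "unital_algebra A" and B: "unital_algebra B" and h: "h \<in> algebra_hom A B"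
begin

interpretation A: unital_algebra A by (rule A)
interpretation B: unital_algebra B by (rule B)

lemma algebra_hom_pow: "a \<in> carrier A \<Longrightarrow> h (a [^]\<^bsub>A\<^esub> (k::nat)) = h a [^]\<^bsub>B\<^esub> k"
  by (induction k) (simp_all add: algebra_homD[OF h])

lemma algebra_hom_monomial:
  assumes "y \<in> {1..r} \<rightarrow> carrier A"
  shows "h (monomial_in A r y \<epsilon>) = monomial_in B r (\<lambda>i. h (y i)) \<epsilon>"
  using assms
proof (induction r)
  case 0
  show ?case by (simp add: algebra_homD(4)[OF h])
next
  case (Suc r)
  have y: "y \<in> {1..r} \<rightarrow> carrier A" "y (Suc r) \<in> carrier A" using Suc.prems by (simp_all add: A.Pi_Suc_iff)
  have hy: "(\<lambda>i. h (y i)) \<in> {1..Suc r} \<rightarrow> carrier B" using Suc.prems algebra_homD(1)[OF h] by auto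
  show ?case
    by (simp add: A.monomial_Suc[OF Suc.prems] B.monomial_Suc[OF hy] algebra_homD(3)[OF h] y
        algebra_hom_pow Suc.IH)
qed

lemma algebra_hom_ad:
  "v \<in> carrier A \<Longrightarrow> a \<in> carrier A \<Longrightarrow> h (ad A v a) = ad B (h v) (h a)"
  by (simp add: ad_def A.a_minus_smult B.a_minus_smult algebra_homD[OF h])

lemma commuting_family_hom: "A.commuting_family r y \<Longrightarrow> B.commuting_family r (\<lambda>i. h (y i))"
  unfolding A.commuting_family_def B.commuting_family_def
  by (auto simp: algebra_homD(1)[OF h] algebra_homD(3)[OF h, symmetric] Pi_iff simp del: atLeastAtMost_iff)

lemma weyl_family_hom:
  assumes "weyl_family A n Q P e"
  shows "weyl_family B n (\<lambda>i. h (Q i)) (\<lambda>i. h (P i)) e"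
proof -
  interpret W: weyl_family A n Q P e by fact
  show ?thesis
  proof
    show "B.commuting_family n (\<lambda>i. h (Q i))" by (rule commuting_family_hom[OF W.Q])
    show "B.commuting_family n (\<lambda>i. h (P i))" by (rule commuting_family_hom[OF W.P])
    show "e * e = 1" by (rule W.e2)
    fix i j assume ij: "i \<in> {1..n}" "j \<in> {1..n}"
    then have "ad B (h (P i)) (h (Q j)) = h ((if i = j then e else 0) \<odot>\<^bsub>A\<^esub> \<one>\<^bsub>A\<^esub>)"
      by (simp only: algebra_hom_ad[symmetric] W.P_closed W.Q_closed W.PQ)
    then show "ad B (h (P i)) (h (Q j)) = (if i = j then e else 0) \<odot>\<^bsub>B\<^esub> \<one>\<^bsub>B\<^esub>"
      by (simp only: algebra_homD(5)[OF h A.one_closed] algebra_homD(4)[OF h])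
  qed
qed

end

section \<open>The operators of the inversion formula\<close>

text \<open>
  Different descriptions of the same operators agree on the carrier only, so composing and
  iterating them requires that the carrier is preserved.
\<close>

lemma foldr_agree:
  assumes "\<And>i x. i \<in> set xs \<Longrightarrow> x \<in> C \<Longrightarrow> F i x = G i x" "\<And>i x. i \<in> set xs \<Longrightarrow> x \<in> C \<Longrightarrow> G i x \<in> C"
    and "x \<in> C"
  shows "foldr F xs x = foldr G xs x \<and> foldr G xs x \<in> C"
  using assms by (induction xs) auto

lemma funpow_agree:
  assumes "\<And>x. x \<in> C \<Longrightarrow> F x = G x" "\<And>x. x \<in> C \<Longrightarrow> G x \<in> C" and "x \<in> C"
  shows "(F ^^ k) x = (G ^^ k) x \<and> (G ^^ k) x \<in> C"
  using assms by (induction k) auto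

lemma comp_prod_funpow_agree:
  assumes "\<And>i x. i \<in> {1..n} \<Longrightarrow> x \<in> C \<Longrightarrow> F i x = G i x" "\<And>i x. i \<in> {1..n} \<Longrightarrow> x \<in> C \<Longrightarrow> G i x \<in> C"
    and "x \<in> C"
  shows "comp_prod n (\<lambda>i. F i ^^ \<alpha> i) x = comp_prod n (\<lambda>i. G i ^^ \<alpha> i) x \<and> comp_prod n (\<lambda>i. G i ^^ \<alpha> i) x \<in> C"
  unfolding comp_prod_def
proof (rule foldr_agree)
  fix i y assume "i \<in> set [1..<Suc n]" and y: "y \<in> C"
  then have i: "i \<in> {1..n}" by auto
  show "(F i ^^ \<alpha> i) y = (G i ^^ \<alpha> i) y" "(G i ^^ \<alpha> i) y \<in> C"
    using funpow_agree[of C "F i" "G i" y "\<alpha> i"] assms(1,2) i y by blast+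
qed (rule assms(3))

context weyl_family
begin

lemma taylor_agree:
  assumes F: "\<And>i b. i \<in> {1..n} \<Longrightarrow> b \<in> carrier A \<Longrightarrow> F i b = e \<odot> ad A (P i) b"
    and G: "\<And>i b. i \<in> {1..n} \<Longrightarrow> b \<in> carrier A \<Longrightarrow> G i b = (- e) \<odot> ad A (Q i) b"
    and a: "a \<in> carrier A"
  shows "inverse (of_nat (multi_fact n \<alpha> * multi_fact n \<beta>)) \<odot>
      comp_prod n (\<lambda>i. F i ^^ \<alpha> i) (comp_prod n (\<lambda>j. G j ^^ \<beta> j) a) = taylor \<alpha> \<beta> a"
proof -
  have 1: "comp_prod n (\<lambda>j. G j ^^ \<beta> j) a = comp_prod n (\<lambda>j. (\<lambda>b. (- e) \<odot> ad A (Q j) b) ^^ \<beta> j) a \<and>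
      comp_prod n (\<lambda>j. (\<lambda>b. (- e) \<odot> ad A (Q j) b) ^^ \<beta> j) a \<in> carrier A"
    by (rule comp_prod_funpow_agree) (simp_all only: G smult_closed ad_closed Q_closed a)
  have "comp_prod n (\<lambda>i. F i ^^ \<alpha> i) c = comp_prod n (\<lambda>i. (\<lambda>b. e \<odot> ad A (P i) b) ^^ \<alpha> i) c"
    if "c \<in> carrier A" for c
    by (rule conjunct1[OF comp_prod_funpow_agree[where C = "carrier A"]])
      (simp_all only: F smult_closed ad_closed P_closed that)
  with 1 show ?thesis unfolding taylor_def by simp
qed

lemma Phi_delta:
  assumes "e = 1" "a \<in> carrier A"
  shows "Phi_op A p n Q P (delta_op A n Q P \<alpha> \<beta> a) = comp_prod_rev (2*n) (center_factor p) (taylor \<alpha> \<beta> a)"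
proof -
  have "Phi_factor A p n Q P = center_factor p"
    by (rule ext, unfold Phi_factor_def center_factor_def) (simp only: assms(1))
  moreover have "delta_op A n Q P \<alpha> \<beta> a = taylor \<alpha> \<beta> a"
    unfolding delta_op_def
    by (rule taylor_agree)
      (use assms in \<open>simp_all add: a_inv_smult Q_closed P_closed del: atLeastAtMost_iff\<close>)
  ultimately show ?thesis by (simp add: Phi_op_def)
qed

text \<open>
  In the opposite algebra the right factors become left factors and all commutators change sign,
  which is absorbed by the sign of the family.
\<close>

lemma Psi_delta:
  assumes e: "e = 1" and a: "a \<in> carrier A"
  shows "Psi_op A p n Q P (delta_op A n Q P \<alpha> \<beta> a)
    = comp_prod_rev (2*n) (weyl_family.center_factor (opposite A) n Q P (- 1) p)
        (weyl_family.taylor (opposite A) n Q P (- 1) \<alpha> \<beta> a)"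
proof -
  interpret O: weyl_family "opposite A" n Q P "- 1"
    using weyl_family_opposite e by simp
  have "delta_op A n Q P \<alpha> \<beta> a = O.taylor \<alpha> \<beta> a"
  proof -
    have "inverse (of_nat (multi_fact n \<alpha> * multi_fact n \<beta>)) \<odot>\<^bsub>opposite A\<^esub>
        comp_prod n (\<lambda>i. ad A (P i) ^^ \<alpha> i) (comp_prod n (\<lambda>j. (\<lambda>b. \<ominus> ad A (Q j) b) ^^ \<beta> j) a) = O.taylor \<alpha> \<beta> a"
      by (rule O.taylor_agree)
        (use a in \<open>simp_all add: ad_opposite smult_smult a_inv_smult Q_closed P_closed del: atLeastAtMost_iff\<close>)
    then show ?thesis by (simp add: delta_op_def)
  qed
  moreover have "Psi_op A p n Q P b = comp_prod_rev (2*n) (O.center_factor p) b" if b: "b \<in> carrier A" for b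
  proof -
    have "foldr (Psi_factor A p n Q P) (rev [1..<Suc (2*n)]) b = foldr (O.center_factor p) (rev [1..<Suc (2*n)]) b"
    proof (rule conjunct1[OF foldr_agree[where C = "carrier A"]])
      fix i y assume "i \<in> set (rev [1..<Suc (2*n)])" and y: "y \<in> carrier A"
      then have i: "i \<in> {1..2*n}" by auto
      then consider "i \<le> n" "i \<in> {1..n}" | "\<not> i \<le> n" "i - n \<in> {1..n}" by fastforce
      then show "Psi_factor A p n Q P i y = O.center_factor p i y"
        by cases (simp_all add: Psi_factor_def O.center_factor_def left_ad_series_opposite Q_closed P_closed y
            del: atLeastAtMost_iff)
      show "O.center_factor p i y \<in> carrier A"
        using O.linear_op_center_factor[OF i, of p] y by (simp add: linear_map_on_def)
    qed (rule b)
    then show ?thesis by (simp add: Psi_op_def comp_prod_rev_def foldr_conv_fold del: upt_Suc)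
  qed
  moreover have "O.taylor \<alpha> \<beta> a \<in> carrier A"
    using O.linear_op_taylor[of \<alpha> \<beta>] a by (simp add: linear_map_on_def)
  ultimately show ?thesis by simp
qed

end

context polynomial_subalgebra
begin

text \<open>
  The operator \<open>T\<close> isolates the part of the expansion that belongs to \<open>(\<alpha>, \<beta>)\<close>, an element of \<open>Z\<close>,
  and the operators on \<open>Z\<close> isolate the coefficient with index \<open>\<gamma>\<close> in it.
\<close>

lemma coefficient_extraction:
  assumes T: "linear_op T" and G: "\<And>t. t \<in> I \<Longrightarrow> G t \<in> carrier A"
    and TG: "\<And>a b \<gamma>. (a, b, \<gamma>) \<in> I \<Longrightarrow> \<gamma> \<in> E \<and> T (G (a, b, \<gamma>)) = (if a = \<alpha> \<and> b = \<beta> then mon \<gamma> else \<zero>)"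
    and f: "keys f \<subseteq> I" and t: "(\<alpha>, \<beta>, \<gamma>) \<in> I"
  shows "phi_Z A p s x (hderiv_multi A s x \<gamma> (T (lincomb A G f))) = lookup f (\<alpha>, \<beta>, \<gamma>) \<odot> \<one>"
proof -
  let ?R = "\<lambda>z. phi_Z A p s x (hderiv_multi A s x \<gamma> z)"
  define g where "g = (\<lambda>(a, b, \<gamma>). if a = \<alpha> \<and> b = \<beta> then mon \<gamma> else \<zero>)"
  have zero_Z: "\<zero> \<in> Z" using Z_subspace by (simp add: vector_subspace_def)
  have R0: "?R \<zero> = \<zero>"
  proof -
    have "?R (0 \<odot> \<zero>) = 0 \<odot> ?R \<zero>"
      by (rule Z_operator_smult[OF constant_coefficient_operator zero_Z])
    moreover have "?R \<zero> \<in> carrier A"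
      using constant_coefficient_operator[of \<gamma>] zero_Z by (simp add: Z_operator_def linear_map_on_def)
    ultimately show ?thesis by simp
  qed
  have gZ: "g u \<in> Z" if "u \<in> I" for u
    using TG that zero_Z by (cases u) (auto simp: g_def)
  have "T (lincomb A G f) = lincomb A (\<lambda>u. T (G u)) f"
    by (rule linear_map_on_lincomb[OF unital_algebra_axioms subspace_carrier T]) (use G f in blast)
  also have "\<dots> = lincomb A g f"
    by (rule lincomb_cong) (use TG f gZ Z_carrier in \<open>auto simp: g_def\<close>)
  finally have "?R (T (lincomb A G f)) = ?R (lincomb A g f)" by simp
  also have "\<dots> = lincomb A (\<lambda>u. ?R (g u)) f"
    by (rule Z_operator_lincomb[OF constant_coefficient_operator]) (use gZ f in blast)
  also have "\<dots> = lincomb A (\<lambda>u. if u = (\<alpha>, \<beta>, \<gamma>) then \<one> else \<zero>) f"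
  proof (rule lincomb_cong)
    fix u assume "u \<in> keys f"
    then have u: "u \<in> I" using f by blast
    obtain a b \<gamma>' where abc: "u = (a, b, \<gamma>')" by (cases u)
    have "\<gamma>' \<in> E" "\<gamma> \<in> E" using TG u t abc by blast+
    then show "?R (g u) = (if u = (\<alpha>, \<beta>, \<gamma>) then \<one> else \<zero>)"
      using R0 by (auto simp: g_def abc constant_coefficient_mon)
  qed auto
  also have "\<dots> = (\<Oplus>u\<in>insert (\<alpha>, \<beta>, \<gamma>) (keys f). lookup f u \<odot> (if u = (\<alpha>, \<beta>, \<gamma>) then \<one> else \<zero>))"
    by (rule lincomb_superset) auto
  also have "\<dots> = (\<Oplus>u\<in>insert (\<alpha>, \<beta>, \<gamma>) (keys f). if (\<alpha>, \<beta>, \<gamma>) = u then lookup f u \<odot> \<one> else \<zero>)"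
    by (rule finsum_cong') auto
  also have "\<dots> = lookup f (\<alpha>, \<beta>, \<gamma>) \<odot> \<one>"
    by (rule finsum_singleton) auto
  finally show ?thesis .
qed

end

text \<open>
  A term may vanish although its coefficient does not, so the support of \<open>F\<close> may be smaller than that
  of \<open>f\<close>; the additional summands are zero.
\<close>

lemma (in unital_algebra) is_finitary_sum_lincomb:
  assumes f: "keys f \<subseteq> I" and g: "\<And>i. i \<in> I \<Longrightarrow> g i \<in> carrier A"
    and F: "\<And>i. i \<in> I \<Longrightarrow> F i = lookup f i \<odot> g i"
  shows "is_finitary_sum A I F (lincomb A g f)"
  unfolding is_finitary_sum_def
proof (intro conjI)
  show "F ` I \<subseteq> carrier A" using F g by auto
  have sub: "{i \<in> I. F i \<noteq> \<zero>} \<subseteq> keys f" using F g by (auto simp: in_keys_iff)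
  then show "finite {i \<in> I. F i \<noteq> \<zero>}" by (rule finite_subset) simp
  show "lincomb A g f = (\<Oplus>i\<in>{i \<in> I. F i \<noteq> \<zero>}. F i)"
    unfolding lincomb_def
  proof (rule add.finprod_mono_neutral_cong_right[folded finsum_def])
    show "{i \<in> I. F i \<noteq> \<zero>} \<subseteq> keys f" by (rule sub)
    show "lookup f i \<odot> g i = \<zero>" if "i \<in> keys f - {i \<in> I. F i \<noteq> \<zero>}" for i
      using that f F by auto
    show "lookup f i \<odot> g i = F i" if "i \<in> {i \<in> I. F i \<noteq> \<zero>}" for i
      using that F by simp
    show "(\<lambda>i. lookup f i \<odot> g i) \<in> keys f \<rightarrow> carrier A"
      using f g by auto
  qed simp
qed

section \<open>The inversion formula\<close>

context weyl_poly_char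
begin

lemma Q_pow: "i \<in> {1..n} \<Longrightarrow> Q i [^]\<^bsub>A\<^esub> p = x i"
  and D_pow: "i \<in> {1..n} \<Longrightarrow> D i [^]\<^bsub>A\<^esub> p = x (n + i)"
  by (auto simp: x_gen_def)

lemma generation_x:
  assumes S: "vector_subspace A S" "\<one>\<^bsub>A\<^esub> \<in> S"
    "\<And>i a. i \<in> {1..n} \<Longrightarrow> a \<in> S \<Longrightarrow> Q i \<otimes>\<^bsub>A\<^esub> a \<in> S"
    "\<And>i a. i \<in> {1..n} \<Longrightarrow> a \<in> S \<Longrightarrow> D i \<otimes>\<^bsub>A\<^esub> a \<in> S"
    "\<And>j a. j \<in> {1..s} \<Longrightarrow> a \<in> S \<Longrightarrow> x j \<otimes>\<^bsub>A\<^esub> a \<in> S"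
  shows "carrier A \<subseteq> S"
proof (rule generation[OF S(1-4)])
  fix j a assume "j \<in> {2*n+1..2*n+m}" "a \<in> S"
  then show "t j \<otimes>\<^bsub>A\<^esub> a \<in> S" using S(5)[of j a] by (simp add: x_gen_def t_gen_def)
qed

sublocale QD: weyl_center A n Q D 1 s p x "\<lambda>i. i" "\<lambda>i. n + i"
proof
  show "carrier A \<subseteq> S"
    if "vector_subspace A S" "\<one>\<^bsub>A\<^esub> \<in> S"
      "\<And>i a. i \<in> {1..n} \<Longrightarrow> a \<in> S \<Longrightarrow> Q i \<otimes>\<^bsub>A\<^esub> a \<in> S"
      "\<And>i a. i \<in> {1..n} \<Longrightarrow> a \<in> S \<Longrightarrow> D i \<otimes>\<^bsub>A\<^esub> a \<in> S"
      "\<And>j a. j \<in> {1..s} \<Longrightarrow> a \<in> S \<Longrightarrow> x j \<otimes>\<^bsub>A\<^esub> a \<in> S" for S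
    using that by (rule generation_x)
qed (use x_commuting x_commutant p Q_pow D_pow in auto)

lemma DQ_center: "weyl_center A n D Q (- 1) s p x (\<lambda>i. n + i) (\<lambda>i. i)"
proof -
  interpret DQ: weyl_family A n D Q "- 1" by (rule WF.weyl_family_swap)
  show ?thesis
  proof
    show "x j \<in> DQ.commutant" if "j \<in> {1..s}" for j
      using x_commutant[OF that] by (auto simp: DQ.commutant_def WF.commutant_def)
    show "carrier A \<subseteq> S"
      if "vector_subspace A S" "\<one>\<^bsub>A\<^esub> \<in> S"
        "\<And>i a. i \<in> {1..n} \<Longrightarrow> a \<in> S \<Longrightarrow> D i \<otimes>\<^bsub>A\<^esub> a \<in> S"
        "\<And>i a. i \<in> {1..n} \<Longrightarrow> a \<in> S \<Longrightarrow> Q i \<otimes>\<^bsub>A\<^esub> a \<in> S"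
        "\<And>j a. j \<in> {1..s} \<Longrightarrow> a \<in> S \<Longrightarrow> x j \<otimes>\<^bsub>A\<^esub> a \<in> S" for S
      using that(1,2,4,3,5) by (rule generation_x)
  qed (use x_commuting p Q_pow D_pow in auto)
qed

abbreviation "N \<equiv> restricted_exponents p n"
abbreviation "E \<equiv> exponents {1..s}"
abbreviation "mQ \<equiv> monomial_in A n Q"
abbreviation "mD \<equiv> monomial_in A n D"
abbreviation "mx \<equiv> monomial_in A s x"

lemma mons_A_closed [simp]: "mQ \<alpha> \<in> carrier A" "mD \<alpha> \<in> carrier A" "mx \<gamma> \<in> carrier A"
  using WF.mons_closed A.commuting_familyD(1)[OF x_commuting] by auto

lemma normal_form_QD:
  assumes "b \<in> carrier A"
  shows "\<exists>f. keys f \<subseteq> N \<times> N \<times> E \<and> b = lincomb A (\<lambda>(\<alpha>, \<beta>, \<gamma>). mQ \<alpha> \<otimes>\<^bsub>A\<^esub> mD \<beta> \<otimes>\<^bsub>A\<^esub> mx \<gamma>) f"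
  using QD.normal_form[OF assms] unfolding QD.basis_def WF.B_def .

lemma normal_form_DQ:
  assumes "b \<in> carrier A"
  shows "\<exists>f. keys f \<subseteq> N \<times> N \<times> E \<and> b = lincomb A (\<lambda>(\<alpha>, \<beta>, \<gamma>). mD \<beta> \<otimes>\<^bsub>A\<^esub> mQ \<alpha> \<otimes>\<^bsub>A\<^esub> mx \<gamma>) f"
proof -
  interpret DQ: weyl_center A n D Q "- 1" s p x "\<lambda>i. n + i" "\<lambda>i. i" by (rule DQ_center)
  let ?g = "\<lambda>(\<alpha>, \<beta>, \<gamma>). mD \<beta> \<otimes>\<^bsub>A\<^esub> mQ \<alpha> \<otimes>\<^bsub>A\<^esub> mx \<gamma>"
  define S where "S = {lincomb A ?g f | f. keys f \<subseteq> N \<times> N \<times> E}"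
  have g: "?g t \<in> carrier A" for t by (cases t) simp
  have S: "vector_subspace A S" unfolding S_def by (rule A.vector_subspace_lincombs) (rule g)
  obtain f where f: "keys f \<subseteq> N \<times> N \<times> E" "b = lincomb A DQ.basis f"
    using DQ.normal_form[OF assms] by blast
  have "b \<in> S" unfolding f(2)
  proof (rule A.subspace_lincomb[OF S])
    fix t assume "t \<in> keys f"
    then obtain \<beta> \<alpha> \<gamma> where t: "t = (\<beta>, \<alpha>, \<gamma>)" "\<beta> \<in> N" "\<alpha> \<in> N" "\<gamma> \<in> E" using f(1) by blast
    have "?g (\<alpha>, \<beta>, \<gamma>) \<in> S" unfolding S_def using t g by (intro A.lincomb_generator[where g = ?g]) auto
    then show "DQ.basis t \<in> S" by (simp add: DQ.basis_def DQ.B_def t)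
  qed
  then show ?thesis unfolding S_def by blast
qed

text \<open>
  The images of the generators again form a Weyl family with central and independent \<open>x'\<^sub>j\<close>.  Hence
  the operators in the formula extract the coefficients of \<open>a = \<sigma> b\<close> with respect to the images of
  the normally ordered products, and these are the coefficients of \<open>b\<close>.
\<close>

theorem inversion_formula:
  assumes \<sigma>: "\<sigma> \<in> algebra_aut A" and a: "a \<in> carrier A"
  defines "q' \<equiv> \<lambda>i. \<sigma> (Q i)" and "d' \<equiv> \<lambda>i. \<sigma> (D i)" and "x' \<equiv> \<lambda>j. \<sigma> (x j)"
  shows "is_finitary_sum A (N \<times> N \<times> E)
      (\<lambda>(\<alpha>, \<beta>, \<gamma>). phi_Z A p s x' (hderiv_multi A s x' \<gamma> (Phi_op A p n q' d' (delta_op A n q' d' \<alpha> \<beta> a)))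
         \<otimes>\<^bsub>A\<^esub> mQ \<alpha> \<otimes>\<^bsub>A\<^esub> mD \<beta> \<otimes>\<^bsub>A\<^esub> mx \<gamma>) (inv_into (carrier A) \<sigma> a)" (is ?Phi)
    and "is_finitary_sum A (N \<times> N \<times> E)
      (\<lambda>(\<alpha>, \<beta>, \<gamma>). phi_Z A p s x' (hderiv_multi A s x' \<gamma> (Psi_op A p n q' d' (delta_op A n q' d' \<alpha> \<beta> a)))
         \<otimes>\<^bsub>A\<^esub> mD \<beta> \<otimes>\<^bsub>A\<^esub> mQ \<alpha> \<otimes>\<^bsub>A\<^esub> mx \<gamma>) (inv_into (carrier A) \<sigma> a)" (is ?Psi)
proof -
  let ?b = "inv_into (carrier A) \<sigma> a"
  have hom: "\<sigma> \<in> algebra_hom A A" and bij: "bij_betw \<sigma> (carrier A) (carrier A)"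
    using \<sigma> by (auto simp: algebra_aut_def algebra_hom_def ring_iso_def)
  note h = algebra_homD[OF hom]
  have b: "?b \<in> carrier A" "\<sigma> ?b = a"
  proof -
    have "a \<in> \<sigma> ` carrier A" using bij a by (simp add: bij_betw_def)
    then show "?b \<in> carrier A" "\<sigma> ?b = a" by (rule inv_into_into, rule f_inv_into_f)
  qed
  note AA = A.unital_algebra_axioms
  interpret W: weyl_family A n q' d' 1
    unfolding q'_def d'_def by (rule weyl_family_hom[OF AA AA hom weyl_family])
  have x'_commuting: "A.commuting_family s x'"
    unfolding x'_def by (rule commuting_family_hom[OF AA AA hom x_commuting])
  have x_Pi: "x \<in> {1..s} \<rightarrow> carrier A" by (rule A.commuting_familyD(1)[OF x_commuting])
  have x'_commutant: "x' j \<in> W.commutant" if "j \<in> {1..s}" for j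
    using x_commutant[OF that] unfolding W.commutant_def WF.commutant_def unfolding q'_def d'_def x'_def
    by (auto simp: h(1) gen_closed h(3)[symmetric] simp del: atLeastAtMost_iff)
  have \<sigma>_mons: "\<sigma> (mQ \<alpha>) = monomial_in A n q' \<alpha>" "\<sigma> (mD \<alpha>) = monomial_in A n d' \<alpha>"
      "\<sigma> (mx \<gamma>) = monomial_in A s x' \<gamma>" for \<alpha> \<gamma>
    unfolding q'_def d'_def x'_def
    by (rule algebra_hom_monomial[OF AA AA hom], rule WF.Q_Pi WF.P_Pi x_Pi)+
  have pv: "poly_value A s x' f = \<sigma> (poly_value A s x f)" for f
  proof -
    have "\<sigma> (lincomb A mx f) = lincomb A (\<lambda>\<gamma>. \<sigma> (mx \<gamma>)) f"
      by (rule A.linear_map_on_lincomb[OF AA A.subspace_carrier linear_map_on_algebra_hom[OF hom]]) simp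
    then show ?thesis by (simp add: poly_value_def lincomb_def \<sigma>_mons)
  qed
  interpret PS: polynomial_subalgebra A s p x'
  proof
    show "inj_on (poly_value A s x') (carrier (poly_algebra {1..s}))"
    proof (rule inj_onI)
      fix f g :: "'k poly_rep"
      assume fg: "f \<in> carrier (poly_algebra {1..s})" "g \<in> carrier (poly_algebra {1..s})"
        and eq: "poly_value A s x' f = poly_value A s x' g"
      have "poly_value A s x f \<in> carrier A" for f :: "'k poly_rep"
        unfolding poly_value_def lincomb_def[symmetric] by (rule A.lincomb_closed) simp
      then have "poly_value A s x f = poly_value A s x g"
        using eq bij unfolding pv by (auto simp: bij_betw_def dest: inj_onD)
      then show "f = g" by (rule inj_onD[OF x_independent]) (rule fg)+
    qed
  qed (rule char p x'_commuting)+
  have mon'_commutant: "PS.mon \<gamma> \<in> W.commutant" for \<gamma>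
    using x'_commuting x'_commutant by (rule W.commutant_monomial)
  \<comment> \<open>Common to both orders of the generators: \<open>u\<close>, \<open>v\<close> are the two noncentral factors of the products
    in the chosen order, and \<open>T \<alpha> \<beta>\<close> is the operator that isolates the central part.\<close>
  have half: "is_finitary_sum A (N \<times> N \<times> E)
      (\<lambda>(\<alpha>, \<beta>, \<gamma>). phi_Z A p s x' (hderiv_multi A s x' \<gamma> (T \<alpha> \<beta> a)) \<otimes>\<^bsub>A\<^esub> u \<alpha> \<beta> \<otimes>\<^bsub>A\<^esub> v \<alpha> \<beta> \<otimes>\<^bsub>A\<^esub> mx \<gamma>) ?b"
    if span: "\<exists>f. keys f \<subseteq> N \<times> N \<times> E \<and> ?b = lincomb A (\<lambda>(\<alpha>, \<beta>, \<gamma>). u \<alpha> \<beta> \<otimes>\<^bsub>A\<^esub> v \<alpha> \<beta> \<otimes>\<^bsub>A\<^esub> mx \<gamma>) f"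
      and uv: "\<And>\<alpha> \<beta>. u \<alpha> \<beta> \<in> carrier A" "\<And>\<alpha> \<beta>. v \<alpha> \<beta> \<in> carrier A"
      and T: "\<And>\<alpha> \<beta>. A.linear_op (T \<alpha> \<beta>)"
      and Tuv: "\<And>\<alpha> \<beta> a b \<gamma>. a \<in> N \<Longrightarrow> b \<in> N \<Longrightarrow> \<alpha> \<in> N \<Longrightarrow> \<beta> \<in> N \<Longrightarrow>
        T \<alpha> \<beta> (\<sigma> (u a b \<otimes>\<^bsub>A\<^esub> v a b \<otimes>\<^bsub>A\<^esub> mx \<gamma>)) = (if a = \<alpha> \<and> b = \<beta> then PS.mon \<gamma> else \<zero>\<^bsub>A\<^esub>)"
    for T u v
  proof -
    define g where "g = (\<lambda>(\<alpha>, \<beta>, \<gamma>). u \<alpha> \<beta> \<otimes>\<^bsub>A\<^esub> v \<alpha> \<beta> \<otimes>\<^bsub>A\<^esub> mx \<gamma>)"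
    have g: "g t \<in> carrier A" for t using uv by (cases t) (simp add: g_def)
    obtain f where f: "keys f \<subseteq> N \<times> N \<times> E" "?b = lincomb A g f"
      using span unfolding g_def by blast
    have "a = \<sigma> (lincomb A g f)" using b(2) f(2) by simp
    also have "\<dots> = lincomb A (\<lambda>t. \<sigma> (g t)) f"
      by (rule A.linear_map_on_lincomb[OF AA A.subspace_carrier linear_map_on_algebra_hom[OF hom]]) (rule g)
    finally have a': "a = lincomb A (\<lambda>t. \<sigma> (g t)) f" .
    have coeff: "phi_Z A p s x' (hderiv_multi A s x' \<gamma> (T \<alpha> \<beta> a)) = lookup f (\<alpha>, \<beta>, \<gamma>) \<odot>\<^bsub>A\<^esub> \<one>\<^bsub>A\<^esub>"
      if t: "(\<alpha>, \<beta>, \<gamma>) \<in> N \<times> N \<times> E" for \<alpha> \<beta> \<gamma>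
      unfolding a'
      by (rule PS.coefficient_extraction[OF T h(1)[OF g] _ f(1) t]) (use t Tuv in \<open>simp add: g_def\<close>)
    show ?thesis
      unfolding f(2)
      by (rule A.is_finitary_sum_lincomb[OF f(1) g])
        (auto simp: coeff g_def uv A.smult_mult_left A.m_assoc)
  qed
  have "is_finitary_sum A (N \<times> N \<times> E)
      (\<lambda>(\<alpha>, \<beta>, \<gamma>). phi_Z A p s x' (hderiv_multi A s x' \<gamma> (comp_prod_rev (2*n) (W.center_factor p) (W.taylor \<alpha> \<beta> a)))
         \<otimes>\<^bsub>A\<^esub> mQ \<alpha> \<otimes>\<^bsub>A\<^esub> mD \<beta> \<otimes>\<^bsub>A\<^esub> mx \<gamma>) ?b"
  proof (rule half[OF normal_form_QD[OF b(1)]])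
    show "A.linear_op (\<lambda>y. comp_prod_rev (2*n) (W.center_factor p) (W.taylor \<alpha> \<beta> y))" for \<alpha> \<beta>
      by (rule A.linear_op_comp[OF W.linear_op_center W.linear_op_taylor])
    have "\<sigma> (mQ a \<otimes>\<^bsub>A\<^esub> mD b \<otimes>\<^bsub>A\<^esub> mx \<gamma>) = W.B a b (PS.mon \<gamma>)" for a b \<gamma>
      by (simp add: W.B_def h(3) \<sigma>_mons)
    then show "comp_prod_rev (2*n) (W.center_factor p) (W.taylor \<alpha> \<beta> (\<sigma> (mQ a \<otimes>\<^bsub>A\<^esub> mD b \<otimes>\<^bsub>A\<^esub> mx \<gamma>)))
        = (if a = \<alpha> \<and> b = \<beta> then PS.mon \<gamma> else \<zero>\<^bsub>A\<^esub>)"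
      if "a \<in> N" "b \<in> N" "\<alpha> \<in> N" "\<beta> \<in> N" for \<alpha> \<beta> a b \<gamma>
      using that W.center_coefficient[OF char p mon'_commutant] by simp
  qed simp_all
  then show ?Phi unfolding W.Phi_delta[OF refl a] .
  interpret O: weyl_family "opposite A" n q' d' "- 1"
    using W.weyl_family_opposite by simp
  have "is_finitary_sum A (N \<times> N \<times> E)
      (\<lambda>(\<alpha>, \<beta>, \<gamma>). phi_Z A p s x' (hderiv_multi A s x' \<gamma> (comp_prod_rev (2*n) (O.center_factor p) (O.taylor \<alpha> \<beta> a)))
         \<otimes>\<^bsub>A\<^esub> mD \<beta> \<otimes>\<^bsub>A\<^esub> mQ \<alpha> \<otimes>\<^bsub>A\<^esub> mx \<gamma>) ?b"
  proof (rule half[OF normal_form_DQ[OF b(1)]])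
    show "A.linear_op (\<lambda>y. comp_prod_rev (2*n) (O.center_factor p) (O.taylor \<alpha> \<beta> y))" for \<alpha> \<beta>
      using O.linear_op_comp[OF O.linear_op_center O.linear_op_taylor] by simp
    have mon_O: "PS.mon \<gamma> \<in> O.commutant" for \<gamma>
      using mon'_commutant[of \<gamma>] by (auto simp: W.commutant_def O.commutant_def)
    have "\<sigma> (mD b \<otimes>\<^bsub>A\<^esub> mQ a \<otimes>\<^bsub>A\<^esub> mx \<gamma>) = O.B a b (PS.mon \<gamma>)" for a b \<gamma>
    proof -
      let ?q = "monomial_in A n q' a" and ?d = "monomial_in A n d' b" and ?z = "PS.mon \<gamma>"
      have "\<sigma> (mD b \<otimes>\<^bsub>A\<^esub> mQ a \<otimes>\<^bsub>A\<^esub> mx \<gamma>) = ?d \<otimes>\<^bsub>A\<^esub> (?q \<otimes>\<^bsub>A\<^esub> ?z)"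
        by (simp add: h(3) \<sigma>_mons A.m_assoc)
      also have "?q \<otimes>\<^bsub>A\<^esub> ?z = ?z \<otimes>\<^bsub>A\<^esub> ?q"
        by (rule W.commutant_commutes(1)[OF mon'_commutant, symmetric])
      also have "?d \<otimes>\<^bsub>A\<^esub> (?z \<otimes>\<^bsub>A\<^esub> ?q) = (?d \<otimes>\<^bsub>A\<^esub> ?z) \<otimes>\<^bsub>A\<^esub> ?q"
        by (simp add: A.m_assoc)
      also have "?d \<otimes>\<^bsub>A\<^esub> ?z = ?z \<otimes>\<^bsub>A\<^esub> ?d"
        by (rule W.commutant_commutes(2)[OF mon'_commutant, symmetric])
      also have "(?z \<otimes>\<^bsub>A\<^esub> ?d) \<otimes>\<^bsub>A\<^esub> ?q = O.B a b ?z"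
        by (simp add: O.B_def A.monomial_opposite[OF W.Q] A.monomial_opposite[OF W.P] A.m_assoc)
      finally show ?thesis .
    qed
    then show "comp_prod_rev (2*n) (O.center_factor p) (O.taylor \<alpha> \<beta> (\<sigma> (mD b \<otimes>\<^bsub>A\<^esub> mQ a \<otimes>\<^bsub>A\<^esub> mx \<gamma>)))
        = (if a = \<alpha> \<and> b = \<beta> then PS.mon \<gamma> else \<zero>\<^bsub>A\<^esub>)"
      if "a \<in> N" "b \<in> N" "\<alpha> \<in> N" "\<beta> \<in> N" for \<alpha> \<beta> a b \<gamma>
      using that O.center_coefficient[OF char p mon_O] by simp
  qed simp_all
  then show ?Psi unfolding W.Psi_delta[OF refl a] .
qed

end

theorem theorem9p2:
  fixes p n m :: nat
    and \<sigma> :: "'k::field weyl_poly \<Rightarrow> 'k weyl_poly"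
    and a :: "'k weyl_poly"
  assumes char: "CHAR('k) = p" and "p > 0"
    and \<sigma>: "\<sigma> \<in> algebra_aut (weyl_poly_algebra n m)"
    and a: "a \<in> carrier (weyl_poly_algebra n m)"
  shows
    "let A = weyl_poly_algebra n m :: ('k, 'k weyl_poly) module;
         s = 2*n + m;
         q = q_gen n m; pg = p_gen n m; x = x_gen p n m;
         q' = (\<lambda>i. \<sigma> (q i)); pg' = (\<lambda>i. \<sigma> (pg i)); x' = (\<lambda>j. \<sigma> (x j));
         N = restricted_exponents p n;
         I = N \<times> N \<times> exponents {1..s}
     in is_finitary_sum A I
          (\<lambda>(\<alpha>, \<beta>, \<gamma>).
             phi_Z A p s x' (hderiv_multi A s x' \<gamma>
               (Phi_op A p n q' pg' (delta_op A n q' pg' \<alpha> \<beta> a)))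
             \<otimes>\<^bsub>A\<^esub> monomial_in A n q \<alpha> \<otimes>\<^bsub>A\<^esub> monomial_in A n pg \<beta> \<otimes>\<^bsub>A\<^esub> monomial_in A s x \<gamma>)
          (inv_into (carrier A) \<sigma> a)
      \<and> is_finitary_sum A I
          (\<lambda>(\<alpha>, \<beta>, \<gamma>).
             phi_Z A p s x' (hderiv_multi A s x' \<gamma>
               (Psi_op A p n q' pg' (delta_op A n q' pg' \<alpha> \<beta> a)))
             \<otimes>\<^bsub>A\<^esub> monomial_in A n pg \<beta> \<otimes>\<^bsub>A\<^esub> monomial_in A n q \<alpha> \<otimes>\<^bsub>A\<^esub> monomial_in A s x \<gamma>)
          (inv_into (carrier A) \<sigma> a)"
proof -
  interpret weyl_poly_char n m "TYPE('k)" p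
    using assms(1,2) by unfold_locales
  show ?thesis
    unfolding Let_def using inversion_formula[OF \<sigma> a] by blast
qed

end
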